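(* Let $N\ge 1$ and let threads $1,\dots,N$ share the Dynamic Elimination-Combining Stack (DECS), i.e. the concurrent object whose operations $\mathtt{push}(d)$ and $\mathtt{pop}()$ are executed by the DECS pseudo-code given in the context, starting from the initial state given there. Then DECS is a linearizable implementation of a stack object: for every execution in which the threads invoke $\mathtt{push}$ and $\mathtt{pop}$ operations, the resulting history of invocations and responses is linearizable with respect to the sequential specification of the (initially empty) stack.
   Context: **Sequential stack.** The state is a finite sequence $S=\langle v_0,\dots,v_n\rangle$, initially empty. $\mathrm{pop}()$: if $S$ is non-empty, returns $v_n$ and changes $S$ to $\langle v_0,\dots,v_{n-1}\rangle$; otherwise returns "empty" and leaves $S$ unchanged. $\mathrm{push}(v)$: changes $S$ to $\langle v_0,\dots,v_n,v\rangle$. *Linearizable* has the usual Herlihy–Wing meaning: each operation appears to take effect atomically at some point between its invocation and its response, consistently with the sequential specification (pending operations may be completed or dropped). **Model.** Asynchronous shared memory; each shared read, write and compare-and-swap (CAS) is atomic. $\mathrm{CAS}(\&x,a,b)$: if $x=a$, sets $x:=b$ and returns true; otherwise returns false. Variables of type Cell and multiOp are pointers to records, compared as pointers. Every record is freshly allocated and never reused for another purpose, so there is no ABA problem on pointers. Each thread executes one operation at a time. In a function body, parameters are local variables, so assigning to $mOp$ itself does not affect the caller, whereas assigning to fields of the record does. "id" denotes the identifier of the executing thread. **Records and shared variables.** Cell: fields data, next. multiOp: fields id, op $\in\{PUSH,POP\}$, length, cStatus $\in\{INIT,FINISHED,RETRY\}$, cell (a Cell), next, last (multiOps). EMPTY_CELL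 is a fixed constant Cell whose data is the "empty" indication. Globals: $CentralStack$ (Cell pointer, initially null); $collision[1..N]$ (integers, initially $EMPTY$, a value which is not a thread identifier); $location[1..N]$ (multiOp pointers, initially null). initMultiOp() (for pop), respectively initMultiOp($d$) (for push), returns a new multiOp record $r$ with $r$.id = id, $r$.op = POP (resp. PUSH), $r$.length = 1, $r$.cStatus = INIT, $r$.next = null, $r$.last = $r$, and $r$.cell empty (resp. $r$.cell a new Cell with data $d$ and next null). randomIndex() returns an arbitrary (randomly chosen) index in $\{1,\dots,N\}$. wait() is a finite delay with no effect. await($C$) repeatedly tests $C$ until it holds. In the code, "=" in statements is assignment and "==" is an equality test. **pop()**: mOp = initMultiOp(); loop forever: { if cMultiPop(mOp) return mOp.cell.data; else if collide(mOp) return mOp.cell.data }. **push(d)**: mOp = initMultiOp(d); loop forever: { if cMultiPush(mOp) return; else if collide(mOp) return }. **boolean cMultiPop(mOp)**: 1. top = CentralStack. 2. If top == null: repeat { mOp.cell = EMPTY_CELL; mOp.cStatus = FINISHED; mOp = mOp.next } until mOp == null; return true. 3. nTop = top.next; m = 1; while (nTop $\ne$ null and m < mOp.length) { nTop = nTop.next; m = m+1 }. 4. If CAS(&CentralStack, top, nTop): { mOp.cell = top; top = top.next; while (mOp.next $\neq$ null) { if top == null then mOp.next.cell = EMPTY_CELL, else { mOp.next.cell = top; top = top.next }; mOp.next.cStatus = FINISHED; mOp.next = mOp.next.next }; return true }. Otherwise return false. **boolean cMultiPush(mOp)**: top = CentralStack; mOp.last.cell.next = top; if CAS(&CentralStack,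 top, mOp.cell): { while (mOp.next $\ne$ null) { mOp.next.cStatus = FINISHED; mOp.next = mOp.next.next }; return true }; else return false. **boolean collide(mOp)**: 1. location[id] = mOp; index = randomIndex(); him = collision[index]. 2. While CAS(&collision[index], him, id) == false: him = collision[index]. 3. If him $\ne$ EMPTY: { oInfo = location[him]; if (oInfo $\neq$ null and oInfo.id $\ne$ id and oInfo.id == him): { if CAS(&location[id], mOp, null) == true, return activeCollide(mOp, oInfo); else return passiveCollide(mOp) } }. 4. wait(); if CAS(&location[id], mOp, null) == false, return passiveCollide(mOp). 5. Return false. **boolean activeCollide(aInf, pInf)**: if CAS(&location[pInf.id], pInf, aInf): { if aInf.op == pInf.op: { combine(aInf, pInf); return false } else { multiEliminate(aInf, pInf); return true } }; else return false. **boolean passiveCollide(pInf)**: aInf = location[pInf.id]; location[pInf.id] = null; if pInf.op $\ne$ aInf.op: { if pInf.op == POP then pInf.cell = aInf.cell; return true }; else { await(pInf.cStatus $\neq$ INIT); if pInf.cStatus == FINISHED return true; else { pInf.cStatus = INIT; return false } }. **combine(aInf, pInf)**: if aInf.op == PUSH: aInf.last.cell.next = pInf.cell. Then aInf.last.next = pInf; aInf.last = pInf.last; aInf.length = aInf.length + pInf.length. **multiEliminate(aInf, pInf)**: aCurr = aInf; pCurr = pInf; repeat { if aInf.op == POP then aCurr.cell = pCurr.cell, else pCurr.cell = aCurr.cell; aCurr.cStatus = FINISHED; pCurr.cStatus = FINISHED; aInf.length = aInf.length $-1$; pInf.length = pInf.length $-1$; aCurr = aCurr.next; pCurr = pCurr.next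 } until (aCurr == null or pCurr == null). Then: if aCurr $\ne$ null: { aCurr.length = aInf.length; aCurr.last = aInf.last; aCurr.cStatus = RETRY }; else if pCurr $\neq$ null: { pCurr.length = pInf.length; pCurr.last = pInf.last; pCurr.cStatus = RETRY }. *)

theory Defs
  imports Main
begin

section \<open>Histories and linearizability\<close>

datatype ('i, 'r) event = Inv nat 'i | Res nat 'r

type_synonym ('i, 'r) history = "('i, 'r) event list"

primrec ev_thread :: "('i, 'r) event \<Rightarrow> nat" where
  "ev_thread (Inv t c) = t"
| "ev_thread (Res t r) = t"

primrec is_Inv :: "('i, 'r) event \<Rightarrow> bool" where
  "is_Inv (Inv t c) = True"
| "is_Inv (Res t r) = False"

definition proj :: "('i, 'r) history \<Rightarrow> nat \<Rightarrow> ('i, 'r) history" where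
  "proj h t = filter (\<lambda>e. ev_thread e = t) h"

fun alternating :: "('i, 'r) history \<Rightarrow> bool" where
  "alternating [] = True"
| "alternating [e] = is_Inv e"
| "alternating (e # e' # h) = (is_Inv e \<and> \<not> is_Inv e' \<and> alternating h)"

definition well_formed :: "('i, 'r) history \<Rightarrow> bool" where
  "well_formed h \<longleftrightarrow> (\<forall>t. alternating (proj h t))"

text \<open>
  Removal of the pending invocations. In a well-formed history an invocation is pending
  iff it is the last event of its thread.
\<close>

primrec complete :: "('i, 'r) history \<Rightarrow> ('i, 'r) history" where
  "complete [] = []"
| "complete (e # h) =
     (if is_Inv e \<and> (\<forall>e'\<in>set h. ev_thread e' \<noteq> ev_thread e)
      then complete h else e # complete h)"

text \<open>
  An operation of a history is identified by its thread \<open>t\<close> and the number \<open>n\<close> of operations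
  that \<open>t\<close> has invoked before it. These names are the same in all equivalent histories, so that the
  precedence orders of two equivalent histories can be compared as sets of pairs of names.
\<close>

definition inv_at :: "('i, 'r) history \<Rightarrow> nat \<Rightarrow> nat \<times> nat \<Rightarrow> bool" where
  "inv_at h i = (\<lambda>(t, n). i < length h \<and> is_Inv (h ! i) \<and> ev_thread (h ! i) = t \<and>
     length (filter is_Inv (proj (take i h) t)) = n)"

definition res_at :: "('i, 'r) history \<Rightarrow> nat \<Rightarrow> nat \<times> nat \<Rightarrow> bool" where
  "res_at h i = (\<lambda>(t, n). i < length h \<and> \<not> is_Inv (h ! i) \<and> ev_thread (h ! i) = t \<and>
     length (filter (\<lambda>e. \<not> is_Inv e) (proj (take i h) t)) = n)"

definition precedence :: "('i, 'r) history \<Rightarrow> ((nat \<times> nat) \<times> (nat \<times> nat)) set" where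
  "precedence h = {(a, b). \<exists>i j. i < j \<and> res_at h i a \<and> inv_at h j b}"

text \<open>
  The complete sequential history in which the operations \<open>(t, c, r)\<close> (thread, invocation,
  response) are executed one after the other.
\<close>

definition seq_history :: "(nat \<times> 'i \<times> 'r) list \<Rightarrow> ('i, 'r) history" where
  "seq_history xs = concat (map (\<lambda>(t, c, r). [Inv t c, Res t r]) xs)"

text \<open>
  Herlihy and Wing: \<open>h\<close> can be extended by responses \<open>rs\<close> such that the completion
  of the extension is equivalent to a legal sequential history which respects the precedence order
  of that completion (so the order does not mention pending invocations that are dropped).
  The sequential specification \<open>legal\<close> is a predicate on sequences of invocation-response pairs.
\<close>

definition linearizable :: "(('i \<times> 'r) list \<Rightarrow> bool) \<Rightarrow> ('i, 'r) history \<Rightarrow> bool" where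
  "linearizable legal h \<longleftrightarrow>
     (\<exists>rs xs.
        (\<forall>e\<in>set rs. \<not> is_Inv e) \<and>
        well_formed (h @ rs) \<and>
        legal (map snd xs) \<and>
        (\<forall>t. proj (complete (h @ rs)) t = proj (seq_history xs) t) \<and>
        precedence (complete (h @ rs)) \<subseteq> precedence (seq_history xs))"


section \<open>The sequential stack\<close>

datatype 'v call = Push 'v | Pop

text \<open>\<open>Ret None\<close> is the result "empty" of a pop; \<open>Ack\<close> is the response of a push.\<close>

datatype 'v resp = Ack | Ret "'v option"

primrec stack_step :: "'v list \<Rightarrow> 'v call \<Rightarrow> 'v list \<times> 'v resp" where
  "stack_step S (Push v) = (S @ [v], Ack)"
| "stack_step S Pop = (if S = [] then (S, Ret None) else (butlast S, Ret (Some (last S))))"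

fun stack_run :: "'v list \<Rightarrow> ('v call \<times> 'v resp) list \<Rightarrow> bool" where
  "stack_run S [] = True"
| "stack_run S ((c, r) # xs) = (r = snd (stack_step S c) \<and> stack_run (fst (stack_step S c)) xs)"

definition stack_legal :: "('v call \<times> 'v resp) list \<Rightarrow> bool" where
  "stack_legal xs \<longleftrightarrow> stack_run [] xs"


section \<open>Shared memory and local variables of DECS\<close>

text \<open>
  Cell pointers and multiOp pointers are natural numbers; they index two separate heaps, which are
  stored field by field (prefixes \<open>c_\<close> for Cell and \<open>o_\<close> for multiOp). A cell whose data is \<open>None\<close>
  carries the "empty" indication. Threads are \<open>1, \<dots>, N\<close>, so \<open>EMPTY\<close> is not a thread identifier.
\<close>

type_synonym cell_ptr = nat
type_synonym op_ptr = nat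

definition null :: nat where "null = 0"
definition EMPTY_CELL :: cell_ptr where "EMPTY_CELL = 1"
definition EMPTY :: nat where "EMPTY = 0"

datatype op_type = PUSH | POP
datatype status = INIT | FINISHED | RETRY

record 'v shared =
  g_central :: cell_ptr
  g_collision :: "nat \<Rightarrow> nat"
  g_location :: "nat \<Rightarrow> op_ptr"
  c_alloc :: "cell_ptr set"
  c_data :: "cell_ptr \<Rightarrow> 'v option"
  c_next :: "cell_ptr \<Rightarrow> cell_ptr"
  o_alloc :: "op_ptr set"
  o_id :: "op_ptr \<Rightarrow> nat"
  o_op :: "op_ptr \<Rightarrow> op_type"
  o_length :: "op_ptr \<Rightarrow> int"
  o_status :: "op_ptr \<Rightarrow> status"
  o_cell :: "op_ptr \<Rightarrow> cell_ptr"
  o_next :: "op_ptr \<Rightarrow> op_ptr"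
  o_last :: "op_ptr \<Rightarrow> op_ptr"

text \<open>
  Program counters. \<open>Start\<close> is the call of initMultiOp; \<open>MPop\<close>, \<open>MPush\<close>, \<open>Col\<close>, \<open>Act\<close>, \<open>Pas\<close>,
  \<open>Comb\<close>, \<open>Elim\<close> are inside cMultiPop, cMultiPush, collide, activeCollide, passiveCollide, combine,
  multiEliminate; \<open>Load1\<close> and \<open>Load2\<close> evaluate mOp.cell.data for the result of a pop.
\<close>

datatype mpop_pc = P1 | P2 | P3 | P4 | P5 | P6 | P7 | P8 | P9 | P10 | P11 | P12 | P13 | P14 | P15
  | P16 | P17 | P18 | P19 | P20 | P21
datatype mpush_pc = U1 | U2 | U3 | U4 | U5 | U6 | U7 | U8 | U9 | U10 | U11 | U12
datatype col_pc = C1 | C2 | C3 | C4 | C5 | C6 | C7 | C8 | C9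
datatype act_pc = A1 | A2 | A3 | A4
datatype pas_pc = W1 | W2 | W3 | W4 | W5 | W6 | W7 | W8 | W9 | W10 | W11 | W12
datatype comb_pc = B1 | B2 | B3 | B4 | B5 | B6 | B7 | B8 | B9 | B10 | B11 | B12
datatype elim_pc = E1 | E2 | E3 | E4 | E5 | E6 | E7 | E8 | E9 | E10 | E11 | E12 | E13 | E14 | E15
  | E16 | E17 | E18 | E19 | E20 | E21 | E22 | E23

datatype pc =
    Idle | Start | Load1 | Load2 | Respond
  | MPop mpop_pc | MPush mpush_pc | Col col_pc | Act act_pc | Pas pas_pc | Comb comb_pc
  | Elim elim_pc

text \<open>
  \<open>l_mOp\<close> is the variable mOp of push and pop (also the parameter of collide, which does not assign
  to it); \<open>l_par\<close> is the parameter mOp of cMultiPop and cMultiPush. The fields from \<open>l_cp\<close> on hold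
  intermediate results of expressions such as mOp.next.next, whose evaluation takes several reads.
\<close>

record 'v locals =
  l_pc :: pc
  l_call :: "'v call"
  l_resp :: "'v resp"
  l_mOp :: op_ptr
  l_par :: op_ptr
  l_top :: cell_ptr
  l_nTop :: cell_ptr
  l_m :: int
  l_index :: nat
  l_him :: nat
  l_oInfo :: op_ptr
  l_aInf :: op_ptr
  l_pInf :: op_ptr
  l_aCurr :: op_ptr
  l_pCurr :: op_ptr
  l_cp :: cell_ptr
  l_cp2 :: cell_ptr
  l_op :: op_ptr
  l_id :: nat
  l_type :: op_type
  l_len :: int


section \<open>The DECS code\<close>

abbreviation goto :: "pc \<Rightarrow> 'v locals \<Rightarrow> 'v locals" where
  "goto p l \<equiv> l\<lparr>l_pc := p\<rparr>"

definition enter_loop :: "'v locals \<Rightarrow> 'v locals" where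
  "enter_loop l = (case l_call l of
     Push d \<Rightarrow> l\<lparr>l_par := l_mOp l, l_pc := MPush U1\<rparr>
   | Pop \<Rightarrow> l\<lparr>l_par := l_mOp l, l_pc := MPop P1\<rparr>)"

text \<open>How push and pop continue after cMultiPush, cMultiPop or collide has returned true.\<close>

definition finish :: "'v locals \<Rightarrow> 'v locals" where
  "finish l = (case l_call l of
     Push d \<Rightarrow> l\<lparr>l_resp := Ack, l_pc := Respond\<rparr>
   | Pop \<Rightarrow> goto Load1 l)"

definition new_op ::
  "nat \<Rightarrow> op_ptr \<Rightarrow> op_type \<Rightarrow> cell_ptr \<Rightarrow> 'v shared \<Rightarrow> 'v shared" where
  "new_op i r x c s = s\<lparr>
     o_alloc := insert r (o_alloc s),
     o_id := (o_id s)(r := i),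
     o_op := (o_op s)(r := x),
     o_length := (o_length s)(r := 1),
     o_status := (o_status s)(r := INIT),
     o_cell := (o_cell s)(r := c),
     o_next := (o_next s)(r := null),
     o_last := (o_last s)(r := r)\<rparr>"

definition new_cell :: "cell_ptr \<Rightarrow> 'v \<Rightarrow> 'v shared \<Rightarrow> 'v shared" where
  "new_cell c d s = s\<lparr>
     c_alloc := insert c (c_alloc s),
     c_data := (c_data s)(c := Some d),
     c_next := (c_next s)(c := null)\<rparr>"

text \<open>
  \<open>exec p N i l s\<close> is the set of possible results of the step that thread \<open>i\<close> takes at \<open>p\<close> in local
  state \<open>l\<close> and shared state \<open>s\<close>. Except for the allocation of fresh records, each step performs
  exactly one shared read, write or CAS, possibly fused with computations on local variables only.
  Each occurrence of a field in the pseudo-code is read separately (even if it is never changed),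
  in the order from left to right. The call wait() has no effect and needs no step of its own.
  The results for \<open>Idle\<close> and \<open>Respond\<close> are empty since these points are left by an
  invocation and by a response. The local assignments aCurr = aInf; pCurr = pInf at the start of
  multiEliminate are part of step \<open>A4\<close>.
\<close>

primrec exec_mpop ::
  "mpop_pc \<Rightarrow> nat \<Rightarrow> nat \<Rightarrow> 'v locals \<Rightarrow> 'v shared \<Rightarrow> ('v locals \<times> 'v shared) set"
where
  (* top = CentralStack; if top == null *)
  "exec_mpop P1 N i l s =
     (let v = g_central s
      in {(l\<lparr>l_top := v, l_pc := (if v = null then MPop P2 else MPop P5)\<rparr>, s)})"
  (* repeat { mOp.cell = EMPTY_CELL; mOp.cStatus = FINISHED; mOp = mOp.next } until mOp == null *)
| "exec_mpop P2 N i l s =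
     {(goto (MPop P3) l, s\<lparr>o_cell := (o_cell s)(l_par l := EMPTY_CELL)\<rparr>)}"
| "exec_mpop P3 N i l s =
     {(goto (MPop P4) l, s\<lparr>o_status := (o_status s)(l_par l := FINISHED)\<rparr>)}"
| "exec_mpop P4 N i l s =
     (let l' = l\<lparr>l_par := o_next s (l_par l)\<rparr>
      in {(if l_par l' = null then finish l' else goto (MPop P2) l', s)})"
  (* nTop = top.next; m = 1; while (nTop != null and m < mOp.length) {nTop = nTop.next; m = m+1} *)
| "exec_mpop P5 N i l s =
     (let v = c_next s (l_top l)
      in {(l\<lparr>l_nTop := v, l_m := 1, l_pc := (if v = null then MPop P8 else MPop P6)\<rparr>, s)})"
| "exec_mpop P6 N i l s =
     {(goto (if l_m l < o_length s (l_par l) then MPop P7 else MPop P8) l, s)}"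
| "exec_mpop P7 N i l s =
     (let v = c_next s (l_nTop l)
      in {(l\<lparr>l_nTop := v, l_m := l_m l + 1, l_pc := (if v = null then MPop P8 else MPop P6)\<rparr>, s)})"
  (* if CAS(&CentralStack, top, nTop) *)
| "exec_mpop P8 N i l s =
     (if g_central s = l_top l then {(goto (MPop P9) l, s\<lparr>g_central := l_nTop l\<rparr>)}
      else {(goto (Col C1) l, s)})"
  (* mOp.cell = top; top = top.next *)
| "exec_mpop P9 N i l s = {(goto (MPop P10) l, s\<lparr>o_cell := (o_cell s)(l_par l := l_top l)\<rparr>)}"
| "exec_mpop P10 N i l s = {(l\<lparr>l_top := c_next s (l_top l), l_pc := MPop P11\<rparr>, s)}"
  (* while (mOp.next != null) *)
| "exec_mpop P11 N i l s =
     {(if o_next s (l_par l) = null then finish l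
       else if l_top l = null then goto (MPop P12) l
       else goto (MPop P14) l, s)}"
  (* mOp.next.cell = EMPTY_CELL *)
| "exec_mpop P12 N i l s = {(l\<lparr>l_op := o_next s (l_par l), l_pc := MPop P13\<rparr>, s)}"
| "exec_mpop P13 N i l s =
     {(goto (MPop P17) l, s\<lparr>o_cell := (o_cell s)(l_op l := EMPTY_CELL)\<rparr>)}"
  (* mOp.next.cell = top; top = top.next *)
| "exec_mpop P14 N i l s = {(l\<lparr>l_op := o_next s (l_par l), l_pc := MPop P15\<rparr>, s)}"
| "exec_mpop P15 N i l s =
     {(goto (MPop P16) l, s\<lparr>o_cell := (o_cell s)(l_op l := l_top l)\<rparr>)}"
| "exec_mpop P16 N i l s = {(l\<lparr>l_top := c_next s (l_top l), l_pc := MPop P17\<rparr>, s)}"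
  (* mOp.next.cStatus = FINISHED; mOp.next = mOp.next.next *)
| "exec_mpop P17 N i l s = {(l\<lparr>l_op := o_next s (l_par l), l_pc := MPop P18\<rparr>, s)}"
| "exec_mpop P18 N i l s =
     {(goto (MPop P19) l, s\<lparr>o_status := (o_status s)(l_op l := FINISHED)\<rparr>)}"
| "exec_mpop P19 N i l s = {(l\<lparr>l_op := o_next s (l_par l), l_pc := MPop P20\<rparr>, s)}"
| "exec_mpop P20 N i l s = {(l\<lparr>l_op := o_next s (l_op l), l_pc := MPop P21\<rparr>, s)}"
| "exec_mpop P21 N i l s =
     {(goto (MPop P11) l, s\<lparr>o_next := (o_next s)(l_par l := l_op l)\<rparr>)}"

primrec exec_mpush ::
  "mpush_pc \<Rightarrow> nat \<Rightarrow> nat \<Rightarrow> 'v locals \<Rightarrow> 'v shared \<Rightarrow> ('v locals \<times> 'v shared) set"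
where
  (* top = CentralStack; mOp.last.cell.next = top *)
  "exec_mpush U1 N i l s = {(l\<lparr>l_top := g_central s, l_pc := MPush U2\<rparr>, s)}"
| "exec_mpush U2 N i l s = {(l\<lparr>l_op := o_last s (l_par l), l_pc := MPush U3\<rparr>, s)}"
| "exec_mpush U3 N i l s = {(l\<lparr>l_cp := o_cell s (l_op l), l_pc := MPush U4\<rparr>, s)}"
| "exec_mpush U4 N i l s = {(goto (MPush U5) l, s\<lparr>c_next := (c_next s)(l_cp l := l_top l)\<rparr>)}"
  (* if CAS(&CentralStack, top, mOp.cell) *)
| "exec_mpush U5 N i l s = {(l\<lparr>l_cp := o_cell s (l_par l), l_pc := MPush U6\<rparr>, s)}"
| "exec_mpush U6 N i l s =
     (if g_central s = l_top l then {(goto (MPush U7) l, s\<lparr>g_central := l_cp l\<rparr>)}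
      else {(goto (Col C1) l, s)})"
  (* while (mOp.next != null) { mOp.next.cStatus = FINISHED; mOp.next = mOp.next.next } *)
| "exec_mpush U7 N i l s =
     {(if o_next s (l_par l) = null then finish l else goto (MPush U8) l, s)}"
| "exec_mpush U8 N i l s = {(l\<lparr>l_op := o_next s (l_par l), l_pc := MPush U9\<rparr>, s)}"
| "exec_mpush U9 N i l s =
     {(goto (MPush U10) l, s\<lparr>o_status := (o_status s)(l_op l := FINISHED)\<rparr>)}"
| "exec_mpush U10 N i l s = {(l\<lparr>l_op := o_next s (l_par l), l_pc := MPush U11\<rparr>, s)}"
| "exec_mpush U11 N i l s = {(l\<lparr>l_op := o_next s (l_op l), l_pc := MPush U12\<rparr>, s)}"
| "exec_mpush U12 N i l s =
     {(goto (MPush U7) l, s\<lparr>o_next := (o_next s)(l_par l := l_op l)\<rparr>)}"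

primrec exec_col ::
  "col_pc \<Rightarrow> nat \<Rightarrow> nat \<Rightarrow> 'v locals \<Rightarrow> 'v shared \<Rightarrow> ('v locals \<times> 'v shared) set"
where
  (* location[id] = mOp; index = randomIndex(); him = collision[index] *)
  "exec_col C1 N i l s =
     {(goto (Col C2) l, s\<lparr>g_location := (g_location s)(i := l_mOp l)\<rparr>)}"
| "exec_col C2 N i l s =
     (\<lambda>j. (l\<lparr>l_index := j, l_him := g_collision s j, l_pc := Col C3\<rparr>, s)) ` {1..N}"
  (* while CAS(&collision[index], him, id) == false: him = collision[index]; if him != EMPTY *)
| "exec_col C3 N i l s =
     (if g_collision s (l_index l) = l_him l
      then {(goto (if l_him l \<noteq> EMPTY then Col C5 else Col C9) l,
             s\<lparr>g_collision := (g_collision s)(l_index l := i)\<rparr>)}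
      else {(goto (Col C4) l, s)})"
| "exec_col C4 N i l s = {(l\<lparr>l_him := g_collision s (l_index l), l_pc := Col C3\<rparr>, s)}"
  (* oInfo = location[him]; if (oInfo != null and oInfo.id != id and oInfo.id == him) *)
| "exec_col C5 N i l s =
     (let v = g_location s (l_him l)
      in {(l\<lparr>l_oInfo := v, l_pc := (if v \<noteq> null then Col C6 else Col C9)\<rparr>, s)})"
| "exec_col C6 N i l s = {(goto (if o_id s (l_oInfo l) \<noteq> i then Col C7 else Col C9) l, s)}"
| "exec_col C7 N i l s = {(goto (if o_id s (l_oInfo l) = l_him l then Col C8 else Col C9) l, s)}"
  (* if CAS(&location[id], mOp, null) return activeCollide(mOp, oInfo)
     else return passiveCollide(mOp) *)
| "exec_col C8 N i l s =
     (if g_location s i = l_mOp l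
      then {(l\<lparr>l_aInf := l_mOp l, l_pInf := l_oInfo l, l_pc := Act A1\<rparr>,
             s\<lparr>g_location := (g_location s)(i := null)\<rparr>)}
      else {(l\<lparr>l_pInf := l_mOp l, l_pc := Pas W1\<rparr>, s)})"
  (* wait(); if CAS(&location[id], mOp, null) == false return passiveCollide(mOp);
     return false *)
| "exec_col C9 N i l s =
     (if g_location s i = l_mOp l
      then {(enter_loop l, s\<lparr>g_location := (g_location s)(i := null)\<rparr>)}
      else {(l\<lparr>l_pInf := l_mOp l, l_pc := Pas W1\<rparr>, s)})"

primrec exec_act ::
  "act_pc \<Rightarrow> nat \<Rightarrow> nat \<Rightarrow> 'v locals \<Rightarrow> 'v shared \<Rightarrow> ('v locals \<times> 'v shared) set"
where
  (* if CAS(&location[pInf.id], pInf, aInf) *)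
  "exec_act A1 N i l s = {(l\<lparr>l_id := o_id s (l_pInf l), l_pc := Act A2\<rparr>, s)}"
| "exec_act A2 N i l s =
     (if g_location s (l_id l) = l_pInf l
      then {(goto (Act A3) l, s\<lparr>g_location := (g_location s)(l_id l := l_aInf l)\<rparr>)}
      else {(enter_loop l, s)})"
  (* if aInf.op == pInf.op: { combine(aInf, pInf); return false }
     else { multiEliminate(aInf, pInf); return true } *)
| "exec_act A3 N i l s = {(l\<lparr>l_type := o_op s (l_aInf l), l_pc := Act A4\<rparr>, s)}"
| "exec_act A4 N i l s =
     {(if l_type l = o_op s (l_pInf l) then goto (Comb B1) l
       else l\<lparr>l_aCurr := l_aInf l, l_pCurr := l_pInf l, l_pc := Elim E1\<rparr>, s)}"

primrec exec_pas ::
  "pas_pc \<Rightarrow> nat \<Rightarrow> nat \<Rightarrow> 'v locals \<Rightarrow> 'v shared \<Rightarrow> ('v locals \<times> 'v shared) set"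
where
  (* aInf = location[pInf.id]; location[pInf.id] = null *)
  "exec_pas W1 N i l s = {(l\<lparr>l_id := o_id s (l_pInf l), l_pc := Pas W2\<rparr>, s)}"
| "exec_pas W2 N i l s = {(l\<lparr>l_aInf := g_location s (l_id l), l_pc := Pas W3\<rparr>, s)}"
| "exec_pas W3 N i l s = {(l\<lparr>l_id := o_id s (l_pInf l), l_pc := Pas W4\<rparr>, s)}"
| "exec_pas W4 N i l s =
     {(goto (Pas W5) l, s\<lparr>g_location := (g_location s)(l_id l := null)\<rparr>)}"
  (* if pInf.op != aInf.op *)
| "exec_pas W5 N i l s = {(l\<lparr>l_type := o_op s (l_pInf l), l_pc := Pas W6\<rparr>, s)}"
| "exec_pas W6 N i l s =
     {(goto (if l_type l \<noteq> o_op s (l_aInf l) then Pas W7 else Pas W10) l, s)}"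
  (* if pInf.op == POP then pInf.cell = aInf.cell; return true *)
| "exec_pas W7 N i l s = {(if o_op s (l_pInf l) = POP then goto (Pas W8) l else finish l, s)}"
| "exec_pas W8 N i l s = {(l\<lparr>l_cp := o_cell s (l_aInf l), l_pc := Pas W9\<rparr>, s)}"
| "exec_pas W9 N i l s = {(finish l, s\<lparr>o_cell := (o_cell s)(l_pInf l := l_cp l)\<rparr>)}"
  (* await(pInf.cStatus != INIT); if pInf.cStatus == FINISHED return true
     else { pInf.cStatus = INIT; return false } *)
| "exec_pas W10 N i l s = {(goto (if o_status s (l_pInf l) \<noteq> INIT then Pas W11 else Pas W10) l, s)}"
| "exec_pas W11 N i l s =
     {(if o_status s (l_pInf l) = FINISHED then finish l else goto (Pas W12) l, s)}"
| "exec_pas W12 N i l s = {(enter_loop l, s\<lparr>o_status := (o_status s)(l_pInf l := INIT)\<rparr>)}"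

primrec exec_comb ::
  "comb_pc \<Rightarrow> nat \<Rightarrow> nat \<Rightarrow> 'v locals \<Rightarrow> 'v shared \<Rightarrow> ('v locals \<times> 'v shared) set"
where
  (* if aInf.op == PUSH: aInf.last.cell.next = pInf.cell *)
  "exec_comb B1 N i l s = {(goto (if o_op s (l_aInf l) = PUSH then Comb B2 else Comb B6) l, s)}"
| "exec_comb B2 N i l s = {(l\<lparr>l_op := o_last s (l_aInf l), l_pc := Comb B3\<rparr>, s)}"
| "exec_comb B3 N i l s = {(l\<lparr>l_cp := o_cell s (l_op l), l_pc := Comb B4\<rparr>, s)}"
| "exec_comb B4 N i l s = {(l\<lparr>l_cp2 := o_cell s (l_pInf l), l_pc := Comb B5\<rparr>, s)}"
| "exec_comb B5 N i l s = {(goto (Comb B6) l, s\<lparr>c_next := (c_next s)(l_cp l := l_cp2 l)\<rparr>)}"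
  (* aInf.last.next = pInf; aInf.last = pInf.last *)
| "exec_comb B6 N i l s = {(l\<lparr>l_op := o_last s (l_aInf l), l_pc := Comb B7\<rparr>, s)}"
| "exec_comb B7 N i l s = {(goto (Comb B8) l, s\<lparr>o_next := (o_next s)(l_op l := l_pInf l)\<rparr>)}"
| "exec_comb B8 N i l s = {(l\<lparr>l_op := o_last s (l_pInf l), l_pc := Comb B9\<rparr>, s)}"
| "exec_comb B9 N i l s = {(goto (Comb B10) l, s\<lparr>o_last := (o_last s)(l_aInf l := l_op l)\<rparr>)}"
  (* aInf.length = aInf.length + pInf.length *)
| "exec_comb B10 N i l s = {(l\<lparr>l_len := o_length s (l_aInf l), l_pc := Comb B11\<rparr>, s)}"
| "exec_comb B11 N i l s = {(l\<lparr>l_len := l_len l + o_length s (l_pInf l), l_pc := Comb B12\<rparr>, s)}"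
| "exec_comb B12 N i l s =
     {(enter_loop l, s\<lparr>o_length := (o_length s)(l_aInf l := l_len l)\<rparr>)}"

primrec exec_elim ::
  "elim_pc \<Rightarrow> nat \<Rightarrow> nat \<Rightarrow> 'v locals \<Rightarrow> 'v shared \<Rightarrow> ('v locals \<times> 'v shared) set"
where
  (* if aInf.op == POP then aCurr.cell = pCurr.cell, else pCurr.cell = aCurr.cell *)
  "exec_elim E1 N i l s = {(goto (if o_op s (l_aInf l) = POP then Elim E2 else Elim E4) l, s)}"
| "exec_elim E2 N i l s = {(l\<lparr>l_cp := o_cell s (l_pCurr l), l_pc := Elim E3\<rparr>, s)}"
| "exec_elim E3 N i l s = {(goto (Elim E6) l, s\<lparr>o_cell := (o_cell s)(l_aCurr l := l_cp l)\<rparr>)}"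
| "exec_elim E4 N i l s = {(l\<lparr>l_cp := o_cell s (l_aCurr l), l_pc := Elim E5\<rparr>, s)}"
| "exec_elim E5 N i l s = {(goto (Elim E6) l, s\<lparr>o_cell := (o_cell s)(l_pCurr l := l_cp l)\<rparr>)}"
  (* aCurr.cStatus = FINISHED; pCurr.cStatus = FINISHED *)
| "exec_elim E6 N i l s =
     {(goto (Elim E7) l, s\<lparr>o_status := (o_status s)(l_aCurr l := FINISHED)\<rparr>)}"
| "exec_elim E7 N i l s =
     {(goto (Elim E8) l, s\<lparr>o_status := (o_status s)(l_pCurr l := FINISHED)\<rparr>)}"
  (* aInf.length = aInf.length - 1; pInf.length = pInf.length - 1 *)
| "exec_elim E8 N i l s = {(l\<lparr>l_len := o_length s (l_aInf l), l_pc := Elim E9\<rparr>, s)}"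
| "exec_elim E9 N i l s =
     {(goto (Elim E10) l, s\<lparr>o_length := (o_length s)(l_aInf l := l_len l - 1)\<rparr>)}"
| "exec_elim E10 N i l s = {(l\<lparr>l_len := o_length s (l_pInf l), l_pc := Elim E11\<rparr>, s)}"
| "exec_elim E11 N i l s =
     {(goto (Elim E12) l, s\<lparr>o_length := (o_length s)(l_pInf l := l_len l - 1)\<rparr>)}"
  (* aCurr = aCurr.next; pCurr = pCurr.next; until (aCurr == null or pCurr == null);
     if aCurr != null ... else if pCurr != null ... *)
| "exec_elim E12 N i l s = {(l\<lparr>l_aCurr := o_next s (l_aCurr l), l_pc := Elim E13\<rparr>, s)}"
| "exec_elim E13 N i l s =
     (let l' = l\<lparr>l_pCurr := o_next s (l_pCurr l)\<rparr>
      in {(if \<not> (l_aCurr l' = null \<or> l_pCurr l' = null) then goto (Elim E1) l'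
           else if l_aCurr l' \<noteq> null then goto (Elim E14) l'
           else if l_pCurr l' \<noteq> null then goto (Elim E19) l'
           else finish l', s)})"
  (* aCurr.length = aInf.length; aCurr.last = aInf.last; aCurr.cStatus = RETRY *)
| "exec_elim E14 N i l s = {(l\<lparr>l_len := o_length s (l_aInf l), l_pc := Elim E15\<rparr>, s)}"
| "exec_elim E15 N i l s =
     {(goto (Elim E16) l, s\<lparr>o_length := (o_length s)(l_aCurr l := l_len l)\<rparr>)}"
| "exec_elim E16 N i l s = {(l\<lparr>l_op := o_last s (l_aInf l), l_pc := Elim E17\<rparr>, s)}"
| "exec_elim E17 N i l s =
     {(goto (Elim E18) l, s\<lparr>o_last := (o_last s)(l_aCurr l := l_op l)\<rparr>)}"
| "exec_elim E18 N i l s =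
     {(finish l, s\<lparr>o_status := (o_status s)(l_aCurr l := RETRY)\<rparr>)}"
  (* pCurr.length = pInf.length; pCurr.last = pInf.last; pCurr.cStatus = RETRY *)
| "exec_elim E19 N i l s = {(l\<lparr>l_len := o_length s (l_pInf l), l_pc := Elim E20\<rparr>, s)}"
| "exec_elim E20 N i l s =
     {(goto (Elim E21) l, s\<lparr>o_length := (o_length s)(l_pCurr l := l_len l)\<rparr>)}"
| "exec_elim E21 N i l s = {(l\<lparr>l_op := o_last s (l_pInf l), l_pc := Elim E22\<rparr>, s)}"
| "exec_elim E22 N i l s =
     {(goto (Elim E23) l, s\<lparr>o_last := (o_last s)(l_pCurr l := l_op l)\<rparr>)}"
| "exec_elim E23 N i l s =
     {(finish l, s\<lparr>o_status := (o_status s)(l_pCurr l := RETRY)\<rparr>)}"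

primrec exec ::
  "pc \<Rightarrow> nat \<Rightarrow> nat \<Rightarrow> 'v locals \<Rightarrow> 'v shared \<Rightarrow> ('v locals \<times> 'v shared) set"
where
  "exec Idle N i l s = {}"
| "exec Respond N i l s = {}"
| "exec Start N i l s = (case l_call l of
     Push d \<Rightarrow> {(enter_loop (l\<lparr>l_mOp := r\<rparr>), new_op i r PUSH c (new_cell c d s)) | r c.
                 r \<notin> o_alloc s \<and> c \<notin> c_alloc s}
   | Pop \<Rightarrow> {(enter_loop (l\<lparr>l_mOp := r\<rparr>), new_op i r POP null s) | r. r \<notin> o_alloc s})"
  (* return mOp.cell.data *)
| "exec Load1 N i l s = {(l\<lparr>l_cp := o_cell s (l_mOp l), l_pc := Load2\<rparr>, s)}"
| "exec Load2 N i l s = {(l\<lparr>l_resp := Ret (c_data s (l_cp l)), l_pc := Respond\<rparr>, s)}"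
| "exec (MPop p) N i l s = exec_mpop p N i l s"
| "exec (MPush p) N i l s = exec_mpush p N i l s"
| "exec (Col p) N i l s = exec_col p N i l s"
| "exec (Act p) N i l s = exec_act p N i l s"
| "exec (Pas p) N i l s = exec_pas p N i l s"
| "exec (Comb p) N i l s = exec_comb p N i l s"
| "exec (Elim p) N i l s = exec_elim p N i l s"


section \<open>Executions\<close>

text \<open>
  Initially \<open>EMPTY_CELL\<close> is the only allocated record. Treating \<open>null\<close> as
  allocated ensures that fresh pointers differ from it. The contents of unallocated records and the
  local variables of idle threads are unconstrained.
\<close>

definition initial :: "nat \<Rightarrow> (nat \<Rightarrow> 'v locals) \<Rightarrow> 'v shared \<Rightarrow> bool" where
  "initial N ls s \<longleftrightarrow>
     (\<forall>i\<in>{1..N}. l_pc (ls i) = Idle) \<and>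
     g_central s = null \<and>
     (\<forall>i\<in>{1..N}. g_collision s i = EMPTY \<and> g_location s i = null) \<and>
     c_alloc s = {null, EMPTY_CELL} \<and> c_data s EMPTY_CELL = None \<and>
     o_alloc s = {null}"

text \<open>
  \<open>decs_execution N h ls s\<close>: some finite execution of threads \<open>1, \<dots>, N\<close> produces the history \<open>h\<close>
  and ends in the local states \<open>ls\<close> and the shared state \<open>s\<close>.
\<close>

inductive decs_execution ::
  "nat \<Rightarrow> ('v call, 'v resp) history \<Rightarrow> (nat \<Rightarrow> 'v locals) \<Rightarrow> 'v shared \<Rightarrow> bool"
  for N :: nat
where
  init: "initial N ls s \<Longrightarrow> decs_execution N [] ls s"
| invoke: "\<lbrakk>decs_execution N h ls s; i \<in> {1..N}; l_pc (ls i) = Idle\<rbrakk> \<Longrightarrow>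
    decs_execution N (h @ [Inv i c]) (ls(i := (ls i)\<lparr>l_call := c, l_pc := Start\<rparr>)) s"
| step: "\<lbrakk>decs_execution N h ls s; i \<in> {1..N};
    (l', s') \<in> exec (l_pc (ls i)) N i (ls i) s\<rbrakk> \<Longrightarrow>
    decs_execution N h (ls(i := l')) s'"
| respond: "\<lbrakk>decs_execution N h ls s; i \<in> {1..N}; l_pc (ls i) = Respond\<rbrakk> \<Longrightarrow>
    decs_execution N (h @ [Res i (l_resp (ls i))]) (ls(i := goto Idle (ls i))) s"

definition decs_histories :: "nat \<Rightarrow> ('v call, 'v resp) history set" where
  "decs_histories N = {h. \<exists>ls s. decs_execution N h ls s}"

end

theory Submission
  imports Defs
begin

text \<open>
  Every operation takes effect at one of four atomic steps of the code: a multi-push at its successful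
  CAS on the central stack (in the reverse order of its list, because the first record of the list
  owns the topmost cell), a multi-pop at its successful CAS or at the read of an empty central stack,
  and two colliding lists of opposite types at the CAS by which the active thread captures the passive
  one; there the lists are eliminated pairwise, a pop directly after its push. At these points all
  operations involved are pending, and since no cell returns to the central stack, the responses they
  compute later are the ones fixed at these points.

  The proof is a simulation by a machine that linearizes one operation at a time. The code is annotated
  with ghost state that says which thread controls which multiOp records; each thread has an assertion
  for each of its program points, which is stable under the steps of the other threads because these
  write only to records they control themselves.
\<close>

section \<open>A linearizing machine\<close>

text \<open>Ownership is dynamic: a capture hands a whole list to the active thread, and
  \<open>RETRY\<close> hands the unmatched remainder to the thread of its first record. In these two
  steps one other thread loses or gains records, so its assertion is re-established directly instead
  of by stability; this is the disjunction in \<open>inv_step\<close>. Nor does ownership protect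
  the cell of a pop record, which the eliminating thread and the waiting thread may both write; this
  is harmless because each write stores a cell whose data is the response fixed before. An
  elimination has to take effect at the capture because the passive thread may read the active
  record and return before multiEliminate has begun. For the central stack the crucial set is
  \<open>gh_pub\<close>: it only grows, is closed under \<open>next\<close> up to
  \<open>null\<close>, and its \<open>next\<close> fields are frozen. The chain below a published
  cell is thus determined by that cell, and a successful CAS on the top pointer validates all that a
  multi-pop has read before. Until a cell is published, only the thread in control of its record
  writes its \<open>next\<close> field.\<close>

datatype 'v phase = Idling | Pending "'v call" | Linearized "'v call" "'v resp"

inductive linearizing ::
  "('v call, 'v resp) history \<Rightarrow> (nat \<times> 'v call \<times> 'v resp) list \<Rightarrow> 'v list \<Rightarrow> (nat \<Rightarrow> 'v phase) \<Rightarrow> bool"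
where
  linearizing_init: "linearizing [] [] [] (\<lambda>_. Idling)"
| linearizing_inv: "linearizing h L S p \<Longrightarrow> p t = Idling \<Longrightarrow>
    linearizing (h @ [Inv t c]) L S (p(t := Pending c))"
| linearizing_lin: "linearizing h L S p \<Longrightarrow> p t = Pending c \<Longrightarrow> stack_step S c = (S', r) \<Longrightarrow>
    linearizing h (L @ [(t, c, r)]) S' (p(t := Linearized c r))"
| linearizing_res: "linearizing h L S p \<Longrightarrow> p t = Linearized c r \<Longrightarrow>
    linearizing (h @ [Res t r]) L S (p(t := Idling))"

section \<open>Counting events per thread, and precedence by cuts\<close>

definition inv_count :: "('i, 'r) history \<Rightarrow> nat \<Rightarrow> nat" where
  "inv_count h t = length (filter is_Inv (proj h t))"

definition res_count :: "('i, 'r) history \<Rightarrow> nat \<Rightarrow> nat" where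
  "res_count h t = length (filter (\<lambda>e. \<not> is_Inv e) (proj h t))"

definition op_count :: "(nat \<times> 'a) list \<Rightarrow> nat \<Rightarrow> nat" where
  "op_count L t = length (filter (\<lambda>x. fst x = t) L)"

lemma proj_append [simp]: "proj (h @ h') t = proj h t @ proj h' t"
  by (simp add: proj_def)

lemma proj_Cons [simp]: "proj (e # h) t = (if ev_thread e = t then e # proj h t else proj h t)"
  by (simp add: proj_def)

lemma proj_Nil [simp]: "proj [] t = []"
  by (simp add: proj_def)

lemma seq_history_append [simp]: "seq_history (L @ L') = seq_history L @ seq_history L'"
  by (simp add: seq_history_def)

lemma seq_history_Nil [simp]: "seq_history [] = []"
  by (simp add: seq_history_def)

lemma seq_history_Cons [simp]: "seq_history ((t, c, r) # L) = Inv t c # Res t r # seq_history L"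
  by (simp add: seq_history_def)

lemma count_append [simp]:
  "inv_count (h @ h') t = inv_count h t + inv_count h' t"
  "res_count (h @ h') t = res_count h t + res_count h' t"
  "op_count (L @ L') t = op_count L t + op_count L' t"
  by (simp_all add: inv_count_def res_count_def op_count_def)

lemma count_Nil [simp]: "inv_count [] t = 0" "res_count [] t = 0" "op_count [] t = 0"
  by (simp_all add: inv_count_def res_count_def op_count_def)

lemma count_Cons [simp]:
  "inv_count (e # h) t = (if ev_thread e = t \<and> is_Inv e then 1 else 0) + inv_count h t"
  "res_count (e # h) t = (if ev_thread e = t \<and> \<not> is_Inv e then 1 else 0) + res_count h t"
  "op_count (x # L) t = (if fst x = t then 1 else 0) + op_count L t"
  by (simp_all add: inv_count_def res_count_def op_count_def)

lemma count_seq_history [simp]: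
  "inv_count (seq_history L) t = op_count L t" "res_count (seq_history L) t = op_count L t"
  by (induction L) (auto simp: seq_history_def)

text \<open>Discrete intermediate value argument: a function that grows by at most one per step
  cannot jump over \<open>n\<close>. It turns a statement about counts into the position of an
  event.\<close>

lemma count_step:
  fixes f :: "nat \<Rightarrow> nat"
  assumes "f 0 \<le> n" "n < f k" "\<And>i. f (Suc i) \<le> Suc (f i)"
  shows "\<exists>i<k. f i = n \<and> f (Suc i) = Suc n"
  using assms(2)
proof (induction k)
  case 0
  then show ?case using assms(1) by simp
next
  case (Suc k)
  show ?case
  proof (cases "n < f k")
    case True
    then show ?thesis using Suc.IH by (meson less_SucI)
  next
    case False
    then show ?thesis using Suc.prems assms(3)[of k] by (intro exI[of _ k]) auto
  qed
qed

text \<open>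
  Precedence in terms of cuts: operation \<open>n\<close> of \<open>t\<close> has responded and operation \<open>m\<close> of \<open>u\<close> has not
  been invoked before some point of the history. In this form the order can be transferred between
  \<open>h\<close>, \<open>complete h\<close> and a linearization by comparing counts of prefixes.
\<close>

lemma precedence_iff_cut:
  "((t, n), (u, m)) \<in> precedence h \<longleftrightarrow>
     (\<exists>h1 h2. h = h1 @ h2 \<and> n < res_count h1 t \<and> inv_count h1 u \<le> m \<and> m < inv_count h u)"
proof
  assume "((t, n), (u, m)) \<in> precedence h"
  then obtain i j where *: "i < j" "res_at h i (t, n)" "inv_at h j (u, m)"
    by (auto simp: precedence_def)
  have j: "j < length h" and i: "i < length h" using * by (auto simp: res_at_def inv_at_def)
  have "take j h = take i h @ (h ! i) # drop (Suc i) (take j h)"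
    using id_take_nth_drop[of i "take j h"] *(1) j by (simp add: min_def)
  then have "res_count (take j h) t = res_count (take i h @ (h ! i) # drop (Suc i) (take j h)) t"
    by simp
  then have "n < res_count (take j h) t"
    using *(2) by (simp add: res_at_def res_count_def)
  moreover have m: "inv_count (take j h) u = m" using *(3) by (simp add: inv_at_def inv_count_def)
  moreover have "h = take j h @ h ! j # drop (Suc j) h" using j by (simp add: id_take_nth_drop)
  then have "inv_count h u = inv_count (take j h @ h ! j # drop (Suc j) h) u" by simp
  then have "inv_count h u > m" using *(3) m by (simp add: inv_at_def)
  ultimately show "\<exists>h1 h2. h = h1 @ h2 \<and> n < res_count h1 t \<and> inv_count h1 u \<le> m \<and> m < inv_count h u"
    by (intro exI[of _ "take j h"] exI[of _ "drop j h"]) simp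
next
  assume "\<exists>h1 h2. h = h1 @ h2 \<and> n < res_count h1 t \<and> inv_count h1 u \<le> m \<and> m < inv_count h u"
  then obtain h1 h2 where h: "h = h1 @ h2"
    and *: "n < res_count h1 t" "inv_count h1 u \<le> m" "m < inv_count h u" by blast
  have stepR: "res_count (take (Suc i) h) t \<le> Suc (res_count (take i h) t)" for i
    by (cases "i < length h") (auto simp: take_Suc_conv_app_nth)
  have stepI: "inv_count (take (Suc i) h) u \<le> Suc (inv_count (take i h) u)" for i
    by (cases "i < length h") (auto simp: take_Suc_conv_app_nth)
  have "n < res_count (take (length h1) h) t" using * h by simp
  then obtain i where i: "i < length h1" "res_count (take i h) t = n"
    "res_count (take (Suc i) h) t = Suc n"
    using count_step[of "\<lambda>i. res_count (take i h) t" n "length h1"] stepR by auto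
  have ri: "res_at h i (t, n)"
    using i h by (auto simp: res_at_def nth_append take_Suc_conv_app_nth res_count_def split: if_splits)
  obtain j where j: "length h1 \<le> j" "j < length h" "inv_count (take j h) u = m"
      "inv_count (take (Suc j) h) u = Suc m"
  \<comment> \<open>The invocation is sought beyond the cut, so \<open>count_step\<close> is applied
    with indices shifted by \<open>length h1\<close>.\<close>
  proof -
    have "\<exists>j<length h2. inv_count (take (length h1 + j) h) u = m \<and>
        inv_count (take (length h1 + Suc j) h) u = Suc m"
    proof (rule count_step)
      show "inv_count (take (length h1 + Suc i) h) u \<le> Suc (inv_count (take (length h1 + i) h) u)" for i
        using stepI[of "length h1 + i"] by (simp only: add_Suc_right)
    qed (use * h in simp_all)
    then obtain j where "j < length h2" "inv_count (take (length h1 + j) h) u = m"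
        "inv_count (take (Suc (length h1 + j)) h) u = Suc m"
      by (auto simp only: add_Suc_right)
    then show ?thesis using that[of "length h1 + j"] h by simp
  qed
  have "inv_at h j (u, m)"
    using j by (auto simp: inv_at_def take_Suc_conv_app_nth inv_count_def split: if_splits)
  then show "((t, n), (u, m)) \<in> precedence h"
    using ri less_le_trans[OF i(1) j(1)] unfolding precedence_def by blast
qed

section \<open>Completion of histories\<close>

lemma set_complete: "set (complete h) \<subseteq> set h"
  by (induction h) auto

text \<open>An invocation is removed only if it is the last event of its thread, so a projection
  loses at most its last entry.\<close>

lemma proj_complete:
  "proj (complete h) t =
     (if proj h t \<noteq> [] \<and> is_Inv (last (proj h t)) then butlast (proj h t) else proj h t)"
proof (induction h)
  case (Cons e h)
  have "proj h (ev_thread e) = [] \<longleftrightarrow> (\<forall>e'\<in>set h. ev_thread e' \<noteq> ev_thread e)"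
    by (auto simp: proj_def filter_empty_conv)
  then show ?case using Cons by auto
qed simp

text \<open>Responses are never removed, so their counts agree on both sides of the transfer. The
  invocation counts of a thread differ only if its dropped invocation lies before the cut; since
  that is its last event, all invocations that it keeps lie before the cut as well.\<close>

lemma cut_complete:
  assumes "complete h = k1 @ k2"
  shows "\<exists>h1 h2. h = h1 @ h2 \<and> (\<forall>t. res_count k1 t = res_count h1 t) \<and>
    (\<forall>t. inv_count h1 t = inv_count k1 t \<or> inv_count k1 t = inv_count (complete h) t)"
  using assms
proof (induction h arbitrary: k1)
  case (Cons e h)
  show ?case
  proof (cases "is_Inv e \<and> (\<forall>e'\<in>set h. ev_thread e' \<noteq> ev_thread e)")
    case True
    then have "complete h = k1 @ k2" using Cons.prems by auto
    then obtain h1 h2 where *: "h = h1 @ h2" "\<forall>t. res_count k1 t = res_count h1 t"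
      "\<forall>t. inv_count h1 t = inv_count k1 t \<or> inv_count k1 t = inv_count (complete h) t"
      using Cons.IH by blast
    have "inv_count (complete h) (ev_thread e) = 0"
      using True set_complete[of h] by (fastforce simp: inv_count_def proj_def filter_empty_conv)
    then have "inv_count k1 (ev_thread e) = inv_count (complete h) (ev_thread e)"
      using \<open>complete h = k1 @ k2\<close> by simp
    with * True show ?thesis
      by (intro exI[of _ "e # h1"] exI[of _ h2]) auto
  next
    case False
    then have c: "complete (e # h) = e # complete h" by auto
    show ?thesis
    proof (cases k1)
      case Nil
      then show ?thesis by (intro exI[of _ "[]"] exI[of _ "e # h"]) simp
    next
      case (Cons a k)
      then have a: "a = e" "complete h = k @ k2" using c Cons.prems by auto
      then obtain h1 h2 where *: "h = h1 @ h2" "\<forall>t. res_count k t = res_count h1 t"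
        "\<forall>t. inv_count h1 t = inv_count k t \<or> inv_count k t = inv_count (complete h) t"
        using Cons.IH by blast
      show ?thesis using * a Cons c
        by (intro exI[of _ "e # h1"] exI[of _ h2]) auto
    qed
  qed
qed simp

section \<open>From runs of the machine to linearizability\<close>

text \<open>The machine appends at the end of \<open>L\<close> whereas \<open>stack_run\<close>
  recurses from the front; the arbitrary continuation \<open>xs\<close> from the current stack
  reconciles the two in the induction.\<close>

lemma linearizing_legal:
  assumes "linearizing h L S p" "stack_run S xs"
  shows "stack_run [] (map snd L @ xs)"
  using assms by (induction arbitrary: xs) simp_all

text \<open>The phase of a thread is exactly its discrepancy with the linearization: a pending
  operation is not yet in \<open>L\<close>, a linearized one is in \<open>L\<close> but still lacks
  its response.\<close>

lemma linearizing_proj: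
  assumes "linearizing h L S p"
  shows "case p t of
      Idling \<Rightarrow> proj h t = proj (seq_history L) t
    | Pending c \<Rightarrow> proj h t = proj (seq_history L) t @ [Inv t c]
    | Linearized c r \<Rightarrow> proj h t @ [Res t r] = proj (seq_history L) t"
  using assms
proof (induction arbitrary: t)
  case (linearizing_inv h L S p t' c)
  then show ?case using linearizing_inv.IH[of t'] linearizing_inv.IH[of t] linearizing_inv.hyps
    by (cases "p t"; cases "t = t'") auto
next
  case (linearizing_lin h L S p t' c S' r)
  then show ?case using linearizing_lin.IH[of t'] linearizing_lin.IH[of t] linearizing_lin.hyps
    by (cases "p t"; cases "t = t'") auto
next
  case (linearizing_res h L S p t' c r)
  then show ?case using linearizing_res.IH[of t'] linearizing_res.IH[of t] linearizing_res.hyps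
    by (cases "p t"; cases "t = t'") auto
qed simp

lemma linearizing_counts:
  assumes "linearizing h L S p"
  shows "res_count h t \<le> op_count L t \<and> op_count L t \<le> inv_count h t"
proof -
  have "inv_count (seq_history L) t = op_count L t" "res_count (seq_history L) t = op_count L t"
    by simp_all
  then show ?thesis
    using linearizing_proj[OF assms, of t]
    by (auto split: phase.splits simp: inv_count_def res_count_def simp del: count_seq_history
      dest: sym)
qed

text \<open>\<open>L1\<close> is what the machine had linearized at the moment when the history was
  \<open>h1\<close>. This is where real-time order enters: at that moment all operations that had
  responded were linearized, and only invoked ones were.\<close>

lemma linearizing_cut:
  assumes "linearizing h L S p" "h = h1 @ h2"
  shows "\<exists>L1 L2. L = L1 @ L2 \<and> (\<forall>t. res_count h1 t \<le> op_count L1 t \<and> op_count L1 t \<le> inv_count h1 t)"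
  using assms
proof (induction arbitrary: h2)
  case linearizing_init
  then show ?case by simp
next
  case (linearizing_inv h L S p t c)
  show ?case
  proof (cases "h2 = []")
    case True
    then show ?thesis
      using linearizing_counts[OF linearizing.linearizing_inv[OF linearizing_inv.hyps], of c]
        linearizing_inv.prems
      by (metis append_Nil2)
  next
    case False
    then obtain h3 where "h = h1 @ h3" using linearizing_inv.prems
      by (metis butlast_append butlast_snoc)
    then show ?thesis by (rule linearizing_inv.IH)
  qed
next
  case (linearizing_lin h L S p t c S' r)
  then obtain L1 L2 where "L = L1 @ L2"
    "\<forall>t. res_count h1 t \<le> op_count L1 t \<and> op_count L1 t \<le> inv_count h1 t" by blast
  then show ?case by (intro exI[of _ L1] exI[of _ "L2 @ [(t, c, r)]"]) simp
next
  case (linearizing_res h L S p t c r)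
  show ?case
  proof (cases "h2 = []")
    case True
    then show ?thesis
      using linearizing_counts[OF linearizing.linearizing_res[OF linearizing_res.hyps]]
        linearizing_res.prems
      by (metis append_Nil2)
  next
    case False
    then obtain h3 where "h = h1 @ h3" using linearizing_res.prems
      by (metis butlast_append butlast_snoc)
    then show ?thesis by (rule linearizing_res.IH)
  qed
qed

text \<open>Supplies the responses \<open>rs\<close> by which the history is extended: those of the
  operations that have taken effect but not returned.\<close>

lemma linearizing_respond_all:
  assumes "linearizing h L S p"
  shows "\<exists>rs p'. linearizing (h @ rs) L S p' \<and> (\<forall>e\<in>set rs. \<not> is_Inv e) \<and>
    (\<forall>t c r. p' t \<noteq> Linearized c r)"
proof -
  \<comment> \<open>All threads start in \<open>Idling\<close> and each step changes one phase, so
    the induction on the number of linearized threads is possible.\<close>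
  have "finite {t. p t \<noteq> Idling}"
    using assms
  proof induction
    case (linearizing_inv h L S p t c)
    then show ?case by (elim rev_finite_subset[OF finite.insertI[of _ t]]) auto
  next
    case (linearizing_lin h L S p t c S' r)
    then show ?case by (elim rev_finite_subset[OF finite.insertI[of _ t]]) auto
  next
    case (linearizing_res h L S p t c r)
    then show ?case by (elim rev_finite_subset[OF finite.insertI[of _ t]]) auto
  qed simp
  then have fin: "finite {t. \<exists>c r. p t = Linearized c r}"
    by (rule rev_finite_subset) auto
  show ?thesis using assms fin
  proof (induction "card {t. \<exists>c r. p t = Linearized c r}" arbitrary: h p)
    case 0
    then show ?case by (intro exI[of _ "[]"] exI[of _ p]) auto
  next
    case (Suc n)
    then obtain t c r where t: "p t = Linearized c r"
      by (cases "{t. \<exists>c r. p t = Linearized c r} = {}") auto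
    let ?p = "p(t := Idling)"
    have eq: "{u. \<exists>c r. ?p u = Linearized c r} = {u. \<exists>c r. p u = Linearized c r} - {t}" by auto
    have "linearizing (h @ [Res t r]) L S ?p" using Suc.prems(1) t by (rule linearizing_res)
    moreover have "n = card {u. \<exists>c r. ?p u = Linearized c r}"
      using Suc.hyps(2) Suc.prems(2) t unfolding eq by (subst card_Diff_singleton) auto
    moreover have "finite {u. \<exists>c r. ?p u = Linearized c r}" using Suc.prems(2) unfolding eq by simp
    ultimately obtain rs p' where "linearizing ((h @ [Res t r]) @ rs) L S p'" "\<forall>e\<in>set rs. \<not> is_Inv e"
      "\<forall>t c r. p' t \<noteq> Linearized c r"
      using Suc.hyps(1) by blast
    then show ?case by (intro exI[of _ "Res t r # rs"] exI[of _ p']) auto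
  qed
qed

lemma proj_seq_history_alternating:
  "alternating (proj (seq_history L) t)" "alternating (proj (seq_history L) t @ [Inv t c])"
  by (induction L) auto

lemma proj_seq_history_last:
  "proj (seq_history L) t \<noteq> [] \<Longrightarrow> \<not> is_Inv (last (proj (seq_history L) t))"
  by (induction L) (auto split: if_splits)

text \<open>Once all linearized operations have responded, the invocations that remain pending are
  exactly those without effect, and \<open>complete\<close> drops them. The order is transferred by
  carrying a cut from \<open>complete\<close> to the history and from there to
  \<open>L\<close>.\<close>

lemma linearizing_linearizable:
  assumes "linearizing h L S p"
  shows "linearizable stack_legal h"
proof -
  obtain rs p' where lin: "linearizing (h @ rs) L S p'" and rs: "\<forall>e\<in>set rs. \<not> is_Inv e"
    and p': "\<forall>t c r. p' t \<noteq> Linearized c r"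
    using linearizing_respond_all[OF assms] by blast
  let ?h = "h @ rs"
  have proj: "proj ?h t = proj (seq_history L) t \<or>
    (\<exists>c. proj ?h t = proj (seq_history L) t @ [Inv t c])" for t
    using linearizing_proj[OF lin, of t] p' by (auto split: phase.splits simp del: proj_append)
  have wf: "well_formed ?h"
    unfolding well_formed_def using proj proj_seq_history_alternating by metis
  have eq: "proj (complete ?h) t = proj (seq_history L) t" for t
    using proj[of t] proj_seq_history_last[of L t]
    by (auto simp: proj_complete simp del: proj_append)
  have cnt: "inv_count (complete ?h) t = op_count L t" for t
    using eq[of t] count_seq_history(1)[of L t] by (simp add: inv_count_def)
  have "((t, n), (u, m)) \<in> precedence (seq_history L)"
    if "((t, n), (u, m)) \<in> precedence (complete ?h)" for t n u m
  proof -
    obtain k1 k2 where k: "complete ?h = k1 @ k2" "n < res_count k1 t" "inv_count k1 u \<le> m"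
      "m < inv_count (complete ?h) u"
      using \<open>((t, n), (u, m)) \<in> precedence (complete ?h)\<close> unfolding precedence_iff_cut by blast
    \<comment> \<open>The other alternative of \<open>cut_complete\<close> is excluded: operation
      \<open>m\<close> of \<open>u\<close> is invoked in the completion, but not within
      \<open>k1\<close>.\<close>
    obtain h1 h2 where h: "?h = h1 @ h2" "res_count k1 t = res_count h1 t"
      "inv_count h1 u = inv_count k1 u"
      using cut_complete[OF k(1)] k(3,4) by (metis leD)
    obtain L1 L2 where L: "L = L1 @ L2" "res_count h1 t \<le> op_count L1 t"
      "op_count L1 u \<le> inv_count h1 u"
      using linearizing_cut[OF lin h(1)] by blast
    \<comment> \<open>The cut behind \<open>L1\<close> splits no operation, so invocation and
      response counts on its left are both \<open>op_count L1\<close>.\<close>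
    show ?thesis unfolding precedence_iff_cut
      using k h L cnt[of u]
      by (intro exI[of _ "seq_history L1"] exI[of _ "seq_history L2"]) auto
  qed
  then have "precedence (complete ?h) \<subseteq> precedence (seq_history L)" by auto
  then show ?thesis
    unfolding linearizable_def stack_legal_def
    using rs wf eq linearizing_legal[OF lin, of "[]"] by auto
qed

section \<open>Ghost state and invariant\<close>

text \<open>\<open>MHead\<close> marks the first record of a list that is under the control of its
  own thread. \<open>MFin\<close> means that the operation has taken effect and its thread needs no
  further signal in order to return.\<close>

datatype mode = MHead | MWait | MFin

text \<open>
  \<open>gh_own\<close> is the thread that may write next, last and length of a record; \<open>gh_res\<close> is the response
  of a linearized operation; \<open>gh_q\<close> and \<open>gh_z\<close> are the lists of records that a thread is working on;
  \<open>gh_pub\<close> consists of the cells that have been pushed to the central stack. A record is in mode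
  \<open>MWait\<close> as long as its thread has to wait in passiveCollide for its status.
\<close>

record 'v ghost =
  gh_own :: "op_ptr \<Rightarrow> nat"
  gh_mode :: "op_ptr \<Rightarrow> mode"
  gh_res :: "op_ptr \<Rightarrow> 'v resp option"
  gh_q :: "nat \<Rightarrow> op_ptr list"
  gh_z :: "nat \<Rightarrow> op_ptr list"
  gh_pub :: "cell_ptr set"

section \<open>Predicates on lists of records and chains of cells\<close>

fun lseg :: "(nat \<Rightarrow> nat) \<Rightarrow> nat \<Rightarrow> nat list \<Rightarrow> nat \<Rightarrow> bool" where
  "lseg nx a [] b \<longleftrightarrow> a = b"
| "lseg nx a (x # xs) b \<longleftrightarrow> a = x \<and> lseg nx (nx x) xs b"

text \<open>The \<open>next\<close> field of the last cell is left open; it is set when the list is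
  extended in combine or attached to the stack in cMultiPush.\<close>

fun linked :: "'v shared \<Rightarrow> op_ptr list \<Rightarrow> bool" where
  "linked s (x # y # xs) \<longleftrightarrow> c_next s (o_cell s x) = o_cell s y \<and> linked s (y # xs)"
| "linked s _ \<longleftrightarrow> True"

primrec adv :: "(nat \<Rightarrow> nat) \<Rightarrow> nat \<Rightarrow> nat \<Rightarrow> nat" where
  "adv nx 0 c = c"
| "adv nx (Suc n) c = (if c = null then null else adv nx n (nx c))"

text \<open>The responses are read off the chain of cells and not off the abstract stack, so that
  they can still be stated when the CAS has detached these cells.\<close>

primrec pops :: "'v shared \<Rightarrow> nat \<Rightarrow> cell_ptr \<Rightarrow> 'v resp list" where
  "pops s 0 c = []"
| "pops s (Suc n) c = (if c = null then Ret None # pops s n null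
     else Ret (c_data s c) # pops s n (c_next s c))"

definition celldone :: "'v shared \<Rightarrow> 'v ghost \<Rightarrow> op_ptr \<Rightarrow> bool" where
  "celldone s g r \<longleftrightarrow> o_cell s r \<in> c_alloc s \<and> gh_res g r = Some (Ret (c_data s (o_cell s r)))"

definition finok :: "'v shared \<Rightarrow> 'v ghost \<Rightarrow> op_ptr \<Rightarrow> bool" where
  "finok s g r \<longleftrightarrow> (if o_op s r = PUSH then gh_res g r = Some Ack else celldone s g r)"

definition owned :: "nat \<Rightarrow> 'v shared \<Rightarrow> 'v ghost \<Rightarrow> op_ptr list \<Rightarrow> bool" where
  "owned t s g xs \<longleftrightarrow> distinct xs \<and> null \<notin> set xs \<and> (\<forall>r\<in>set xs. r \<in> o_alloc s \<and> gh_own g r = t)"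

definition waits :: "'v ghost \<Rightarrow> op_ptr list \<Rightarrow> bool" where
  "waits g xs \<longleftrightarrow> (\<forall>r\<in>set xs. gh_mode g r = MWait)"

definition optype :: "'v shared \<Rightarrow> op_type \<Rightarrow> op_ptr list \<Rightarrow> bool" where
  "optype s x xs \<longleftrightarrow> (\<forall>r\<in>set xs. o_op s r = x)"

definition unres :: "'v ghost \<Rightarrow> op_ptr list \<Rightarrow> bool" where
  "unres g xs \<longleftrightarrow> (\<forall>r\<in>set xs. gh_res g r = None)"

text \<open>The fields \<open>last\<close> and \<open>length\<close> of the first record are left to
  \<open>hlist\<close>, because they are stale in the middle of combine and in the remainder of an
  elimination. The mode of the first record is open since it depends on the phase of the
  algorithm.\<close>

definition plist :: "nat \<Rightarrow> 'v shared \<Rightarrow> 'v ghost \<Rightarrow> op_ptr list \<Rightarrow> bool" where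
  "plist t s g xs \<longleftrightarrow> owned t s g xs \<and> xs \<noteq> [] \<and> lseg (o_next s) (hd xs) xs null \<and>
     optype s (o_op s (hd xs)) xs \<and> unres g xs \<and> waits g (tl xs) \<and>
     (o_op s (hd xs) = PUSH \<longrightarrow> linked s xs)"

definition hlist :: "nat \<Rightarrow> 'v shared \<Rightarrow> 'v ghost \<Rightarrow> op_ptr list \<Rightarrow> bool" where
  "hlist t s g xs \<longleftrightarrow> plist t s g xs \<and>
     o_last s (hd xs) = last xs \<and> o_length s (hd xs) = int (length xs)"

text \<open>
  The predicates \<open>_at\<close> take the values of the local variables they depend on instead of the local
  state, so that the simplifier discards assignments to all other local variables.
\<close>

definition leads_at ::
  "nat \<Rightarrow> op_ptr \<Rightarrow> 'v ghost \<Rightarrow> bool" where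
  leads_def: "leads_at t m g \<longleftrightarrow> hd (gh_q g t) = m \<and> gh_mode g m = MHead"

abbreviation "leads t l s g \<equiv> leads_at t (l_mOp l) g"

definition head_at ::
  "nat \<Rightarrow> op_ptr \<Rightarrow> 'v shared \<Rightarrow> 'v ghost \<Rightarrow> bool" where
  head_def: "head_at t m s g \<longleftrightarrow> leads_at t m g \<and> hlist t s g (gh_q g t) \<and> o_status s m = INIT"

abbreviation "head t l s g \<equiv> head_at t (l_mOp l) s g"

definition quiet :: "nat \<Rightarrow> 'v shared \<Rightarrow> 'v ghost \<Rightarrow> bool" where
  "quiet t s g \<longleftrightarrow> g_location s t = null \<and>
     (\<forall>r\<in>o_alloc s. r \<noteq> null \<longrightarrow> o_id s r = t \<longrightarrow> gh_mode g r = MFin)"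

text \<open>Allows the inference from a record to an operation: an unfinished record with identifier
  \<open>t\<close> is the one on which \<open>t\<close> is currently working.\<close>

definition sole :: "nat \<Rightarrow> op_ptr \<Rightarrow> 'v shared \<Rightarrow> 'v ghost \<Rightarrow> bool" where
  "sole t m s g \<longleftrightarrow>
     (\<forall>r\<in>o_alloc s. r \<noteq> null \<longrightarrow> o_id s r = t \<longrightarrow> gh_mode g r \<noteq> MFin \<longrightarrow> r = m)"

definition callop :: "'v call \<Rightarrow> op_ptr \<Rightarrow> 'v shared \<Rightarrow> bool" where
  "callop c m s \<longleftrightarrow> (case c of
     Push d \<Rightarrow> o_op s m = PUSH \<and> c_data s (o_cell s m) = Some d | Pop \<Rightarrow> o_op s m = POP)"

definition base_at ::
  "nat \<Rightarrow> 'v call \<Rightarrow> op_ptr \<Rightarrow> 'v shared \<Rightarrow> 'v ghost \<Rightarrow> bool" where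
  base_def: "base_at t c m s g \<longleftrightarrow> m \<in> o_alloc s \<and> m \<noteq> null \<and> o_id s m = t \<and>
     sole t m s g \<and> callop c m s"

abbreviation "base t l s g \<equiv> base_at t (l_call l) (l_mOp l) s g"

text \<open>
  A waiting thread. Nothing is known about a record in status \<open>INIT\<close>, since it is described by the
  assertion of the thread that captured it.
\<close>

definition waiting_at ::
  "nat \<Rightarrow> op_ptr \<Rightarrow> 'v shared \<Rightarrow> 'v ghost \<Rightarrow> bool" where
  waiting_def: "waiting_at t m s g \<longleftrightarrow>
     gh_mode g m = MWait \<and> o_status s m = INIT \<or>
     gh_mode g m = MFin \<and> o_status s m = FINISHED \<and> finok s g m \<or>
     leads_at t m g \<and> hlist t s g (gh_q g t) \<and> o_status s m = RETRY"

abbreviation "waiting t l s g \<equiv> waiting_at t (l_mOp l) s g"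

text \<open>The passive thread inspects only \<open>r\<close>, the first record of the active list,
  so its response is tied to \<open>r\<close>. If the passive operation is a pop, then
  \<open>r\<close> is a push record, whose cell never changes.\<close>

definition elimd_at ::
  "op_ptr \<Rightarrow> 'v shared \<Rightarrow> 'v ghost \<Rightarrow> op_ptr \<Rightarrow> bool" where
  elimd_def: "elimd_at m s g r \<longleftrightarrow> gh_mode g m = MFin \<and> o_op s r \<noteq> o_op s m \<and>
     (if o_op s m = PUSH then gh_res g m = Some Ack
      else o_cell s r \<in> c_alloc s \<and> gh_res g m = Some (Ret (c_data s (o_cell s r))))"

abbreviation "elimd l s g r \<equiv> elimd_at (l_mOp l) s g r"

text \<open>The condition on \<open>o_id\<close> distinguishes a capturing record in
  \<open>location\<close> from the record that the thread put there itself.\<close>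

definition capt_at ::
  "nat \<Rightarrow> op_ptr \<Rightarrow> 'v shared \<Rightarrow> 'v ghost \<Rightarrow> op_ptr \<Rightarrow> bool" where
  capt_def: "capt_at t m s g r \<longleftrightarrow> r \<in> o_alloc s \<and> r \<noteq> null \<and> o_id s r \<noteq> t \<and>
     (if o_op s r = o_op s m then waiting_at t m s g else elimd_at m s g r)"

abbreviation "capt t l s g r \<equiv> capt_at t (l_mOp l) s g r"

text \<open>While a record is exposed it may be captured at any moment without its thread noticing;
  the CAS at C8 or C9 decides between the two cases.\<close>

definition colp_at ::
  "nat \<Rightarrow> op_ptr \<Rightarrow> 'v shared \<Rightarrow> 'v ghost \<Rightarrow> bool" where
  colp_def: "colp_at t m s g \<longleftrightarrow> g_location s t = m \<and> head_at t m s g \<or> capt_at t m s g (g_location s t)"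

abbreviation "colp t l s g \<equiv> colp_at t (l_mOp l) s g"

section \<open>Assertions for cMultiPop and cMultiPush\<close>

definition mfin_at ::
  "nat \<Rightarrow> op_ptr \<Rightarrow> op_ptr \<Rightarrow> 'v shared \<Rightarrow> 'v ghost \<Rightarrow> bool" where
  mfin_def: "mfin_at t p m s g \<longleftrightarrow> p = m \<and> gh_q g t \<noteq> [] \<and> hd (gh_q g t) = m \<and>
     owned t s g (gh_q g t) \<and> lseg (o_next s) m (gh_q g t) null \<and>
     gh_mode g m = MFin \<and> optype s (o_op s m) (gh_q g t)"

abbreviation "mfin t l s g \<equiv> mfin_at t (l_par l) (l_mOp l) s g"

definition psupply ::
  "'v shared \<Rightarrow> 'v ghost \<Rightarrow> op_ptr list \<Rightarrow> cell_ptr \<Rightarrow> bool" where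
  "psupply s g xs c \<longleftrightarrow> (c = null \<or> c \<in> gh_pub g) \<and>
     map (gh_res g) xs = map Some (pops s (length xs) c)"

definition pnone_at ::
  "nat \<Rightarrow> op_ptr \<Rightarrow> op_ptr \<Rightarrow> 'v shared \<Rightarrow> 'v ghost \<Rightarrow> bool" where
  pnone_def: "pnone_at t p m s g \<longleftrightarrow> gh_q g t \<noteq> [] \<and> owned t s g (gh_q g t) \<and>
     lseg (o_next s) p (gh_q g t) null \<and> optype s POP (gh_q g t) \<and>
     (\<forall>r\<in>set (gh_q g t). gh_res g r = Some (Ret None)) \<and> gh_mode g m = MFin"

abbreviation "pnone t l s g \<equiv> pnone_at t (l_par l) (l_mOp l) s g"

text \<open>Since \<open>adv\<close> stays at \<open>null\<close>, leaving the loop early at the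
  bottom of the stack and completing all its iterations both lead to the assertion of P8. In P2 the
  cell of \<open>l_mOp\<close> may still be unwritten, but only in the first iteration.\<close>

primrec mpop_inv :: "mpop_pc \<Rightarrow> nat \<Rightarrow> 'v locals \<Rightarrow> 'v shared \<Rightarrow> 'v ghost \<Rightarrow> bool" where
  "mpop_inv P1 t l s g \<longleftrightarrow> head t l s g \<and> l_par l = l_mOp l"
| "mpop_inv P2 t l s g \<longleftrightarrow> pnone t l s g \<and> (l_par l = l_mOp l \<or> celldone s g (l_mOp l))"
| "mpop_inv P3 t l s g \<longleftrightarrow> pnone t l s g \<and> celldone s g (l_mOp l) \<and> celldone s g (l_par l)"
| "mpop_inv P4 t l s g \<longleftrightarrow> pnone t l s g \<and> celldone s g (l_mOp l)"
| "mpop_inv P5 t l s g \<longleftrightarrow> head t l s g \<and> l_par l = l_mOp l \<and> l_top l \<in> gh_pub g"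
| "mpop_inv P6 t l s g \<longleftrightarrow> head t l s g \<and> l_par l = l_mOp l \<and> l_top l \<in> gh_pub g \<and>
     l_nTop l \<in> gh_pub g \<and> l_nTop l = adv (c_next s) (nat (l_m l)) (l_top l) \<and>
     1 \<le> l_m l \<and> l_m l \<le> int (length (gh_q g t))"
| "mpop_inv P7 t l s g \<longleftrightarrow> head t l s g \<and> l_par l = l_mOp l \<and> l_top l \<in> gh_pub g \<and>
     l_nTop l \<in> gh_pub g \<and> l_nTop l = adv (c_next s) (nat (l_m l)) (l_top l) \<and>
     1 \<le> l_m l \<and> l_m l < int (length (gh_q g t))"
| "mpop_inv P8 t l s g \<longleftrightarrow> head t l s g \<and> l_par l = l_mOp l \<and> l_top l \<in> gh_pub g \<and>
     l_nTop l = adv (c_next s) (length (gh_q g t)) (l_top l)"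
| "mpop_inv P9 t l s g \<longleftrightarrow> mfin t l s g \<and> l_top l \<in> gh_pub g \<and> psupply s g (gh_q g t) (l_top l)"
| "mpop_inv P10 t l s g \<longleftrightarrow> mfin t l s g \<and> celldone s g (l_mOp l) \<and> l_top l \<in> gh_pub g \<and>
     psupply s g (tl (gh_q g t)) (c_next s (l_top l))"
| "mpop_inv P11 t l s g \<longleftrightarrow> mfin t l s g \<and> celldone s g (l_mOp l) \<and>
     psupply s g (tl (gh_q g t)) (l_top l)"
| "mpop_inv P12 t l s g \<longleftrightarrow> mfin t l s g \<and> celldone s g (l_mOp l) \<and>
     psupply s g (tl (gh_q g t)) (l_top l) \<and> tl (gh_q g t) \<noteq> [] \<and> l_top l = null"
| "mpop_inv P13 t l s g \<longleftrightarrow> mfin t l s g \<and> celldone s g (l_mOp l) \<and>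
     psupply s g (tl (gh_q g t)) (l_top l) \<and> tl (gh_q g t) \<noteq> [] \<and> l_top l = null \<and>
     l_op l = hd (tl (gh_q g t))"
| "mpop_inv P14 t l s g \<longleftrightarrow> mfin t l s g \<and> celldone s g (l_mOp l) \<and>
     psupply s g (tl (gh_q g t)) (l_top l) \<and> tl (gh_q g t) \<noteq> [] \<and> l_top l \<noteq> null"
| "mpop_inv P15 t l s g \<longleftrightarrow> mfin t l s g \<and> celldone s g (l_mOp l) \<and>
     psupply s g (tl (gh_q g t)) (l_top l) \<and> tl (gh_q g t) \<noteq> [] \<and> l_top l \<noteq> null \<and>
     l_op l = hd (tl (gh_q g t))"
| "mpop_inv P16 t l s g \<longleftrightarrow> mfin t l s g \<and> celldone s g (l_mOp l) \<and> l_top l \<in> gh_pub g \<and>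
     tl (gh_q g t) \<noteq> [] \<and> celldone s g (hd (tl (gh_q g t))) \<and>
     psupply s g (tl (tl (gh_q g t))) (c_next s (l_top l))"
| "mpop_inv P17 t l s g \<longleftrightarrow> mfin t l s g \<and> celldone s g (l_mOp l) \<and> tl (gh_q g t) \<noteq> [] \<and>
     celldone s g (hd (tl (gh_q g t))) \<and> psupply s g (tl (tl (gh_q g t))) (l_top l)"
| "mpop_inv P18 t l s g \<longleftrightarrow> mfin t l s g \<and> celldone s g (l_mOp l) \<and> tl (gh_q g t) \<noteq> [] \<and>
     celldone s g (hd (tl (gh_q g t))) \<and> psupply s g (tl (tl (gh_q g t))) (l_top l) \<and>
     l_op l = hd (tl (gh_q g t))"
| "mpop_inv P19 t l s g \<longleftrightarrow> mfin t l s g \<and> celldone s g (l_mOp l) \<and> tl (gh_q g t) \<noteq> [] \<and>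
     psupply s g (tl (tl (gh_q g t))) (l_top l)"
| "mpop_inv P20 t l s g \<longleftrightarrow> mfin t l s g \<and> celldone s g (l_mOp l) \<and> tl (gh_q g t) \<noteq> [] \<and>
     psupply s g (tl (tl (gh_q g t))) (l_top l) \<and> l_op l = hd (tl (gh_q g t))"
| "mpop_inv P21 t l s g \<longleftrightarrow> mfin t l s g \<and> celldone s g (l_mOp l) \<and> tl (gh_q g t) \<noteq> [] \<and>
     psupply s g (tl (tl (gh_q g t))) (l_top l) \<and> lseg (o_next s) (l_op l) (tl (tl (gh_q g t))) null"

definition ufin_at ::
  "nat \<Rightarrow> op_ptr \<Rightarrow> op_ptr \<Rightarrow> 'v shared \<Rightarrow> 'v ghost \<Rightarrow> bool" where
  ufin_def: "ufin_at t p m s g \<longleftrightarrow> mfin_at t p m s g \<and> (\<forall>r\<in>set (gh_q g t). gh_res g r = Some Ack)"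

abbreviation "ufin t l s g \<equiv> ufin_at t (l_par l) (l_mOp l) s g"

text \<open>The cell linked at U4 need not be the top any longer. If it is not, the CAS at U6 fails,
  and the link of the still unpublished cell may be overwritten later.\<close>

primrec mpush_inv :: "mpush_pc \<Rightarrow> nat \<Rightarrow> 'v locals \<Rightarrow> 'v shared \<Rightarrow> 'v ghost \<Rightarrow> bool" where
  "mpush_inv U1 t l s g \<longleftrightarrow> head t l s g \<and> l_par l = l_mOp l"
| "mpush_inv U2 t l s g \<longleftrightarrow> head t l s g \<and> l_par l = l_mOp l \<and> (l_top l = null \<or> l_top l \<in> gh_pub g)"
| "mpush_inv U3 t l s g \<longleftrightarrow> head t l s g \<and> l_par l = l_mOp l \<and> (l_top l = null \<or> l_top l \<in> gh_pub g) \<and>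
     l_op l = last (gh_q g t)"
| "mpush_inv U4 t l s g \<longleftrightarrow> head t l s g \<and> l_par l = l_mOp l \<and> (l_top l = null \<or> l_top l \<in> gh_pub g) \<and>
     l_cp l = o_cell s (last (gh_q g t))"
| "mpush_inv U5 t l s g \<longleftrightarrow> head t l s g \<and> l_par l = l_mOp l \<and> (l_top l = null \<or> l_top l \<in> gh_pub g) \<and>
     c_next s (o_cell s (last (gh_q g t))) = l_top l"
| "mpush_inv U6 t l s g \<longleftrightarrow> head t l s g \<and> l_par l = l_mOp l \<and> (l_top l = null \<or> l_top l \<in> gh_pub g) \<and>
     c_next s (o_cell s (last (gh_q g t))) = l_top l \<and> l_cp l = o_cell s (l_mOp l)"
| "mpush_inv U7 t l s g \<longleftrightarrow> ufin t l s g"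
| "mpush_inv U8 t l s g \<longleftrightarrow> ufin t l s g \<and> tl (gh_q g t) \<noteq> []"
| "mpush_inv U9 t l s g \<longleftrightarrow> ufin t l s g \<and> tl (gh_q g t) \<noteq> [] \<and> l_op l = hd (tl (gh_q g t))"
| "mpush_inv U10 t l s g \<longleftrightarrow> ufin t l s g \<and> tl (gh_q g t) \<noteq> []"
| "mpush_inv U11 t l s g \<longleftrightarrow> ufin t l s g \<and> tl (gh_q g t) \<noteq> [] \<and> l_op l = hd (tl (gh_q g t))"
| "mpush_inv U12 t l s g \<longleftrightarrow> ufin t l s g \<and> tl (gh_q g t) \<noteq> [] \<and>
     lseg (o_next s) (l_op l) (tl (tl (gh_q g t))) null"

section \<open>Assertions for collisions, combining and elimination\<close>

text \<open>The record in \<open>l_oInfo\<close> may be out of date as soon as it has been read, so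
  only its constant properties are kept. Whether it is still exposed is checked by the CAS at
  A2.\<close>

primrec col_inv :: "col_pc \<Rightarrow> nat \<Rightarrow> nat \<Rightarrow> 'v locals \<Rightarrow> 'v shared \<Rightarrow> 'v ghost \<Rightarrow> bool" where
  "col_inv C1 N t l s g \<longleftrightarrow> head t l s g \<and> g_location s t = null"
| "col_inv C2 N t l s g \<longleftrightarrow> colp t l s g"
| "col_inv C3 N t l s g \<longleftrightarrow> colp t l s g \<and> l_index l \<in> {1..N} \<and> l_him l \<le> N"
| "col_inv C4 N t l s g \<longleftrightarrow> colp t l s g \<and> l_index l \<in> {1..N}"
| "col_inv C5 N t l s g \<longleftrightarrow> colp t l s g \<and> l_him l \<in> {1..N}"
| "col_inv C6 N t l s g \<longleftrightarrow> colp t l s g \<and> l_him l \<in> {1..N} \<and> l_oInfo l \<in> o_alloc s \<and> l_oInfo l \<noteq> null"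
| "col_inv C7 N t l s g \<longleftrightarrow> colp t l s g \<and> l_him l \<in> {1..N} \<and> l_oInfo l \<in> o_alloc s \<and> l_oInfo l \<noteq> null \<and>
     o_id s (l_oInfo l) \<noteq> t"
| "col_inv C8 N t l s g \<longleftrightarrow> colp t l s g \<and> l_oInfo l \<in> o_alloc s \<and> l_oInfo l \<noteq> null \<and>
     o_id s (l_oInfo l) \<noteq> t \<and> o_id s (l_oInfo l) \<in> {1..N}"
| "col_inv C9 N t l s g \<longleftrightarrow> colp t l s g"

definition pairok :: "'v shared \<Rightarrow> 'v ghost \<Rightarrow> op_ptr \<Rightarrow> op_ptr \<Rightarrow> bool" where
  "pairok s g x y \<longleftrightarrow> o_op s y \<noteq> o_op s x \<and> (if o_op s x = PUSH
     then gh_res g x = Some Ack \<and> gh_res g y = Some (Ret (c_data s (o_cell s x))) \<and>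
       o_cell s x \<in> c_alloc s
     else gh_res g y = Some Ack \<and> gh_res g x = Some (Ret (c_data s (o_cell s y))) \<and>
       o_cell s y \<in> c_alloc s)"

text \<open>The surplus of the longer list falls under the second equation: its operations have not
  taken effect and are to be retried.\<close>

fun paired :: "'v shared \<Rightarrow> 'v ghost \<Rightarrow> op_ptr list \<Rightarrow> op_ptr list \<Rightarrow> bool" where
  "paired s g (x # xs) (y # ys) \<longleftrightarrow> pairok s g x y \<and> paired s g xs ys"
| "paired s g xs ys \<longleftrightarrow> unres g xs \<and> unres g ys"

definition elimbase_at ::
  "nat \<Rightarrow> op_ptr \<Rightarrow> op_ptr \<Rightarrow> op_ptr \<Rightarrow> 'v shared \<Rightarrow> 'v ghost \<Rightarrow> bool" where
  elimbase_def: "elimbase_at t a p m s g \<longleftrightarrow> a = m \<and> gh_mode g m = MFin \<and> gh_own g m = t \<and>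
     p \<in> o_alloc s \<and> gh_own g p = t \<and> gh_mode g p = MFin \<and>
     p \<noteq> m \<and> p \<noteq> null \<and> o_op s p \<noteq> o_op s m"

abbreviation "elimbase t l s g \<equiv> elimbase_at t (l_aInf l) (l_pInf l) (l_mOp l) s g"

text \<open>\<open>xs\<close> and \<open>ys\<close> are the unprocessed suffixes, whereas
  \<open>last\<close> is stored in the first records \<open>m\<close> and \<open>p\<close> of the
  original lists throughout.\<close>

definition elimlists_at ::
  "nat \<Rightarrow> op_ptr \<Rightarrow> op_ptr \<Rightarrow> op_ptr \<Rightarrow> op_ptr \<Rightarrow> 'v shared \<Rightarrow> 'v ghost \<Rightarrow> op_ptr list \<Rightarrow> op_ptr list \<Rightarrow>
    bool" where
  elimlists_def: "elimlists_at t p m x y s g xs ys \<longleftrightarrow> owned t s g (xs @ ys) \<and>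
     optype s (o_op s m) xs \<and> optype s (o_op s p) ys \<and>
     (o_op s m = PUSH \<longrightarrow> linked s xs) \<and> (o_op s m \<noteq> PUSH \<longrightarrow> linked s ys) \<and>
     (xs \<noteq> [] \<longrightarrow> o_last s m = last xs) \<and> (ys \<noteq> [] \<longrightarrow> o_last s p = last ys) \<and>
     lseg (o_next s) x xs null \<and> lseg (o_next s) y ys null \<and>
     waits g (tl xs) \<and> waits g (tl ys)"

abbreviation "elimlists t l s g xs ys \<equiv> elimlists_at t (l_pInf l) (l_mOp l) (l_aCurr l) (l_pCurr l)
  s g xs ys"

text \<open>
  In the loop of multiEliminate, \<open>n\<close> and \<open>k\<close> are 1 from the decrement of a length field on until the
  respective list is advanced.
\<close>

definition elimfull_at ::
  "nat \<Rightarrow> op_ptr \<Rightarrow> op_ptr \<Rightarrow> op_ptr \<Rightarrow> op_ptr \<Rightarrow> op_ptr \<Rightarrow> 'v shared \<Rightarrow> 'v ghost \<Rightarrow> int \<Rightarrow> int \<Rightarrow> bool" where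
  elimfull_def: "elimfull_at t a p m x y s g n k \<longleftrightarrow> elimbase_at t a p m s g \<and>
    elimlists_at t p m x y s g (gh_q g t) (gh_z g t) \<and>
     gh_q g t \<noteq> [] \<and> gh_z g t \<noteq> [] \<and> paired s g (gh_q g t) (gh_z g t) \<and>
     o_length s m = int (length (gh_q g t)) - n \<and>
     o_length s p = int (length (gh_z g t)) - k"

abbreviation "elimfull t l s g n k \<equiv> elimfull_at t (l_aInf l) (l_pInf l) (l_mOp l) (l_aCurr l)
  (l_pCurr l) s g n k"

definition comb0_at ::
  "nat \<Rightarrow> op_ptr \<Rightarrow> op_ptr \<Rightarrow> op_ptr \<Rightarrow> 'v shared \<Rightarrow> 'v ghost \<Rightarrow> bool" where
  comb0_def: "comb0_at t a p m s g \<longleftrightarrow> head_at t m s g \<and> a = m \<and> hlist t s g (gh_z g t) \<and>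
     hd (gh_z g t) = p \<and> gh_mode g p = MWait \<and>
     o_op s p = o_op s m \<and> set (gh_q g t) \<inter> set (gh_z g t) = {}"

abbreviation "comb0 t l s g \<equiv> comb0_at t (l_aInf l) (l_pInf l) (l_mOp l) s g"

text \<open>The capture has already settled whether the lists are combined or eliminated; A3 and A4
  merely find it out.\<close>

definition act3_at ::
  "nat \<Rightarrow> op_ptr \<Rightarrow> op_ptr \<Rightarrow> op_ptr \<Rightarrow> 'v shared \<Rightarrow> 'v ghost \<Rightarrow> bool" where
  act3_def: "act3_at t a p m s g \<longleftrightarrow> (if o_op s m = o_op s p then comb0_at t a p m s g
     else a = m \<and>
       elimfull_at t a p m a p s g 0 0)"

abbreviation "act3 t l s g \<equiv> act3_at t (l_aInf l) (l_pInf l) (l_mOp l) s g"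

primrec act_inv :: "act_pc \<Rightarrow> nat \<Rightarrow> nat \<Rightarrow> 'v locals \<Rightarrow> 'v shared \<Rightarrow> 'v ghost \<Rightarrow> bool" where
  "act_inv A1 N t l s g \<longleftrightarrow> head t l s g \<and> l_aInf l = l_mOp l \<and>
     l_pInf l \<in> o_alloc s \<and> l_pInf l \<noteq> null \<and> o_id s (l_pInf l) \<noteq> t \<and> o_id s (l_pInf l) \<in> {1..N}"
| "act_inv A2 N t l s g \<longleftrightarrow> head t l s g \<and> l_aInf l = l_mOp l \<and>
     l_pInf l \<in> o_alloc s \<and> l_pInf l \<noteq> null \<and> o_id s (l_pInf l) \<noteq> t \<and> o_id s (l_pInf l) \<in> {1..N} \<and>
     l_id l = o_id s (l_pInf l)"
| "act_inv A3 N t l s g \<longleftrightarrow> act3 t l s g"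
| "act_inv A4 N t l s g \<longleftrightarrow> act3 t l s g \<and> l_type l = o_op s (l_mOp l)"

primrec pas_inv :: "pas_pc \<Rightarrow> nat \<Rightarrow> 'v locals \<Rightarrow> 'v shared \<Rightarrow> 'v ghost \<Rightarrow> bool" where
  "pas_inv W1 t l s g \<longleftrightarrow> capt t l s g (g_location s t)"
| "pas_inv W2 t l s g \<longleftrightarrow> capt t l s g (g_location s t) \<and> l_id l = t"
| "pas_inv W3 t l s g \<longleftrightarrow> capt t l s g (g_location s t) \<and> l_aInf l = g_location s t"
| "pas_inv W4 t l s g \<longleftrightarrow> capt t l s g (g_location s t) \<and> l_aInf l = g_location s t \<and> l_id l = t"
| "pas_inv W5 t l s g \<longleftrightarrow> g_location s t = null \<and> capt t l s g (l_aInf l)"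
| "pas_inv W6 t l s g \<longleftrightarrow> g_location s t = null \<and> capt t l s g (l_aInf l) \<and> l_type l = o_op s (l_mOp l)"
| "pas_inv W7 t l s g \<longleftrightarrow> g_location s t = null \<and> l_aInf l \<in> o_alloc s \<and> elimd l s g (l_aInf l)"
| "pas_inv W8 t l s g \<longleftrightarrow> g_location s t = null \<and> l_aInf l \<in> o_alloc s \<and> elimd l s g (l_aInf l) \<and>
     o_op s (l_mOp l) = POP"
| "pas_inv W9 t l s g \<longleftrightarrow> g_location s t = null \<and> l_aInf l \<in> o_alloc s \<and> elimd l s g (l_aInf l) \<and>
     o_op s (l_mOp l) = POP \<and> l_cp l = o_cell s (l_aInf l)"
| "pas_inv W10 t l s g \<longleftrightarrow> g_location s t = null \<and> waiting t l s g"
| "pas_inv W11 t l s g \<longleftrightarrow> g_location s t = null \<and> waiting t l s g \<and> o_status s (l_mOp l) \<noteq> INIT"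
| "pas_inv W12 t l s g \<longleftrightarrow> g_location s t = null \<and> leads t l s g \<and> hlist t s g (gh_q g t)"

text \<open>The lists are joined, so the first record of the passive list has become an inner
  element, but the \<open>last\<close> and \<open>length\<close> fields of the active record still
  have to catch up.\<close>

definition comb1_at ::
  "nat \<Rightarrow> op_ptr \<Rightarrow> op_ptr \<Rightarrow> op_ptr \<Rightarrow> 'v shared \<Rightarrow> 'v ghost \<Rightarrow> bool" where
  comb1_def: "comb1_at t a p m s g \<longleftrightarrow> leads_at t m g \<and> plist t s g (gh_q g t) \<and> o_status s m = INIT \<and>
     a = m \<and> p \<in> o_alloc s \<and> gh_own g p = t \<and> p \<noteq> m"

abbreviation "comb1 t l s g \<equiv> comb1_at t (l_aInf l) (l_pInf l) (l_mOp l) s g"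

primrec comb_inv :: "comb_pc \<Rightarrow> nat \<Rightarrow> 'v locals \<Rightarrow> 'v shared \<Rightarrow> 'v ghost \<Rightarrow> bool" where
  "comb_inv B1 t l s g \<longleftrightarrow> comb0 t l s g"
| "comb_inv B2 t l s g \<longleftrightarrow> comb0 t l s g \<and> o_op s (l_mOp l) = PUSH"
| "comb_inv B3 t l s g \<longleftrightarrow> comb0 t l s g \<and> o_op s (l_mOp l) = PUSH \<and> l_op l = last (gh_q g t)"
| "comb_inv B4 t l s g \<longleftrightarrow> comb0 t l s g \<and> o_op s (l_mOp l) = PUSH \<and> l_cp l = o_cell s (last (gh_q g t))"
| "comb_inv B5 t l s g \<longleftrightarrow> comb0 t l s g \<and> o_op s (l_mOp l) = PUSH \<and> l_cp l = o_cell s (last (gh_q g t)) \<and>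
     l_cp2 l = o_cell s (l_pInf l)"
| "comb_inv B6 t l s g \<longleftrightarrow> comb0 t l s g \<and>
     (o_op s (l_mOp l) = PUSH \<longrightarrow> c_next s (o_cell s (last (gh_q g t))) = o_cell s (l_pInf l))"
| "comb_inv B7 t l s g \<longleftrightarrow> comb0 t l s g \<and> l_op l = last (gh_q g t) \<and>
     (o_op s (l_mOp l) = PUSH \<longrightarrow> c_next s (o_cell s (last (gh_q g t))) = o_cell s (l_pInf l))"
| "comb_inv B8 t l s g \<longleftrightarrow> comb1 t l s g \<and> o_last s (l_pInf l) = last (gh_q g t) \<and>
     o_length s (l_mOp l) + o_length s (l_pInf l) = int (length (gh_q g t))"
| "comb_inv B9 t l s g \<longleftrightarrow> comb1 t l s g \<and> l_op l = last (gh_q g t) \<and>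
     o_length s (l_mOp l) + o_length s (l_pInf l) = int (length (gh_q g t))"
| "comb_inv B10 t l s g \<longleftrightarrow> comb1 t l s g \<and> o_last s (l_mOp l) = last (gh_q g t) \<and>
     o_length s (l_mOp l) + o_length s (l_pInf l) = int (length (gh_q g t))"
| "comb_inv B11 t l s g \<longleftrightarrow> comb1 t l s g \<and> o_last s (l_mOp l) = last (gh_q g t) \<and>
     l_len l + o_length s (l_pInf l) = int (length (gh_q g t))"
| "comb_inv B12 t l s g \<longleftrightarrow> comb1 t l s g \<and> o_last s (l_mOp l) = last (gh_q g t) \<and>
     l_len l = int (length (gh_q g t))"

text \<open>The state between the two advances: the active list has moved on, the passive one has
  not, hence \<open>tl\<close> and the offset of one on the passive side.\<close>

definition elim13_at ::
  "nat \<Rightarrow> op_ptr \<Rightarrow> op_ptr \<Rightarrow> op_ptr \<Rightarrow> op_ptr \<Rightarrow> op_ptr \<Rightarrow> 'v shared \<Rightarrow> 'v ghost \<Rightarrow> bool" where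
  elim13_def: "elim13_at t a p m x y s g \<longleftrightarrow> elimbase_at t a p m s g \<and>
    elimlists_at t p m x y s g (gh_q g t) (gh_z g t) \<and>
     waits g (gh_q g t) \<and> gh_z g t \<noteq> [] \<and> paired s g (gh_q g t) (tl (gh_z g t)) \<and>
     o_length s m = int (length (gh_q g t)) \<and>
     o_length s p = int (length (gh_z g t)) - 1"

abbreviation "elim13 t l s g \<equiv> elim13_at t (l_aInf l) (l_pInf l) (l_mOp l) (l_aCurr l) (l_pCurr l) s g"

definition rest_at ::
  "nat \<Rightarrow> op_ptr \<Rightarrow> 'v shared \<Rightarrow> 'v ghost \<Rightarrow> op_ptr list \<Rightarrow> op_ptr \<Rightarrow> bool" where
  rest_def: "rest_at t m s g xs r \<longleftrightarrow> gh_mode g m = MFin \<and> finok s g m \<and>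
     plist t s g xs \<and> hd xs = r \<and> waits g xs"

abbreviation "rest t l s g xs r \<equiv> rest_at t (l_mOp l) s g xs r"

primrec elim_inv :: "elim_pc \<Rightarrow> nat \<Rightarrow> 'v locals \<Rightarrow> 'v shared \<Rightarrow> 'v ghost \<Rightarrow> bool" where
  "elim_inv E1 t l s g \<longleftrightarrow> elimfull t l s g 0 0 \<and> (l_aCurr l = l_mOp l \<or> finok s g (l_mOp l))"
| "elim_inv E2 t l s g \<longleftrightarrow> elimfull t l s g 0 0 \<and> (l_aCurr l = l_mOp l \<or> finok s g (l_mOp l)) \<and>
     o_op s (l_mOp l) = POP"
| "elim_inv E3 t l s g \<longleftrightarrow> elimfull t l s g 0 0 \<and> (l_aCurr l = l_mOp l \<or> finok s g (l_mOp l)) \<and>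
     o_op s (l_mOp l) = POP \<and> l_cp l = o_cell s (l_pCurr l)"
| "elim_inv E4 t l s g \<longleftrightarrow> elimfull t l s g 0 0 \<and> (l_aCurr l = l_mOp l \<or> finok s g (l_mOp l)) \<and>
     o_op s (l_mOp l) = PUSH"
| "elim_inv E5 t l s g \<longleftrightarrow> elimfull t l s g 0 0 \<and> (l_aCurr l = l_mOp l \<or> finok s g (l_mOp l)) \<and>
     o_op s (l_mOp l) = PUSH \<and> l_cp l = o_cell s (l_aCurr l)"
| "elim_inv E6 t l s g \<longleftrightarrow> elimfull t l s g 0 0 \<and> finok s g (l_mOp l) \<and> finok s g (l_aCurr l) \<and>
     finok s g (l_pCurr l)"
| "elim_inv E7 t l s g \<longleftrightarrow> elimfull t l s g 0 0 \<and> finok s g (l_mOp l) \<and> finok s g (l_pCurr l)"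
| "elim_inv E8 t l s g \<longleftrightarrow> elimfull t l s g 0 0 \<and> finok s g (l_mOp l)"
| "elim_inv E9 t l s g \<longleftrightarrow> elimfull t l s g 0 0 \<and> finok s g (l_mOp l) \<and>
     l_len l = int (length (gh_q g t))"
| "elim_inv E10 t l s g \<longleftrightarrow> elimfull t l s g 1 0 \<and> finok s g (l_mOp l)"
| "elim_inv E11 t l s g \<longleftrightarrow> elimfull t l s g 1 0 \<and> finok s g (l_mOp l) \<and>
     l_len l = int (length (gh_z g t))"
| "elim_inv E12 t l s g \<longleftrightarrow> elimfull t l s g 1 1 \<and> finok s g (l_mOp l)"
| "elim_inv E13 t l s g \<longleftrightarrow> elim13 t l s g \<and> finok s g (l_mOp l)"
| "elim_inv E14 t l s g \<longleftrightarrow> rest t l s g (gh_q g t) (l_aCurr l) \<and> elimbase t l s g \<and>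
     o_length s (l_mOp l) = int (length (gh_q g t)) \<and> o_last s (l_mOp l) = last (gh_q g t)"
| "elim_inv E15 t l s g \<longleftrightarrow> rest t l s g (gh_q g t) (l_aCurr l) \<and> elimbase t l s g \<and>
     l_len l = int (length (gh_q g t)) \<and> o_last s (l_mOp l) = last (gh_q g t)"
| "elim_inv E16 t l s g \<longleftrightarrow> rest t l s g (gh_q g t) (l_aCurr l) \<and> elimbase t l s g \<and>
     o_length s (l_aCurr l) = int (length (gh_q g t)) \<and> o_last s (l_mOp l) = last (gh_q g t)"
| "elim_inv E17 t l s g \<longleftrightarrow> rest t l s g (gh_q g t) (l_aCurr l) \<and>
     o_length s (l_aCurr l) = int (length (gh_q g t)) \<and> l_op l = last (gh_q g t)"
| "elim_inv E18 t l s g \<longleftrightarrow> rest t l s g (gh_q g t) (l_aCurr l) \<and>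
     o_length s (l_aCurr l) = int (length (gh_q g t)) \<and> o_last s (l_aCurr l) = last (gh_q g t)"
| "elim_inv E19 t l s g \<longleftrightarrow> rest t l s g (gh_z g t) (l_pCurr l) \<and> elimbase t l s g \<and>
     o_length s (l_pInf l) = int (length (gh_z g t)) \<and> o_last s (l_pInf l) = last (gh_z g t)"
| "elim_inv E20 t l s g \<longleftrightarrow> rest t l s g (gh_z g t) (l_pCurr l) \<and> elimbase t l s g \<and>
     l_len l = int (length (gh_z g t)) \<and> o_last s (l_pInf l) = last (gh_z g t)"
| "elim_inv E21 t l s g \<longleftrightarrow> rest t l s g (gh_z g t) (l_pCurr l) \<and> elimbase t l s g \<and>
     o_length s (l_pCurr l) = int (length (gh_z g t)) \<and> o_last s (l_pInf l) = last (gh_z g t)"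
| "elim_inv E22 t l s g \<longleftrightarrow> rest t l s g (gh_z g t) (l_pCurr l) \<and>
     o_length s (l_pCurr l) = int (length (gh_z g t)) \<and> l_op l = last (gh_z g t)"
| "elim_inv E23 t l s g \<longleftrightarrow> rest t l s g (gh_z g t) (l_pCurr l) \<and>
     o_length s (l_pCurr l) = int (length (gh_z g t)) \<and> o_last s (l_pCurr l) = last (gh_z g t)"

section \<open>The assertions of all program points, and the global invariant\<close>

primrec pc_inv :: "pc \<Rightarrow> nat \<Rightarrow> nat \<Rightarrow> 'v locals \<Rightarrow> 'v shared \<Rightarrow> 'v ghost \<Rightarrow> bool" where
  "pc_inv Idle N t l s g \<longleftrightarrow> quiet t s g"
| "pc_inv Start N t l s g \<longleftrightarrow> quiet t s g"
| "pc_inv Load1 N t l s g \<longleftrightarrow> base t l s g \<and> g_location s t = null \<and> gh_mode g (l_mOp l) = MFin \<and>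
     o_op s (l_mOp l) = POP \<and> celldone s g (l_mOp l)"
| "pc_inv Load2 N t l s g \<longleftrightarrow> base t l s g \<and> g_location s t = null \<and> gh_mode g (l_mOp l) = MFin \<and>
     l_cp l \<in> c_alloc s \<and> gh_res g (l_mOp l) = Some (Ret (c_data s (l_cp l)))"
| "pc_inv Respond N t l s g \<longleftrightarrow> base t l s g \<and> g_location s t = null \<and> gh_mode g (l_mOp l) = MFin \<and>
     gh_res g (l_mOp l) = Some (l_resp l)"
| "pc_inv (MPop p) N t l s g \<longleftrightarrow> base t l s g \<and> g_location s t = null \<and> o_op s (l_mOp l) = POP \<and>
     mpop_inv p t l s g"
| "pc_inv (MPush p) N t l s g \<longleftrightarrow> base t l s g \<and> g_location s t = null \<and> o_op s (l_mOp l) = PUSH \<and>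
     mpush_inv p t l s g"
| "pc_inv (Col p) N t l s g \<longleftrightarrow> base t l s g \<and> col_inv p N t l s g"
| "pc_inv (Act p) N t l s g \<longleftrightarrow> base t l s g \<and> g_location s t = null \<and> act_inv p N t l s g"
| "pc_inv (Pas p) N t l s g \<longleftrightarrow> base t l s g \<and> l_pInf l = l_mOp l \<and> pas_inv p t l s g"
| "pc_inv (Comb p) N t l s g \<longleftrightarrow> base t l s g \<and> g_location s t = null \<and> comb_inv p t l s g"
| "pc_inv (Elim p) N t l s g \<longleftrightarrow> base t l s g \<and> g_location s t = null \<and> elim_inv p t l s g"

abbreviation "thread_inv N t l s g \<equiv> pc_inv (l_pc l) N t l s g"

text \<open>Cells of distinct push records are distinct, and those of unlinearized ones are
  unpublished. Hence a thread that writes the \<open>next\<close> field of such a cell disturbs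
  neither the stack nor a list of another thread.\<close>

definition global_inv :: "nat \<Rightarrow> 'v shared \<Rightarrow> 'v ghost \<Rightarrow> bool" where
  "global_inv N s g \<longleftrightarrow>
     gh_pub g \<subseteq> c_alloc s \<and> null \<notin> gh_pub g \<and> null \<in> o_alloc s \<and>
     (\<forall>c\<in>gh_pub g. (c_next s c = null \<or> c_next s c \<in> gh_pub g) \<and> c_data s c \<noteq> None) \<and>
     {null, EMPTY_CELL} \<subseteq> c_alloc s \<and> c_data s EMPTY_CELL = None \<and>
     (\<forall>r\<in>o_alloc s. r \<noteq> null \<longrightarrow> o_op s r = PUSH \<longrightarrow>
        o_cell s r \<in> c_alloc s \<and> o_cell s r \<noteq> null \<and> c_data s (o_cell s r) \<noteq> None \<and>
        (gh_res g r = None \<longrightarrow> o_cell s r \<notin> gh_pub g) \<and>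
        (\<forall>r'\<in>o_alloc s. r' \<noteq> null \<longrightarrow> o_op s r' = PUSH \<longrightarrow> o_cell s r' = o_cell s r \<longrightarrow> r' = r)) \<and>
     (\<forall>r\<in>o_alloc s. r \<noteq> null \<longrightarrow> o_id s r \<in> {1..N}) \<and>
     (\<forall>j\<in>{1..N}. g_collision s j \<le> N)"

text \<open>The top is the first cell of the chain but the last entry of the abstract stack, hence
  \<open>rev\<close>.\<close>

definition stacked :: "'v shared \<Rightarrow> 'v ghost \<Rightarrow> 'v list \<Rightarrow> bool" where
  "stacked s g S \<longleftrightarrow> (\<exists>cs. lseg (c_next s) (g_central s) cs null \<and> set cs \<subseteq> gh_pub g \<and>
     S = rev (map (\<lambda>c. the (c_data s c)) cs))"

text \<open>At \<open>Start\<close> no record has been allocated for the new call and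
  \<open>l_mOp\<close> may be a leftover, hence the separate case.\<close>

definition phase_of ::
  "nat \<Rightarrow> (nat \<Rightarrow> 'v locals) \<Rightarrow> (op_ptr \<Rightarrow> 'v resp option) \<Rightarrow> nat \<Rightarrow> 'v phase" where
  "phase_of N ls f t =
     (if t \<notin> {1..N} \<or> l_pc (ls t) = Idle then Idling
      else if l_pc (ls t) = Start then Pending (l_call (ls t))
      else case f (l_mOp (ls t)) of
        None \<Rightarrow> Pending (l_call (ls t)) | Some r \<Rightarrow> Linearized (l_call (ls t)) r)"

definition decs_inv ::
  "nat \<Rightarrow> ('v call, 'v resp) history \<Rightarrow> (nat \<Rightarrow> 'v locals) \<Rightarrow> 'v shared \<Rightarrow> 'v ghost \<Rightarrow> 'v list \<Rightarrow> bool"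
where
  "decs_inv N h ls s g S \<longleftrightarrow> global_inv N s g \<and> stacked s g S \<and>
     (\<exists>L. linearizing h L S (phase_of N ls (gh_res g))) \<and> (\<forall>t\<in>{1..N}. thread_inv N t (ls t) s g)"

section \<open>Interference\<close>

text \<open>
  \<open>rely u m\<close> describes what a step of another thread may change from the point of view of thread
  \<open>u\<close> working on record \<open>m\<close>.
\<close>

definition extends ::
  "'v shared \<Rightarrow> 'v ghost \<Rightarrow> 'v shared \<Rightarrow> 'v ghost \<Rightarrow> bool" where
  "extends s g s' g' \<longleftrightarrow> o_alloc s \<subseteq> o_alloc s' \<and> c_alloc s \<subseteq> c_alloc s' \<and> gh_pub g \<subseteq> gh_pub g' \<and>
     (\<forall>c\<in>c_alloc s. c_data s' c = c_data s c) \<and> (\<forall>c\<in>gh_pub g. c_next s' c = c_next s c)"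

text \<open>What may be assumed of a record under foreign control. It keeps alive the facts about
  \<open>l_oInfo\<close> in collide and about \<open>l_aInf\<close> in passiveCollide.\<close>

definition mono_op ::
  "op_ptr \<Rightarrow> 'v shared \<Rightarrow> 'v ghost \<Rightarrow> 'v shared \<Rightarrow> 'v ghost \<Rightarrow> bool" where
  "mono_op r s g s' g' \<longleftrightarrow> o_id s' r = o_id s r \<and> o_op s' r = o_op s r \<and>
     (o_op s r = PUSH \<longrightarrow> o_cell s' r = o_cell s r) \<and>
     (o_op s r = POP \<longrightarrow> celldone s g r \<longrightarrow> celldone s' g' r) \<and>
     (\<forall>x. gh_res g r = Some x \<longrightarrow> gh_res g' r = Some x) \<and>
     (gh_mode g r = MFin \<longrightarrow> gh_mode g' r = MFin) \<and>
     (gh_mode g r = MFin \<longrightarrow> o_status s r = FINISHED \<longrightarrow> o_status s' r = FINISHED)"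

definition keeps ::
  "nat \<Rightarrow> op_ptr \<Rightarrow> 'v shared \<Rightarrow> 'v ghost \<Rightarrow> 'v shared \<Rightarrow> 'v ghost \<Rightarrow> bool" where
  "keeps u r s g s' g' \<longleftrightarrow> gh_own g' r = u \<and> o_next s' r = o_next s r \<and>
     o_last s' r = o_last s r \<and> o_length s' r = o_length s r \<and> gh_mode g' r = gh_mode g r \<and>
     gh_res g' r = gh_res g r \<and> o_status s' r = o_status s r \<and>
     (r \<noteq> null \<longrightarrow> o_op s r = PUSH \<longrightarrow> c_next s' (o_cell s r) = c_next s (o_cell s r))"

text \<open>Waking with \<open>RETRY\<close> is absent because it gives records to the waiting
  thread; \<open>step_retry\<close> treats it separately.\<close>

definition wakes ::
  "op_ptr \<Rightarrow> 'v shared \<Rightarrow> 'v ghost \<Rightarrow> 'v shared \<Rightarrow> 'v ghost \<Rightarrow> bool" where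
  "wakes m s g s' g' \<longleftrightarrow> (gh_mode g m = MWait \<longrightarrow> o_status s m = INIT \<longrightarrow>
     gh_mode g' m = MWait \<and> o_status s' m = INIT \<or>
     gh_mode g' m = MFin \<and> o_status s' m = FINISHED \<and> finok s' g' m)"

definition rely ::
  "nat \<Rightarrow> op_ptr \<Rightarrow> 'v shared \<Rightarrow> 'v ghost \<Rightarrow> 'v shared \<Rightarrow> 'v ghost \<Rightarrow> bool" where
  "rely u m s g s' g' \<longleftrightarrow> extends s g s' g' \<and> (\<forall>r\<in>o_alloc s. mono_op r s g s' g') \<and>
     (\<forall>r\<in>o_alloc s. gh_own g r = u \<longrightarrow> keeps u r s g s' g') \<and>
     (m \<in> o_alloc s \<longrightarrow> o_id s m = u \<longrightarrow> wakes m s g s' g') \<and>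
     g_location s' u = g_location s u \<and> gh_q g' u = gh_q g u \<and> gh_z g' u = gh_z g u \<and>
     (\<forall>r\<in>o_alloc s'. r \<noteq> null \<longrightarrow> gh_mode g' r \<noteq> MFin \<longrightarrow> o_id s' r = u \<longrightarrow>
        r \<in> o_alloc s \<and> gh_mode g r \<noteq> MFin)"

section \<open>Congruence and ownership\<close>

lemma lseg_cong:
  "lseg nx a xs b \<Longrightarrow> (\<And>x. x \<in> set xs \<Longrightarrow> nx' x = nx x) \<Longrightarrow> lseg nx' a xs b"
  by (induction xs arbitrary: a) auto

lemma linked_cong:
  assumes "linked s xs" "\<And>x. x \<in> set xs \<Longrightarrow> o_cell s' x = o_cell s x"
    "\<And>x. x \<in> set (butlast xs) \<Longrightarrow> c_next s' (o_cell s x) = c_next s (o_cell s x)"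
  shows "linked s' xs"
  using assms by (induction s xs rule: linked.induct) (auto split: if_splits)

lemma op_type_neq [simp]: "x \<noteq> PUSH \<longleftrightarrow> x = POP" "PUSH \<noteq> x \<longleftrightarrow> x = POP"
  "x \<noteq> POP \<longleftrightarrow> x = PUSH" "POP \<noteq> x \<longleftrightarrow> x = PUSH"
  by (cases x; simp)+

lemma owned_mem:
  "owned t s g xs \<Longrightarrow> r \<in> set xs \<Longrightarrow> r \<in> o_alloc s \<and> gh_own g r = t \<and> r \<noteq> null"
  by (auto simp: owned_def)

lemma owned_tl: "owned t s g xs \<Longrightarrow> owned t s g (tl xs)"
  by (cases xs) (auto simp: owned_def)

lemma owned_hd:
  "owned t s g xs \<Longrightarrow> xs \<noteq> [] \<Longrightarrow> hd xs \<in> o_alloc s \<and> gh_own g (hd xs) = t \<and> hd xs \<noteq> null"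
  by (cases xs) (auto simp: owned_def)

lemma owned_last:
  "owned t s g xs \<Longrightarrow> xs \<noteq> [] \<Longrightarrow> last xs \<in> o_alloc s \<and> gh_own g (last xs) = t \<and> last xs \<noteq> null"
  by (metis last_in_set owned_def)

lemma owned_append: "owned t s g (xs @ ys) \<Longrightarrow> owned t s g xs \<and> owned t s g ys"
  by (auto simp: owned_def)

lemma optype_hd: "optype s x xs \<Longrightarrow> xs \<noteq> [] \<Longrightarrow> o_op s (hd xs) = x"
  by (auto simp: optype_def)

lemma hlist_owned: "hlist t s g xs \<Longrightarrow> owned t s g xs \<and> xs \<noteq> []"
  by (simp add: hlist_def plist_def)

lemma head_own:
  "leads t l s g \<Longrightarrow> hlist t s g (gh_q g t) \<Longrightarrow> gh_own g (l_mOp l) = t \<and> l_mOp l \<in> o_alloc s"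
  using owned_hd[of t s g "gh_q g t"] by (auto simp: leads_def hlist_def plist_def)

section \<open>Stability of the assertions under \<open>rely\<close>\<close>

context
  fixes N :: nat and u m s g s' g'
  assumes R: "rely u m s g s' g'" and G: "global_inv N s g"
begin

lemma rely_fields:
  assumes "r \<in> o_alloc s" "gh_own g r = u"
  shows "o_next s' r = o_next s r" "o_last s' r = o_last s r" "o_length s' r = o_length s r"
    "gh_mode g' r = gh_mode g r" "gh_res g' r = gh_res g r" "o_status s' r = o_status s r"
    "gh_own g' r = u"
    "r \<noteq> null \<Longrightarrow> o_op s r = PUSH \<Longrightarrow> c_next s' (o_cell s r) = c_next s (o_cell s r)"
proof -
  have "keeps u r s g s' g'" using R assms by (simp add: rely_def)
  then show "o_next s' r = o_next s r" "o_last s' r = o_last s r" "o_length s' r = o_length s r"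
    "gh_mode g' r = gh_mode g r" "gh_res g' r = gh_res g r" "o_status s' r = o_status s r"
    "gh_own g' r = u"
    "r \<noteq> null \<Longrightarrow> o_op s r = PUSH \<Longrightarrow> c_next s' (o_cell s r) = c_next s (o_cell s r)"
    by (simp_all add: keeps_def)
qed

lemma rely_const:
  assumes "r \<in> o_alloc s"
  shows "r \<in> o_alloc s'" "o_id s' r = o_id s r" "o_op s' r = o_op s r"
    "o_op s r = PUSH \<Longrightarrow> o_cell s' r = o_cell s r"
    "gh_res g r = Some x \<Longrightarrow> gh_res g' r = Some x"
    "gh_mode g r = MFin \<Longrightarrow> gh_mode g' r = MFin"
    "o_op s r = POP \<Longrightarrow> celldone s g r \<Longrightarrow> celldone s' g' r"
    "gh_mode g r = MFin \<Longrightarrow> o_status s r = FINISHED \<Longrightarrow> o_status s' r = FINISHED"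
    "finok s g r \<Longrightarrow> finok s' g' r"
proof -
  have *: "mono_op r s g s' g'" "extends s g s' g'" using R assms by (simp_all add: rely_def)
  show "r \<in> o_alloc s'" using *(2) assms by (auto simp: extends_def)
  show "o_id s' r = o_id s r" "o_op s' r = o_op s r"
    "o_op s r = PUSH \<Longrightarrow> o_cell s' r = o_cell s r"
    "gh_res g r = Some x \<Longrightarrow> gh_res g' r = Some x"
    "gh_mode g r = MFin \<Longrightarrow> gh_mode g' r = MFin"
    "o_op s r = POP \<Longrightarrow> celldone s g r \<Longrightarrow> celldone s' g' r"
    "gh_mode g r = MFin \<Longrightarrow> o_status s r = FINISHED \<Longrightarrow> o_status s' r = FINISHED"
    "finok s g r \<Longrightarrow> finok s' g' r"
    using *(1) by (auto simp: mono_op_def finok_def split: if_splits)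
qed

lemma rely_misc:
  "g_location s' u = g_location s u" "gh_q g' u = gh_q g u" "gh_z g' u = gh_z g u"
  "c \<in> gh_pub g \<Longrightarrow> c \<in> gh_pub g'" "c \<in> gh_pub g \<Longrightarrow> c_next s' c = c_next s c"
  "c \<in> c_alloc s \<Longrightarrow> c \<in> c_alloc s'" "c \<in> c_alloc s \<Longrightarrow> c_data s' c = c_data s c"
  using R by (auto simp: rely_def extends_def)

lemma rely_owned: "owned u s g xs \<Longrightarrow> owned u s' g' xs"
  by (auto simp: owned_def rely_fields rely_const)

lemma rely_pub_next: "c \<in> gh_pub g \<Longrightarrow> c_next s c = null \<or> c_next s c \<in> gh_pub g"
  using G by (auto simp: global_inv_def)

text \<open>A walk that starts in a published cell stays among published cells until it reaches
  \<open>null\<close>, and their \<open>next\<close> fields are frozen.\<close>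

lemma rely_adv:
  "c = null \<or> c \<in> gh_pub g \<Longrightarrow> adv (c_next s') n c = adv (c_next s) n c"
  by (induction n arbitrary: c) (use rely_pub_next rely_misc(5) in auto)

lemma pub_alloc: "c \<in> gh_pub g \<Longrightarrow> c \<in> c_alloc s"
  using G by (auto simp: global_inv_def)

lemma rely_pops: "c = null \<or> c \<in> gh_pub g \<Longrightarrow> pops s' n c = pops s n c"
  by (induction n arbitrary: c)
    (use rely_pub_next rely_misc(5) rely_misc(7) pub_alloc in auto)

lemma rely_lseg: "lseg (o_next s) a xs b \<Longrightarrow> owned u s g xs \<Longrightarrow> lseg (o_next s') a xs b"
  by (erule lseg_cong) (auto simp: owned_def rely_fields)

lemma rely_waits: "owned u s g xs \<Longrightarrow> set ys \<subseteq> set xs \<Longrightarrow> waits g ys \<Longrightarrow> waits g' ys"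
  by (auto simp: waits_def owned_def rely_fields subset_iff)

lemma rely_unres: "owned u s g xs \<Longrightarrow> set ys \<subseteq> set xs \<Longrightarrow> unres g ys \<Longrightarrow> unres g' ys"
  by (auto simp: unres_def owned_def rely_fields subset_iff)

lemma rely_optype: "owned u s g xs \<Longrightarrow> set ys \<subseteq> set xs \<Longrightarrow> optype s x ys \<Longrightarrow> optype s' x ys"
  by (auto simp: optype_def owned_def rely_const subset_iff)

lemma rely_linked:
  assumes "linked s xs" "owned u s g xs" "optype s PUSH xs"
  shows "linked s' xs"
proof (rule linked_cong[OF assms(1)])
  fix x
  assume x: "x \<in> set xs"
  then show "o_cell s' x = o_cell s x"
    using assms(2,3) by (simp add: owned_def optype_def rely_const)
next
  fix x
  assume "x \<in> set (butlast xs)"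
  then have "x \<in> set xs" by (rule in_set_butlastD)
  then show "c_next s' (o_cell s x) = c_next s (o_cell s x)"
    using owned_mem[OF assms(2)] assms(3) by (auto simp: optype_def intro!: rely_fields(8))
qed

lemma rely_plist:
  assumes "plist u s g xs"
  shows "plist u s' g' xs"
proof -
  have o: "owned u s g xs" and "xs \<noteq> []" using assms by (auto simp: plist_def)
  then have h: "o_op s' (hd xs) = o_op s (hd xs)" using owned_hd[of u s g xs] by (simp add: rely_const)
  have "set (tl xs) \<subseteq> set xs" by (cases xs) auto
  then show ?thesis using assms o
    unfolding plist_def h
    by (auto intro: rely_owned rely_lseg rely_optype[OF o] rely_unres[OF o] rely_waits[OF o]
      rely_linked)
qed

lemma rely_hlist:
  assumes "hlist u s g xs"
  shows "hlist u s' g' xs"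
  using rely_plist[of xs] owned_hd[of u s g xs] assms
  by (auto simp: hlist_def plist_def rely_fields)

lemma rely_leads:
  assumes "leads u l s g" "hlist u s g (gh_q g u)"
  shows "leads u l s' g'"
  using head_own[OF assms] assms(1) by (simp add: leads_def rely_misc(2) rely_fields(4))

lemma rely_head:
  assumes "head u l s g"
  shows "head u l s' g'"
proof -
  have *: "leads u l s g" "hlist u s g (gh_q g u)" using assms by (auto simp: head_def)
  then show ?thesis
    using head_own[OF *] assms rely_leads[OF *] rely_hlist[OF *(2)]
    by (simp add: head_def rely_misc(2) rely_fields(6))
qed

lemma rely_celldone: "r \<in> o_alloc s \<Longrightarrow> o_op s r = POP \<Longrightarrow> celldone s g r \<Longrightarrow> celldone s' g' r"
  by (rule rely_const(7))

text \<open>Only a record that still waits can be changed from outside, and \<open>wakes\<close>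
  restricts how. A finished record is final, and a retried one belongs to the waiting
  thread.\<close>

lemma rely_waiting:
  assumes "waiting u l s g" "l_mOp l = m" "base u l s g"
  shows "waiting u l s' g'"
proof -
  have m: "m \<in> o_alloc s" "o_id s m = u" using assms by (auto simp: base_def)
  then have w: "wakes m s g s' g'" using R by (simp add: rely_def)
  consider "gh_mode g m = MWait" "o_status s m = INIT" |
    "gh_mode g m = MFin" "o_status s m = FINISHED" "finok s g m" |
    "leads u l s g" "hlist u s g (gh_q g u)" "o_status s m = RETRY"
    using assms by (auto simp: waiting_def)
  then show ?thesis
  proof cases
    case 1
    then show ?thesis using w assms by (auto simp: wakes_def waiting_def)
  next
    case 2
    then show ?thesis using rely_const[OF m(1)] assms by (auto simp: waiting_def)
  next
    case 3
    then show ?thesis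
      using head_own[OF 3(1,2)] rely_leads[OF 3(1,2)] rely_hlist[OF 3(2)] assms
      by (simp add: waiting_def rely_misc(2) rely_fields(6))
  qed
qed

lemma rely_elimd:
  assumes "elimd l s g a" "a \<in> o_alloc s" "base u l s g"
  shows "elimd l s' g' a"
proof -
  have m: "l_mOp l \<in> o_alloc s" using assms by (auto simp: base_def)
  show ?thesis using assms m
    by (auto simp: elimd_def rely_const rely_misc split: if_splits)
qed

lemma rely_capt:
  assumes "capt u l s g a" "l_mOp l = m" "base u l s g"
  shows "capt u l s' g' a"
  using assms rely_waiting[of l] rely_elimd[of l a]
  by (auto simp: capt_def base_def rely_const)

lemma rely_colp:
  assumes "colp u l s g" "l_mOp l = m" "base u l s g"
  shows "colp u l s' g'"
  using assms rely_capt[of l] rely_head[of l] by (auto simp: colp_def rely_misc)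

lemma rely_quiet: "quiet u s g \<Longrightarrow> quiet u s' g'"
  using R by (auto simp: quiet_def rely_def extends_def mono_op_def)

text \<open>\<open>sole\<close> survives because no other thread creates or revives an unfinished
  record with identifier \<open>u\<close>, which is the last clause of \<open>rely\<close>.\<close>

lemma rely_base:
  assumes "base u l s g"
  shows "base u l s' g'"
proof -
  have m: "l_mOp l \<in> o_alloc s" "l_mOp l \<noteq> null" using assms by (auto simp: base_def)
  have c: "o_cell s (l_mOp l) \<in> c_alloc s" if "o_op s (l_mOp l) = PUSH"
    using G m that by (auto simp: global_inv_def)
  have "r = l_mOp l" if "r \<in> o_alloc s'" "r \<noteq> null" "o_id s' r = u" "gh_mode g' r \<noteq> MFin" for r
  proof -
    have "r \<in> o_alloc s \<and> gh_mode g r \<noteq> MFin" using R that by (simp add: rely_def)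
    then show ?thesis using assms that rely_const(2)[of r] by (simp add: base_def sole_def)
  qed
  then have "sole u (l_mOp l) s' g'" by (simp add: sole_def)
  then show ?thesis
    using assms m c by (auto simp: base_def callop_def rely_const rely_misc split: call.splits)
qed

lemma rely_res: "owned u s g xs \<Longrightarrow> set ys \<subseteq> set xs \<Longrightarrow> map (gh_res g') ys = map (gh_res g) ys"
  by (auto simp: owned_def rely_fields subset_iff)

lemma rely_psupply:
  "psupply s g ys c \<Longrightarrow> owned u s g xs \<Longrightarrow> set ys \<subseteq> set xs \<Longrightarrow> psupply s' g' ys c"
  by (auto simp: psupply_def rely_res rely_pops rely_misc)

lemma rely_mfin:
  assumes "mfin u l s g"
  shows "mfin u l s' g'"
proof -
  have o: "owned u s g (gh_q g u)" "gh_q g u \<noteq> []" "hd (gh_q g u) = l_mOp l" using assms by (auto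
    simp: mfin_def)
  then have m: "l_mOp l \<in> o_alloc s" using owned_hd by metis
  then show ?thesis using o assms
    by (auto simp: mfin_def rely_misc rely_const intro: rely_owned rely_lseg rely_optype)
qed

lemma rely_pnone:
  assumes "pnone u l s g" "base u l s g"
  shows "pnone u l s' g'"
proof -
  have o: "owned u s g (gh_q g u)" using assms by (auto simp: pnone_def)
  have m: "l_mOp l \<in> o_alloc s" using assms by (simp add: base_def)
  then show ?thesis using o assms
    by (auto simp: pnone_def rely_misc rely_const intro: rely_owned rely_lseg rely_optype)
      (auto simp: owned_def rely_const)
qed

lemma rely_ufin:
  assumes "ufin u l s g"
  shows "ufin u l s' g'"
proof -
  have o: "owned u s g (gh_q g u)" using assms by (auto simp: mfin_def ufin_def)
  then show ?thesis using assms rely_mfin[of l]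
    by (auto simp: ufin_def rely_misc) (auto simp: owned_def rely_const)
qed

lemma rely_pairok:
  assumes "pairok s g x y" "x \<in> o_alloc s" "y \<in> o_alloc s"
  shows "pairok s' g' x y"
  using assms by (auto simp: pairok_def rely_const rely_misc split: if_splits)

lemma rely_paired:
  "paired s g xs ys \<Longrightarrow> owned u s g xs \<Longrightarrow> owned u s g ys \<Longrightarrow> paired s' g' xs ys"
proof (induction xs ys rule: list_induct2')
  case (4 x xs y ys)
  then show ?case
    using rely_pairok[of x y] by (auto simp: owned_def)
qed (auto simp: unres_def owned_def rely_fields)

lemma rely_elimbase:
  assumes "elimbase u l s g" "base u l s g"
  shows "elimbase u l s' g'"
proof -
  have m: "l_mOp l \<in> o_alloc s" using assms by (simp add: base_def)
  then show ?thesis using assms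
    by (auto simp: elimbase_def rely_const rely_fields)
qed

lemma rely_elimlists:
  assumes "elimlists u l s g xs ys" "elimbase u l s g" "base u l s g"
  shows "elimlists u l s' g' xs ys"
proof -
  have m: "l_mOp l \<in> o_alloc s" using assms by (simp add: base_def)
  have o: "owned u s g (xs @ ys)" "owned u s g xs" "owned u s g ys"
    using assms by (auto simp: elimlists_def dest: owned_append)
  have s: "set (tl zs) \<subseteq> set zs" for zs :: "nat list" by (cases zs) auto
  have "linked s' xs" if "o_op s (l_mOp l) = PUSH"
    using assms(1) that o by (auto simp: elimlists_def intro: rely_linked)
  moreover have "linked s' ys" if "o_op s (l_mOp l) = POP"
    using assms(1,2) that o by (cases "o_op s (l_pInf l)") (auto simp: elimlists_def elimbase_def
      intro: rely_linked)
  moreover have "l_pInf l \<in> o_alloc s" "gh_own g (l_pInf l) = u" "gh_own g (l_mOp l) = u"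
    using assms(2) by (auto simp: elimbase_def)
  moreover note assms(1)[unfolded elimlists_def]
  moreover have "optype s' x xs" if "optype s x xs" for x by (rule rely_optype[OF o(2) _ that]) simp
  moreover have "optype s' x ys" if "optype s x ys" for x by (rule rely_optype[OF o(3) _ that]) simp
  moreover have "waits g' (tl xs)" if "waits g (tl xs)" by (rule rely_waits[OF o(2) _ that]) (rule s)
  moreover have "waits g' (tl ys)" if "waits g (tl ys)" by (rule rely_waits[OF o(3) _ that]) (rule s)
  moreover note rely_lseg[OF _ o(2)] rely_lseg[OF _ o(3)] rely_owned[OF o(1)]
  ultimately show ?thesis
    using m by (simp add: elimlists_def rely_const rely_fields)
qed

lemma rely_elimfull:
  assumes "elimfull u l s g a b" "base u l s g"
  shows "elimfull u l s' g' a b"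
proof -
  have m: "l_mOp l \<in> o_alloc s" using assms by (simp add: base_def)
  have e: "elimbase u l s g" "elimlists u l s g (gh_q g u) (gh_z g u)" using assms by (auto
    simp: elimfull_def)
  have o: "owned u s g (gh_q g u)" "owned u s g (gh_z g u)" using e by (auto simp: elimlists_def
    dest: owned_append)
  show ?thesis using assms m o rely_elimbase[OF e(1) assms(2)] rely_elimlists[OF e(2,1) assms(2)] e(1)
      rely_paired[OF _ o]
    by (simp add: elimfull_def rely_misc rely_fields elimbase_def)
qed

lemma rely_comb0:
  assumes "comb0 u l s g" "base u l s g"
  shows "comb0 u l s' g'"
proof -
  have m: "l_mOp l \<in> o_alloc s" using assms by (simp add: base_def)
  have "l_pInf l \<in> o_alloc s \<and> gh_own g (l_pInf l) = u"
    using assms owned_hd[of u s g "gh_z g u"] by (auto simp: comb0_def dest: hlist_owned)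
  then show ?thesis using assms m
      rely_hlist[of "gh_z g u"] rely_head[of l]
    by (simp add: comb0_def rely_misc rely_const rely_fields)
qed

lemma rely_act3:
  assumes "act3 u l s g" "base u l s g"
  shows "act3 u l s' g'"
proof -
  have m: "l_mOp l \<in> o_alloc s" using assms by (simp add: base_def)
  have "l_pInf l \<in> o_alloc s"
    using assms owned_hd[of u s g "gh_z g u"]
    by (auto simp: act3_def comb0_def elimfull_def elimbase_def split: if_splits dest: hlist_owned)
  \<comment> \<open>In the elimination case \<open>act3\<close> speaks of lists that start at
    \<open>l_aInf\<close> and \<open>l_pInf\<close>. The assignments of A4 are anticipated in the
    local state so that \<open>rely_elimfull\<close> applies.\<close>
  moreover have "base u (l\<lparr>l_aCurr := l_aInf l, l_pCurr := l_pInf l\<rparr>) s g"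
    using assms by (simp add: base_def split: call.splits)
  ultimately show ?thesis
    using assms m rely_comb0[of l] rely_elimfull[of "l\<lparr>l_aCurr := l_aInf l, l_pCurr := l_pInf l\<rparr>" 0 0]
    by (auto simp: act3_def rely_const)
qed

lemma rely_comb1:
  assumes "comb1 u l s g" "base u l s g"
  shows "comb1 u l s' g'"
proof -
  have m: "l_mOp l \<in> o_alloc s" using assms by (simp add: base_def)
  have "gh_own g (l_mOp l) = u"
    using assms owned_hd[of u s g "gh_q g u"] by (auto simp: comb1_def leads_def plist_def)
  then show ?thesis using assms m
      rely_plist[of "gh_q g u"]
    by (simp add: comb1_def leads_def rely_misc rely_const rely_fields)
qed

lemma rely_elim13:
  assumes "elim13 u l s g" "base u l s g"
  shows "elim13 u l s' g'"
proof -
  have m: "l_mOp l \<in> o_alloc s" using assms by (simp add: base_def)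
  have e: "elimbase u l s g" "elimlists u l s g (gh_q g u) (gh_z g u)" using assms by (auto
    simp: elim13_def)
  have o: "owned u s g (gh_q g u)" "owned u s g (gh_z g u)" using e by (auto simp: elimlists_def
    dest: owned_append)
  show ?thesis using assms m o rely_elimbase[OF e(1) assms(2)] rely_elimlists[OF e(2,1) assms(2)] e(1)
      rely_paired[OF _ o(1) owned_tl[OF o(2)]] rely_waits[OF o(1) order_refl]
    by (simp add: elim13_def rely_misc rely_fields elimbase_def)
qed

lemma rely_rest:
  assumes "rest u l s g xs x" "base u l s g"
  shows "rest u l s' g' xs x"
proof -
  have m: "l_mOp l \<in> o_alloc s" using assms by (simp add: base_def)
  have "owned u s g xs" using assms by (simp add: rest_def plist_def)
  then show ?thesis using assms m
    using rely_waits[OF \<open>owned u s g xs\<close> order_refl] rely_plist[of xs] rely_const[of "l_mOp l"]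
    by (simp add: rest_def)
qed

lemma rely_mpop_inv:
  assumes T: "mpop_inv p u l s g" and b: "base u l s g" and pop: "o_op s (l_mOp l) = POP"
  shows "mpop_inv p u l s' g'"
proof -
  have m: "l_mOp l \<in> o_alloc s" using b by (simp add: base_def)
  note cell = rely_celldone[OF m pop]
  note simps = rely_misc rely_adv rely_head[of l] rely_mfin[of l] rely_pnone[OF _ b] cell
  \<comment> \<open>In the empty case \<open>l_par\<close> moves away from \<open>l_mOp\<close>, but
    it is the first record of the ghost list, which consists of pops.\<close>
  have par: "celldone s' g' (l_par l)" if a: "pnone u l s g" "celldone s g (l_par l)"
  proof -
    obtain x xs where "gh_q g u = x # xs" "x = l_par l" "x \<in> o_alloc s" "o_op s x = POP"
      using a by (cases "gh_q g u") (auto simp: pnone_def owned_def optype_def)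
    then show ?thesis using a rely_celldone by auto
  qed
  have q: "owned u s g (gh_q g u)" "set (tl (gh_q g u)) \<subseteq> set (gh_q g u)"
      "set (tl (tl (gh_q g u))) \<subseteq> set (gh_q g u)"
    if "mfin u l s g"
  proof -
    show "owned u s g (gh_q g u)" using that by (simp add: mfin_def)
    show "set (tl (gh_q g u)) \<subseteq> set (gh_q g u)" by (cases "gh_q g u") auto
    then show "set (tl (tl (gh_q g u))) \<subseteq> set (gh_q g u)" by (cases "tl (gh_q g u)") auto
  qed
  have hd: "celldone s' g' (hd (tl (gh_q g u)))"
    if "mfin u l s g" "tl (gh_q g u) \<noteq> []" "celldone s g (hd (tl (gh_q g u)))"
  proof -
    have "hd (tl (gh_q g u)) \<in> set (gh_q g u)" using q(2)[OF that(1)] that(2) by auto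
    then show ?thesis using that pop by (auto simp: mfin_def owned_def optype_def intro: rely_celldone)
  qed
  note sup = rely_psupply[OF _ q(1) order_refl] rely_psupply[OF _ q(1) q(2)] rely_psupply[OF _ q(1)
    q(3)]
  show ?thesis
    using T
  proof (cases p)
    case P21
    then show ?thesis using T rely_lseg[OF _ owned_tl[OF owned_tl[OF q(1)]]]
      by (simp add: simps sup)
  qed (use rely_misc(4)[of "l_nTop l"] in \<open>auto simp: simps par sup hd\<close>)
qed

lemma rely_mpush_inv:
  assumes T: "mpush_inv p u l s g" and b: "base u l s g" and push: "o_op s (l_mOp l) = PUSH"
  shows "mpush_inv p u l s' g'"
proof -
  have h: "gh_q g u \<noteq> [] \<and> owned u s g (gh_q g u) \<and> optype s PUSH (gh_q g u)" if "head u l s g"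
    using that push by (auto simp: head_def leads_def hlist_def plist_def)
  have last: "o_cell s' (last (gh_q g u)) = o_cell s (last (gh_q g u))"
      "c_next s' (o_cell s (last (gh_q g u))) = c_next s (o_cell s (last (gh_q g u)))"
    if "head u l s g"
    using h[OF that] owned_last[of u s g "gh_q g u"]
    by (auto simp: optype_def intro!: rely_const(4) rely_fields(8))
  have q: "owned u s g (gh_q g u)" if "ufin u l s g" using that by (simp add: mfin_def ufin_def)
  have m: "o_cell s' (l_mOp l) = o_cell s (l_mOp l)" using b push by (auto simp: base_def
    intro!: rely_const(4))
  show ?thesis using T rely_head[of l] rely_ufin[of l] last m
      rely_lseg[OF _ owned_tl[OF owned_tl[OF q]]]
    by (cases p) (simp_all add: rely_misc disj_imp)
qed

lemma rely_col_inv: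
  assumes T: "col_inv p N u l s g" and b: "base u l s g" and "l_mOp l = m"
  shows "col_inv p N u l s' g'"
  using T rely_colp[OF _ assms(3) b] rely_head[of l] by (cases p) (simp_all add: rely_misc rely_const)

lemma rely_act_inv:
  assumes T: "act_inv p N u l s g" and b: "base u l s g"
  shows "act_inv p N u l s' g'"
proof -
  have m: "l_mOp l \<in> o_alloc s" using b by (simp add: base_def)
  show ?thesis
    using T rely_head[of l] rely_act3[OF _ b] m by (cases p) (simp_all add: rely_misc rely_const)
qed

lemma rely_pas_inv:
  assumes T: "pas_inv p u l s g" and b: "base u l s g" and "l_mOp l = m"
  shows "pas_inv p u l s' g'"
proof -
  have m: "l_mOp l \<in> o_alloc s" using b by (simp add: base_def)
  \<comment> \<open>A status other than \<open>INIT\<close> belongs to the finished or the retried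
    case of \<open>waiting\<close>, and there no other thread changes it.\<close>
  have w11: "o_status s' (l_mOp l) \<noteq> INIT" if "waiting u l s g" "o_status s (l_mOp l) \<noteq> INIT"
    using that rely_const(8)[OF m] head_own[of u l g s] rely_fields(6)[of "l_mOp l"]
    by (auto simp: waiting_def)
  show ?thesis
    using T rely_capt[OF _ assms(3) b] rely_waiting[OF _ assms(3) b] rely_elimd[OF _ _ b] m w11
      rely_leads[of l] rely_hlist[of "gh_q g u"]
    by (cases p) (auto simp: rely_misc rely_const elimd_def)
qed

lemma rely_comb_inv:
  assumes T: "comb_inv p u l s g" and b: "base u l s g"
  shows "comb_inv p u l s' g'"
proof -
  have m: "l_mOp l \<in> o_alloc s" using b by (simp add: base_def)
  have h: "gh_q g u \<noteq> [] \<and> owned u s g (gh_q g u) \<and> optype s (o_op s (l_mOp l)) (gh_q g u)"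
    if "comb0 u l s g"
    using that by (auto simp: comb0_def head_def leads_def hlist_def plist_def)
  have last: "o_cell s' (last (gh_q g u)) = o_cell s (last (gh_q g u))"
      "c_next s' (o_cell s (last (gh_q g u))) = c_next s (o_cell s (last (gh_q g u)))"
    if "comb0 u l s g" "o_op s (l_mOp l) = PUSH"
    using h[OF that(1)] that(2) owned_last[of u s g "gh_q g u"]
    by (auto simp: optype_def intro!: rely_const(4) rely_fields(8))
  have p: "l_pInf l \<in> o_alloc s" "o_op s (l_mOp l) = PUSH \<Longrightarrow>
    o_cell s' (l_pInf l) = o_cell s (l_pInf l)" if "comb0 u l s g"
    using that owned_hd[of u s g "gh_z g u"] by (auto simp: comb0_def intro: rely_const(4)
      dest: hlist_owned)
  have c: "gh_own g (l_mOp l) = u" "gh_own g (l_pInf l) = u" "l_pInf l \<in> o_alloc s" if "comb1 u l s g"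
    using that owned_hd[of u s g "gh_q g u"] by (auto simp: comb1_def leads_def plist_def)
  show ?thesis
    using T rely_comb0[OF _ b] rely_comb1[OF _ b] m last p c
    by (cases p) (simp_all add: rely_misc rely_const rely_fields)
qed

lemma rely_elim_inv:
  assumes T: "elim_inv p u l s g" and b: "base u l s g"
  shows "elim_inv p u l s' g'"
proof -
  have m: "l_mOp l \<in> o_alloc s" using b by (simp add: base_def)
  have q: "gh_own g (l_mOp l) = u \<and> l_pInf l \<in> o_alloc s \<and> gh_own g (l_pInf l) = u"
    if "elimbase u l s g"
    using that by (auto simp: elimbase_def)
  have r: "x \<in> o_alloc s \<and> gh_own g x = u" if "rest u l s g xs x" for xs x
    using that owned_hd[of u s g xs] by (auto simp: rest_def plist_def)
  have c: "l_aCurr l \<in> o_alloc s \<and> l_pCurr l \<in> o_alloc s \<and> o_op s (l_aCurr l) = o_op s (l_mOp l) \<and>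
      o_op s (l_pCurr l) \<noteq> o_op s (l_mOp l)" if e: "elimfull u l s g a d" for a d
  proof -
    obtain x xs y ys where "gh_q g u = x # xs" "gh_z g u = y # ys"
      using e by (cases "gh_q g u"; cases "gh_z g u") (auto simp: elimfull_def)
    then show ?thesis using e
      by (auto simp: elimfull_def elimlists_def elimbase_def owned_def optype_def)
  qed
  show ?thesis
    using T rely_elimfull[OF _ b] rely_elim13[OF _ b] rely_rest[OF _ b] rely_elimbase[OF _ b]
      rely_const(9)[OF m]
    by (cases p) (auto simp: rely_misc rely_const m dest!: q r c simp: rely_fields)
qed

lemma rely_thread_inv:
  assumes "pc_inv p N u l s g" "l_mOp l = m"
  shows "pc_inv p N u l s' g'"
proof -
  have l: "base u l s g \<Longrightarrow> l_mOp l \<in> o_alloc s" by (simp add: base_def)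
  show ?thesis
    using assms(1) rely_base[of l] rely_mpop_inv[of _ l] rely_mpush_inv[of _ l] rely_col_inv[OF _ _
      assms(2)] rely_act_inv[of _ l]
      rely_pas_inv[OF _ _ assms(2)] rely_comb_inv[of _ l] rely_elim_inv[of _ l] rely_quiet
    by (cases p) (auto simp: rely_misc rely_const l)
qed

end

section \<open>Steps without linearization\<close>

lemma owned_frame [simp]:
  "owned t (s\<lparr>g_central := v0\<rparr>) g xs = owned t s g xs"
  "owned t (s\<lparr>g_collision := v1\<rparr>) g xs = owned t s g xs"
  "owned t (s\<lparr>g_location := v2\<rparr>) g xs = owned t s g xs"
  "owned t (s\<lparr>c_next := v3\<rparr>) g xs = owned t s g xs"
  "owned t (s\<lparr>o_length := v4\<rparr>) g xs = owned t s g xs"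
  "owned t (s\<lparr>o_status := v5\<rparr>) g xs = owned t s g xs"
  "owned t (s\<lparr>o_cell := v6\<rparr>) g xs = owned t s g xs"
  "owned t (s\<lparr>o_next := v7\<rparr>) g xs = owned t s g xs"
  "owned t (s\<lparr>o_last := v8\<rparr>) g xs = owned t s g xs"
  "owned t s (g\<lparr>gh_q := w0\<rparr>) xs = owned t s g xs"
  "owned t s (g\<lparr>gh_z := w1\<rparr>) xs = owned t s g xs"
  "owned t s (g\<lparr>gh_mode := w2\<rparr>) xs = owned t s g xs"
  by (simp_all add: owned_def)

lemma optype_frame [simp]:
  "optype (s\<lparr>g_central := v0\<rparr>) x xs = optype s x xs"
  "optype (s\<lparr>g_collision := v1\<rparr>) x xs = optype s x xs"
  "optype (s\<lparr>g_location := v2\<rparr>) x xs = optype s x xs"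
  "optype (s\<lparr>c_next := v3\<rparr>) x xs = optype s x xs"
  "optype (s\<lparr>o_length := v4\<rparr>) x xs = optype s x xs"
  "optype (s\<lparr>o_status := v5\<rparr>) x xs = optype s x xs"
  "optype (s\<lparr>o_cell := v6\<rparr>) x xs = optype s x xs"
  "optype (s\<lparr>o_next := v7\<rparr>) x xs = optype s x xs"
  "optype (s\<lparr>o_last := v8\<rparr>) x xs = optype s x xs"
  by (simp_all add: optype_def)

lemma unres_frame [simp]:
  "unres (g\<lparr>gh_q := w0\<rparr>) xs = unres g xs"
  "unres (g\<lparr>gh_z := w1\<rparr>) xs = unres g xs"
  "unres (g\<lparr>gh_mode := w2\<rparr>) xs = unres g xs"
  by (simp_all add: unres_def)

lemma waits_frame [simp]:
  "waits (g\<lparr>gh_q := w0\<rparr>) xs = waits g xs"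
  "waits (g\<lparr>gh_z := w1\<rparr>) xs = waits g xs"
  by (simp_all add: waits_def)

lemma callop_frame [simp]:
  "callop c m (s\<lparr>g_central := v0\<rparr>) = callop c m s"
  "callop c m (s\<lparr>g_collision := v1\<rparr>) = callop c m s"
  "callop c m (s\<lparr>g_location := v2\<rparr>) = callop c m s"
  "callop c m (s\<lparr>c_next := v3\<rparr>) = callop c m s"
  "callop c m (s\<lparr>o_length := v4\<rparr>) = callop c m s"
  "callop c m (s\<lparr>o_status := v5\<rparr>) = callop c m s"
  "callop c m (s\<lparr>o_next := v7\<rparr>) = callop c m s"
  "callop c m (s\<lparr>o_last := v8\<rparr>) = callop c m s"
  by (simp_all add: callop_def split: call.split)

lemma sole_frame [simp]:
  "sole t m (s\<lparr>g_central := v0\<rparr>) g = sole t m s g"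
  "sole t m (s\<lparr>g_collision := v1\<rparr>) g = sole t m s g"
  "sole t m (s\<lparr>g_location := v2\<rparr>) g = sole t m s g"
  "sole t m (s\<lparr>c_next := v3\<rparr>) g = sole t m s g"
  "sole t m (s\<lparr>o_length := v4\<rparr>) g = sole t m s g"
  "sole t m (s\<lparr>o_status := v5\<rparr>) g = sole t m s g"
  "sole t m (s\<lparr>o_cell := v6\<rparr>) g = sole t m s g"
  "sole t m (s\<lparr>o_next := v7\<rparr>) g = sole t m s g"
  "sole t m (s\<lparr>o_last := v8\<rparr>) g = sole t m s g"
  "sole t m s (g\<lparr>gh_q := w0\<rparr>) = sole t m s g"
  "sole t m s (g\<lparr>gh_z := w1\<rparr>) = sole t m s g"
  by (simp_all add: sole_def)

lemma base_frame [simp]: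
  "base_at t c m (s\<lparr>g_central := v0\<rparr>) g = base_at t c m s g"
  "base_at t c m (s\<lparr>g_collision := v1\<rparr>) g = base_at t c m s g"
  "base_at t c m (s\<lparr>g_location := v2\<rparr>) g = base_at t c m s g"
  "base_at t c m (s\<lparr>c_next := v3\<rparr>) g = base_at t c m s g"
  "base_at t c m (s\<lparr>o_length := v4\<rparr>) g = base_at t c m s g"
  "base_at t c m (s\<lparr>o_status := v5\<rparr>) g = base_at t c m s g"
  "base_at t c m (s\<lparr>o_next := v7\<rparr>) g = base_at t c m s g"
  "base_at t c m (s\<lparr>o_last := v8\<rparr>) g = base_at t c m s g"
  "base_at t c m s (g\<lparr>gh_q := w0\<rparr>) = base_at t c m s g"
  "base_at t c m s (g\<lparr>gh_z := w1\<rparr>) = base_at t c m s g"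
  by (simp_all add: base_def)

lemma celldone_frame [simp]:
  "celldone (s\<lparr>g_collision := v1\<rparr>) g r = celldone s g r"
  "celldone (s\<lparr>g_location := v2\<rparr>) g r = celldone s g r"
  "celldone (s\<lparr>c_next := v3\<rparr>) g r = celldone s g r"
  "celldone (s\<lparr>o_length := v4\<rparr>) g r = celldone s g r"
  "celldone (s\<lparr>o_status := v5\<rparr>) g r = celldone s g r"
  "celldone (s\<lparr>o_next := v7\<rparr>) g r = celldone s g r"
  "celldone (s\<lparr>o_last := v8\<rparr>) g r = celldone s g r"
  "celldone s (g\<lparr>gh_q := w0\<rparr>) r = celldone s g r"
  "celldone s (g\<lparr>gh_z := w1\<rparr>) r = celldone s g r"
  "celldone s (g\<lparr>gh_mode := w2\<rparr>) r = celldone s g r"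
  by (simp_all add: celldone_def)

lemma finok_frame [simp]:
  "finok (s\<lparr>g_collision := v1\<rparr>) g r = finok s g r"
  "finok (s\<lparr>g_location := v2\<rparr>) g r = finok s g r"
  "finok (s\<lparr>c_next := v3\<rparr>) g r = finok s g r"
  "finok (s\<lparr>o_length := v4\<rparr>) g r = finok s g r"
  "finok (s\<lparr>o_status := v5\<rparr>) g r = finok s g r"
  "finok (s\<lparr>o_next := v7\<rparr>) g r = finok s g r"
  "finok (s\<lparr>o_last := v8\<rparr>) g r = finok s g r"
  "finok s (g\<lparr>gh_q := w0\<rparr>) r = finok s g r"
  "finok s (g\<lparr>gh_z := w1\<rparr>) r = finok s g r"
  "finok s (g\<lparr>gh_mode := w2\<rparr>) r = finok s g r"
  by (simp_all add: finok_def)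

lemma pops_frame [simp]:
  "pops (s\<lparr>g_central := v0\<rparr>) n c = pops s n c"
  "pops (s\<lparr>o_status := v5\<rparr>) n c = pops s n c"
  "pops (s\<lparr>o_cell := v6\<rparr>) n c = pops s n c"
  "pops (s\<lparr>o_next := v7\<rparr>) n c = pops s n c"
  by (induction n arbitrary: c, simp_all)+

lemma linked_frame [simp]:
  "linked (s\<lparr>g_central := v0\<rparr>) xs = linked s xs"
  "linked (s\<lparr>g_collision := v1\<rparr>) xs = linked s xs"
  "linked (s\<lparr>g_location := v2\<rparr>) xs = linked s xs"
  "linked (s\<lparr>o_length := v4\<rparr>) xs = linked s xs"
  "linked (s\<lparr>o_status := v5\<rparr>) xs = linked s xs"
  "linked (s\<lparr>o_next := v7\<rparr>) xs = linked s xs"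
  "linked (s\<lparr>o_last := v8\<rparr>) xs = linked s xs"
  by (induction xs rule: induct_list012, simp_all)+

lemma psupply_frame [simp]:
  "psupply (s\<lparr>g_central := v0\<rparr>) g xs c = psupply s g xs c"
  "psupply (s\<lparr>o_status := v5\<rparr>) g xs c = psupply s g xs c"
  "psupply (s\<lparr>o_cell := v6\<rparr>) g xs c = psupply s g xs c"
  "psupply (s\<lparr>o_next := v7\<rparr>) g xs c = psupply s g xs c"
  "psupply s (g\<lparr>gh_q := w0\<rparr>) xs c = psupply s g xs c"
  "psupply s (g\<lparr>gh_mode := w2\<rparr>) xs c = psupply s g xs c"
  by (simp_all add: psupply_def)

lemma pairok_frame [simp]:
  "pairok (s\<lparr>g_location := v2\<rparr>) g x y = pairok s g x y"
  "pairok (s\<lparr>o_length := v4\<rparr>) g x y = pairok s g x y"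
  "pairok (s\<lparr>o_status := v5\<rparr>) g x y = pairok s g x y"
  "pairok s (g\<lparr>gh_q := w0\<rparr>) x y = pairok s g x y"
  "pairok s (g\<lparr>gh_z := w1\<rparr>) x y = pairok s g x y"
  "pairok s (g\<lparr>gh_mode := w2\<rparr>) x y = pairok s g x y"
  by (simp_all add: pairok_def)

lemma paired_frame [simp]:
  "paired (s\<lparr>g_location := v2\<rparr>) g xs ys = paired s g xs ys"
  "paired (s\<lparr>o_length := v4\<rparr>) g xs ys = paired s g xs ys"
  "paired (s\<lparr>o_status := v5\<rparr>) g xs ys = paired s g xs ys"
  "paired s (g\<lparr>gh_q := w0\<rparr>) xs ys = paired s g xs ys"
  "paired s (g\<lparr>gh_z := w1\<rparr>) xs ys = paired s g xs ys"
  "paired s (g\<lparr>gh_mode := w2\<rparr>) xs ys = paired s g xs ys"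
  by (induction xs ys rule: list_induct2', simp_all)+

lemma plist_frame [simp]:
  "plist t (s\<lparr>g_collision := v1\<rparr>) g xs = plist t s g xs"
  "plist t (s\<lparr>g_location := v2\<rparr>) g xs = plist t s g xs"
  "plist t (s\<lparr>o_length := v4\<rparr>) g xs = plist t s g xs"
  "plist t (s\<lparr>o_status := v5\<rparr>) g xs = plist t s g xs"
  "plist t (s\<lparr>o_last := v8\<rparr>) g xs = plist t s g xs"
  "plist t s (g\<lparr>gh_q := w0\<rparr>) xs = plist t s g xs"
  "plist t s (g\<lparr>gh_z := w1\<rparr>) xs = plist t s g xs"
  by (simp_all add: plist_def)

lemma hlist_frame [simp]:
  "hlist t (s\<lparr>g_collision := v1\<rparr>) g xs = hlist t s g xs"
  "hlist t (s\<lparr>g_location := v2\<rparr>) g xs = hlist t s g xs"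
  "hlist t (s\<lparr>o_status := v5\<rparr>) g xs = hlist t s g xs"
  "hlist t s (g\<lparr>gh_q := w0\<rparr>) xs = hlist t s g xs"
  "hlist t s (g\<lparr>gh_z := w1\<rparr>) xs = hlist t s g xs"
  by (simp_all add: hlist_def)
text \<open>The effect of a step of thread \<open>i\<close> that neither linearizes nor transfers records.\<close>

definition guar ::
  "nat \<Rightarrow> 'v shared \<Rightarrow> 'v ghost \<Rightarrow> 'v shared \<Rightarrow> 'v ghost \<Rightarrow> bool" where
  "guar i s g s' g' \<longleftrightarrow>
     o_alloc s' = o_alloc s \<and> c_alloc s' = c_alloc s \<and> o_id s' = o_id s \<and> o_op s' = o_op s \<and>
     c_data s' = c_data s \<and> g_central s' = g_central s \<and>
     gh_own g' = gh_own g \<and> gh_pub g' = gh_pub g \<and> gh_res g' = gh_res g \<and>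
     (\<forall>r. o_next s' r \<noteq> o_next s r \<or> o_last s' r \<noteq> o_last s r \<or> o_length s' r \<noteq> o_length s r \<longrightarrow>
        gh_own g r = i) \<and>
     (\<forall>r. o_cell s' r \<noteq> o_cell s r \<longrightarrow> o_op s r = POP \<and> celldone s' g' r) \<and>
     (\<forall>r. o_status s' r \<noteq> o_status s r \<or> gh_mode g' r \<noteq> gh_mode g r \<longrightarrow> gh_own g r = i \<and>
        (gh_mode g' r = MFin \<and> o_status s' r = FINISHED \<and> finok s' g' r \<or>
         gh_mode g' r = MHead \<and> gh_mode g r = MHead)) \<and>
     (\<forall>c. c_next s' c \<noteq> c_next s c \<longrightarrow> (\<exists>r\<in>o_alloc s. r \<noteq> null \<and> gh_own g r = i \<and> o_op s r = PUSH \<and>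
        gh_res g r = None \<and> c = o_cell s r)) \<and>
     (\<forall>u. u \<noteq> i \<longrightarrow> g_location s' u = g_location s u \<and> gh_q g' u = gh_q g u \<and> gh_z g' u = gh_z g u) \<and>
     (\<forall>j. g_collision s' j \<noteq> g_collision s j \<longrightarrow> g_collision s' j = i)"

section \<open>The guarantee of a step implies the rely condition of the other threads\<close>

text \<open>A \<open>next\<close> field is written only in the cell of a push that has not taken
  effect, and such a cell is unpublished.\<close>

lemma guar_pub:
  assumes "guar i s g s' g'" "global_inv N s g" "c \<in> gh_pub g"
  shows "c_next s' c = c_next s c"
proof (rule ccontr)
  assume "c_next s' c \<noteq> c_next s c"
  then obtain r where "r \<in> o_alloc s" "r \<noteq> null" "o_op s r = PUSH" "gh_res g r = None" "c = o_cell s r"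
    using assms(1) by (auto simp: guar_def)
  then show False using assms(2,3) by (simp add: global_inv_def)
qed

lemma guar_celldone:
  assumes "guar i s g s' g'" "celldone s g r"
  shows "celldone s' g' r"
proof (cases "o_cell s' r = o_cell s r")
  case True
  then show ?thesis using assms by (simp add: guar_def celldone_def)
next
  case False
  then show ?thesis using assms(1) by (auto simp: guar_def)
qed

lemma guar_cell:
  assumes "guar i s g s' g'" "o_op s r = PUSH"
  shows "o_cell s' r = o_cell s r"
  using assms by (cases "o_cell s' r = o_cell s r") (simp_all add: guar_def)

lemma guar_global_inv:
  assumes G: "guar i s g s' g'" and I: "global_inv N s g" and "i \<le> N"
  shows "global_inv N s' g'"
proof -
  have eq: "o_alloc s' = o_alloc s" "c_alloc s' = c_alloc s" "o_op s' = o_op s" "o_id s' = o_id s"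
    "c_data s' = c_data s" "gh_pub g' = gh_pub g" "gh_res g' = gh_res g"
    using G by (simp_all add: guar_def)
  have "\<forall>j\<in>{1..N}. g_collision s' j \<le> N"
  proof
    fix j
    assume "j \<in> {1..N}"
    then have "g_collision s j \<le> N" using I by (simp add: global_inv_def)
    then show "g_collision s' j \<le> N"
      using G \<open>i \<le> N\<close> by (cases "g_collision s' j = g_collision s j") (simp_all add: guar_def)
  qed
  then show ?thesis
    using I guar_pub[OF G I] guar_cell[OF G] unfolding global_inv_def eq
    by auto
qed

lemma lseg_pub_cong:
  "lseg nx a xs b \<Longrightarrow> set xs \<subseteq> P \<Longrightarrow> (\<And>x. x \<in> P \<Longrightarrow> nx' x = nx x) \<Longrightarrow> lseg nx' a xs b"
  by (erule lseg_cong) auto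

lemma guar_stacked:
  assumes G: "guar i s g s' g'" and I: "global_inv N s g" and "stacked s g S"
  shows "stacked s' g' S"
proof -
  obtain cs where cs: "lseg (c_next s) (g_central s) cs null" "set cs \<subseteq> gh_pub g"
     "S = rev (map (\<lambda>c. the (c_data s c)) cs)"
    using assms(3) by (auto simp: stacked_def)
  have "g_central s' = g_central s" "c_data s' = c_data s" "gh_pub g' = gh_pub g"
    using G by (simp_all add: guar_def)
  then show ?thesis
    using cs lseg_pub_cong[OF cs(1,2) guar_pub[OF G I]] by (auto simp: stacked_def)
qed

lemma guar_rely:
  assumes G: "guar i s g s' g'" and I: "global_inv N s g" and u: "u \<noteq> i"
  shows "rely u m s g s' g'"
proof -
  have eq: "o_alloc s' = o_alloc s" "c_alloc s' = c_alloc s" "o_op s' = o_op s" "o_id s' = o_id s"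
    "c_data s' = c_data s" "gh_pub g' = gh_pub g" "gh_res g' = gh_res g" "gh_own g' = gh_own g"
    "g_location s' u = g_location s u" "gh_q g' u = gh_q g u" "gh_z g' u = gh_z g u"
    using G u by (simp_all add: guar_def)
  have st: "o_status s' r = o_status s r \<and> gh_mode g' r = gh_mode g r \<or> gh_own g r = i \<and>
        (gh_mode g' r = MFin \<and> o_status s' r = FINISHED \<and> finok s' g' r \<or>
         gh_mode g' r = MHead \<and> gh_mode g r = MHead)" for r
    using G by (auto simp: guar_def)
  have "extends s g s' g'" using guar_pub[OF G I] by (simp add: extends_def eq)
  moreover have "mono_op r s g s' g'" for r
    using guar_celldone[OF G, of r] guar_cell[OF G, of r] st[of r]
    by (auto simp: mono_op_def eq)
  moreover have "keeps u r s g s' g'" if r: "r \<in> o_alloc s" "gh_own g r = u" for r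
  proof -
    \<comment> \<open>The written cell belongs to a record owned by \<open>i\<close>; as cells of
      distinct push records differ, it is not the cell of \<open>r\<close>.\<close>
    have "c_next s' (o_cell s r) = c_next s (o_cell s r)" if *: "r \<noteq> null" "o_op s r = PUSH"
    proof (rule ccontr)
      assume "c_next s' (o_cell s r) \<noteq> c_next s (o_cell s r)"
      then obtain r' where "r' \<in> o_alloc s" "r' \<noteq> null" "gh_own g r' = i" "o_op s r' = PUSH"
        "o_cell s r = o_cell s r'" using G by (auto simp: guar_def)
      then have "r' = r" using I r * by (simp add: global_inv_def)
      then show False using \<open>gh_own g r' = i\<close> r u by simp
    qed
    moreover have "o_next s' r = o_next s r" "o_last s' r = o_last s r" "o_length s' r = o_length s r"
      using G r u by (auto simp: guar_def)
    ultimately show ?thesis using st[of r] r u by (auto simp: keeps_def eq)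
  qed
  moreover have "wakes m s g s' g'" using st[of m] by (auto simp: wakes_def)
  moreover have "gh_mode g r \<noteq> MFin" if "gh_mode g' r \<noteq> MFin" for r using that st[of r] by auto
  ultimately show ?thesis by (simp add: rely_def eq)
qed

section \<open>Preservation of the invariant by a single step\<close>

text \<open>The second disjunct of the last assumption serves the thread whose records are taken
  over or handed back; its assertion changes in a way that \<open>rely\<close> does not
  allow.\<close>

lemma inv_step:
  assumes I: "decs_inv N h ls s g S" and i: "i \<in> {1..N}"
    and T: "thread_inv N i l' s' g'" and G: "global_inv N s' g'" "stacked s' g' S'"
    and L: "\<exists>L. linearizing h L S' (phase_of N (ls(i := l')) (gh_res g'))"
    and R: "\<And>u. u \<in> {1..N} \<Longrightarrow> u \<noteq> i \<Longrightarrow> rely u (l_mOp (ls u)) s g s' g' \<or> thread_inv N u (ls u) s' g'"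
  shows "decs_inv N h (ls(i := l')) s' g' S'"
proof -
  have "thread_inv N u (ls u) s' g'" if "u \<in> {1..N}" "u \<noteq> i" for u
    using R[OF that] I that rely_thread_inv[of u "l_mOp (ls u)" s g s' g' N] by (auto
      simp: decs_inv_def)
  then show ?thesis using T G L by (auto simp: decs_inv_def)
qed

definition keep :: "'v locals \<Rightarrow> 'v locals \<Rightarrow> bool" where
  "keep l l' \<longleftrightarrow> l_call l' = l_call l \<and> l_mOp l' = l_mOp l \<and> l_pc l' \<noteq> Idle \<and> l_pc l' \<noteq> Start"

definition locstep ::
  "nat \<Rightarrow> nat \<Rightarrow> 'v locals \<Rightarrow> 'v shared \<Rightarrow> 'v ghost \<Rightarrow> 'v locals \<Rightarrow> 'v shared \<Rightarrow> bool" where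
  "locstep N i l s g l' s' \<longleftrightarrow> (\<exists>g'. guar i s g s' g' \<and> thread_inv N i l' s' g' \<and> keep l l')"

lemma phase_of_keep:
  assumes "keep (ls i) l'" "l_pc (ls i) \<noteq> Idle" "l_pc (ls i) \<noteq> Start"
  shows "phase_of N (ls(i := l')) f = phase_of N ls f"
  using assms by (auto simp: phase_of_def keep_def fun_eq_iff split: option.split)

lemma inv_locstep:
  assumes I: "decs_inv N h ls s g S" and i: "i \<in> {1..N}" and L: "locstep N i (ls i) s g l' s'"
    and pc: "l_pc (ls i) \<noteq> Idle" "l_pc (ls i) \<noteq> Start"
  shows "\<exists>g' S'. decs_inv N h (ls(i := l')) s' g' S'"
proof -
  obtain g' where g': "guar i s g s' g'" "thread_inv N i l' s' g'" "keep (ls i) l'"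
    using L by (auto simp: locstep_def)
  have G: "global_inv N s g" "stacked s g S" and L: "\<exists>L. linearizing h L S (phase_of N ls (gh_res g))"
    using I by (auto simp: decs_inv_def)
  have "gh_res g' = gh_res g" using g' by (simp add: guar_def)
  then have "\<exists>L. linearizing h L S (phase_of N (ls(i := l')) (gh_res g'))"
    using L phase_of_keep[where i = i and ls = ls, OF g'(3) pc] by simp
  then have "decs_inv N h (ls(i := l')) s' g' S"
    using inv_step[OF I i g'(2) guar_global_inv[OF g'(1) G(1)] guar_stacked[OF g'(1) G]]
      guar_rely[OF g'(1) G(1)] i
    by auto
  then show ?thesis by blast
qed

lemma thread_inv_enter:
  assumes "head t l s g" "base t l s g" "g_location s t = null"
  shows "thread_inv N t (enter_loop l) s g"
  using assms by (auto simp: enter_loop_def base_def callop_def split: call.splits)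

lemma thread_inv_finish:
  assumes "base t l s g" "g_location s t = null" "gh_mode g (l_mOp l) = MFin" "finok s g (l_mOp l)"
  shows "thread_inv N t (finish l) s g"
  using assms by (auto simp: finish_def finok_def base_def callop_def split: call.splits)

lemma enter_finish_simps [simp]:
  "l_call (finish l) = l_call l" "l_mOp (finish l) = l_mOp l" "l_pc (finish l) \<noteq> Idle"
  "l_pc (finish l) \<noteq> Start" "l_call (enter_loop l) = l_call l" "l_mOp (enter_loop l) = l_mOp l"
  "l_pc (enter_loop l) \<noteq> Idle" "l_pc (enter_loop l) \<noteq> Start"
  by (auto simp: finish_def enter_loop_def split: call.splits)

lemma keep_enter: "keep l (enter_loop l)"
  by (auto simp: keep_def enter_loop_def split: call.splits)

lemma keep_finish: "keep l (finish l)"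
  by (auto simp: keep_def finish_def split: call.splits)

lemma guar_refl: "guar i s g s g"
  by (simp add: guar_def)

lemma locstep_read:
  "thread_inv N i l' s g \<Longrightarrow> keep l l' \<Longrightarrow> locstep N i l s g l' s"
  using guar_refl locstep_def by blast

lemma locstep_enter:
  "head i l s g \<Longrightarrow> base i l s g \<Longrightarrow> g_location s i = null \<Longrightarrow> locstep N i l s g (enter_loop l) s"
  by (rule locstep_read[OF thread_inv_enter keep_enter])

section \<open>Walking along chains of cells and lists of records\<close>

lemma adv_null [simp]: "adv nx n null = null"
  by (induction n) auto

lemma adv_add: "adv nx (m + n) c = adv nx n (adv nx m c)"
  by (induction m arbitrary: c) auto

lemma adv_Suc: "adv nx (Suc n) c = (if adv nx n c = null then null else nx (adv nx n c))"
  using adv_add[of nx n 1 c] by simp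

lemma lseg_upd [simp]: "r \<notin> set xs \<Longrightarrow> lseg (nx(r := v)) a xs b = lseg nx a xs b"
  by (induction xs arbitrary: a) auto

lemma lseg_hd: "lseg nx a xs b \<Longrightarrow> xs \<noteq> [] \<Longrightarrow> hd xs = a"
  by (cases xs) auto

lemma lseg_null: "lseg nx a xs null \<Longrightarrow> null \<notin> set xs \<Longrightarrow> a = null \<longleftrightarrow> xs = []"
  by (cases xs) auto

lemma lseg_tl: "lseg nx a xs b \<Longrightarrow> xs \<noteq> [] \<Longrightarrow> lseg nx (nx a) (tl xs) b"
  by (cases xs) auto

lemma mfin_next:
  assumes "mfin t l s g"
  shows "o_next s (l_mOp l) = null \<longleftrightarrow> tl (gh_q g t) = []"
    "tl (gh_q g t) \<noteq> [] \<Longrightarrow> o_next s (l_mOp l) = hd (tl (gh_q g t))"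
    "lseg (o_next s) (o_next s (l_mOp l)) (tl (gh_q g t)) null"
    "null \<notin> set (gh_q g t)" "l_par l = l_mOp l"
    "tl (gh_q g t) \<noteq> [] \<Longrightarrow> lseg (o_next s) (o_next s (hd (tl (gh_q g t)))) (tl (tl (gh_q g t))) null"
proof -
  show a: "lseg (o_next s) (o_next s (l_mOp l)) (tl (gh_q g t)) null" and n: "null \<notin> set (gh_q g t)"
    using assms lseg_tl[of "o_next s" "l_mOp l" "gh_q g t" null] by (auto simp: mfin_def owned_def)
  have "null \<notin> set (tl (gh_q g t))" using n by (cases "gh_q g t") auto
  then show "o_next s (l_mOp l) = null \<longleftrightarrow> tl (gh_q g t) = []" using lseg_null[OF a] by simp
  show "tl (gh_q g t) \<noteq> [] \<Longrightarrow> o_next s (l_mOp l) = hd (tl (gh_q g t))" using lseg_hd[OF a] by simp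
  then show "tl (gh_q g t) \<noteq> [] \<Longrightarrow>
      lseg (o_next s) (o_next s (hd (tl (gh_q g t)))) (tl (tl (gh_q g t))) null"
    using lseg_tl[OF a] by simp
  show "l_par l = l_mOp l" using assms by (simp add: mfin_def)
qed

lemma finok_simps:
  "o_op s r = POP \<Longrightarrow> finok s g r = celldone s g r"
  "o_op s r = PUSH \<Longrightarrow> finok s g r = (gh_res g r = Some Ack)"
  by (auto simp: finok_def)

section \<open>Steps of cMultiPop without linearization\<close>

lemma locstep_mpop_read:
  assumes T: "pc_inv (MPop p) N i l s g" and G: "global_inv N s g"
    and e: "(l', s') \<in> exec_mpop p N i l s"
    and p: "p \<in> {P5, P6, P7, P10, P11, P12, P14, P16, P17, P19, P20}"
  shows "locstep N i l s g l' s'"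
proof -
  have b: "base i l s g" "g_location s i = null" "o_op s (l_mOp l) = POP" and T': "mpop_inv p i l s g"
    using T by auto
  have pub: "c_next s c = null \<or> c_next s c \<in> gh_pub g" "c \<noteq> null" if "c \<in> gh_pub g" for c
    using G that by (auto simp: global_inv_def)
  show ?thesis
  proof (cases p)
    case P5
    have "length (gh_q g i) > 0" if "head i l s g" using that by (auto
      simp: head_def hlist_def plist_def)
    \<comment> \<open>When \<open>top\<close> is the bottom cell the loop is skipped, but the list
      has at least one record, so \<open>adv\<close> has reached \<open>null\<close> as
      well.\<close>
    moreover have "adv (c_next s) (length (gh_q g i)) (l_top l) = null"
      if "head i l s g" "c_next s (l_top l) = null"
      using that by (cases "gh_q g i") (auto simp: head_def hlist_def plist_def)
    ultimately show ?thesis using T' b e P5 pub[of "l_top l"]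
      by (auto intro!: locstep_read simp: Let_def keep_def Suc_le_eq int_one_le_iff_zero_less)
  next
    case P6
    have "o_length s (l_par l) = int (length (gh_q g i))" if "head i l s g" "l_par l = l_mOp l"
      using that by (auto simp: head_def hlist_def leads_def)
    then show ?thesis using T' b e P6
      by (auto intro!: locstep_read simp: Let_def keep_def)
  next
    case P7
    have a: "adv (c_next s) (nat (l_m l + 1)) (l_top l) = c_next s (l_nTop l)"
      using T' P7 pub(2)[of "l_nTop l"] by (auto simp: nat_add_distrib adv_Suc simp del: adv.simps)
    \<comment> \<open>The walk has reached \<open>null\<close> early; the steps for the remaining
      records of the list do not leave it.\<close>
    moreover have "adv (c_next s) (length (gh_q g i)) (l_top l) = null" if "c_next s (l_nTop l) = null"
    proof -
      have "length (gh_q g i) = nat (l_m l + 1) + (length (gh_q g i) - nat (l_m l + 1))"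
        using T' P7 by auto
      then show ?thesis using a that by (metis adv_add adv_null)
    qed
    ultimately show ?thesis using T' b e P7 pub[of "l_nTop l"]
      by (auto intro!: locstep_read simp: Let_def keep_def)
  next
    case P11
    then show ?thesis
      using T' b e mfin_next[of i l s g]
      by (auto intro!: locstep_read thread_inv_finish simp: mfin_def finok_simps keep_def)
  qed (use T' b e p mfin_next[of i l s g] pub[of "l_top l"] in
      \<open>auto intro!: locstep_read simp: keep_def\<close>)
qed

text \<open>The cell of an eliminated passive pop is written both by the eliminating thread at E5
  and by its own thread at W9. Both writes are admissible because they agree with the response in
  \<open>gh_res\<close>.\<close>

lemma guar_cell_write:
  "o_op s r = POP \<Longrightarrow> v \<in> c_alloc s \<Longrightarrow> gh_res g r = Some (Ret (c_data s v)) \<Longrightarrow>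
    guar i s g (s\<lparr>o_cell := (o_cell s)(r := v)\<rparr>) g"
  by (simp add: guar_def celldone_def)

text \<open>The ghost mode switches in the same step as the status, so that a waiting thread never
  meets one change without the other, as \<open>wakes\<close> demands.\<close>

lemma guar_finished:
  "gh_own g r = i \<Longrightarrow> finok s g r \<Longrightarrow>
    guar i s g (s\<lparr>o_status := (o_status s)(r := FINISHED)\<rparr>) (g\<lparr>gh_mode := (gh_mode g)(r := MFin)\<rparr>)"
  by (auto simp: guar_def)

lemma guar_next_write:
  "gh_own g r = i \<Longrightarrow>
    guar i s g (s\<lparr>o_next := (o_next s)(r := v)\<rparr>) (g\<lparr>gh_q := (gh_q g)(i := xs)\<rparr>)"
  by (simp add: guar_def)

lemma guar_last_write:
  "gh_own g r = i \<Longrightarrow> guar i s g (s\<lparr>o_last := (o_last s)(r := v)\<rparr>) g"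
  by (simp add: guar_def)

lemma guar_length_write:
  "gh_own g r = i \<Longrightarrow> guar i s g (s\<lparr>o_length := (o_length s)(r := v)\<rparr>) g"
  by (simp add: guar_def)

lemma guar_q: "guar i s g s (g\<lparr>gh_q := (gh_q g)(i := xs)\<rparr>)"
  and guar_z: "guar i s g s (g\<lparr>gh_z := (gh_z g)(i := xs)\<rparr>)"
  by (simp_all add: guar_def)

lemma guar_location: "guar i s g (s\<lparr>g_location := (g_location s)(i := v)\<rparr>) g"
  by (simp add: guar_def)

lemma guar_collision: "guar i s g (s\<lparr>g_collision := (g_collision s)(j := i)\<rparr>) g"
  by (simp add: guar_def)

lemma guar_c_next:
  "r \<in> o_alloc s \<Longrightarrow> r \<noteq> null \<Longrightarrow> gh_own g r = i \<Longrightarrow> o_op s r = PUSH \<Longrightarrow> gh_res g r = None \<Longrightarrow>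
    guar i s g (s\<lparr>c_next := (c_next s)(o_cell s r := v)\<rparr>) g"
  by (auto simp: guar_def)

lemma guar_head_status:
  "gh_own g r = i \<Longrightarrow> gh_mode g r = MHead \<Longrightarrow>
    guar i s g (s\<lparr>o_status := (o_status s)(r := v)\<rparr>) g"
  by (simp add: guar_def)

lemma locstep_write:
  "guar i s g s' g' \<Longrightarrow> thread_inv N i l' s' g' \<Longrightarrow> keep l l' \<Longrightarrow> locstep N i l s g l' s'"
  by (auto simp: locstep_def)

lemma sole_MFin: "sole t m s g \<Longrightarrow> sole t m s (g\<lparr>gh_mode := (gh_mode g)(r := MFin)\<rparr>)"
  by (simp add: sole_def)

lemma base_MFin: "base_at t c m s g \<Longrightarrow> base_at t c m s (g\<lparr>gh_mode := (gh_mode g)(r := MFin)\<rparr>)"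
  by (simp add: base_def sole_MFin)

lemma base_cell_write:
  "base_at t c m s g \<Longrightarrow> o_op s r = POP \<Longrightarrow> base_at t c m (s\<lparr>o_cell := (o_cell s)(r := v)\<rparr>) g"
  by (auto simp: base_def callop_def split: call.splits)

lemma celldone_write:
  "celldone (s\<lparr>o_cell := (o_cell s)(r := v)\<rparr>) g r' \<longleftrightarrow>
     (if r' = r then v \<in> c_alloc s \<and> gh_res g r = Some (Ret (c_data s v)) else celldone s g r')"
  by (simp add: celldone_def)

lemma mfin_frame [simp]:
  "mfin_at t p m (s\<lparr>o_cell := v\<rparr>) g = mfin_at t p m s g"
  "mfin_at t p m (s\<lparr>o_status := v'\<rparr>) g = mfin_at t p m s g"
  by (simp_all add: mfin_def)

lemma pnone_frame [simp]:
  "pnone_at t p m (s\<lparr>o_cell := v\<rparr>) g = pnone_at t p m s g"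
  "pnone_at t p m (s\<lparr>o_status := v'\<rparr>) g = pnone_at t p m s g"
  by (simp_all add: pnone_def)

lemma mfin_MFin: "mfin_at t p m s g \<Longrightarrow> mfin_at t p m s (g\<lparr>gh_mode := (gh_mode g)(r := MFin)\<rparr>)"
  by (simp add: mfin_def)

lemma pnone_MFin: "pnone_at t p m s g \<Longrightarrow> pnone_at t p m s (g\<lparr>gh_mode := (gh_mode g)(r := MFin)\<rparr>)"
  by (simp add: pnone_def)

lemma pnone_par:
  assumes "pnone t l s g"
  shows "o_op s (l_par l) = POP" "gh_own g (l_par l) = t" "gh_res g (l_par l) = Some (Ret None)"
    "l_par l \<in> o_alloc s"
proof -
  obtain x xs where "gh_q g t = x # xs" using assms by (cases "gh_q g t") (auto simp: pnone_def)
  then show "o_op s (l_par l) = POP" "gh_own g (l_par l) = t" "gh_res g (l_par l) = Some (Ret None)"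
    "l_par l \<in> o_alloc s"
    using assms by (auto simp: pnone_def owned_def optype_def)
qed

lemma mfin_Cons:
  assumes "mfin t l s g" "tl (gh_q g t) \<noteq> []"
  obtains y xs where "gh_q g t = l_mOp l # y # xs" "distinct (l_mOp l # y # xs)"
    "gh_own g (l_mOp l) = t" "gh_own g y = t" "o_op s y = o_op s (l_mOp l)" "y \<in> o_alloc s"
proof -
  obtain x y xs where q: "gh_q g t = x # y # xs"
    using assms(2) by (metis list.sel(2) neq_Nil_conv list.sel(3))
  have *: "hd (gh_q g t) = l_mOp l" "owned t s g (gh_q g t)" "optype s (o_op s (l_mOp l)) (gh_q g t)"
    using assms(1) by (simp_all add: mfin_def)
  then have "x = l_mOp l" using q by simp
  with * show ?thesis
    using that[of y xs] q by (simp add: owned_def optype_def)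
qed

lemma mfin_tl:
  assumes "mfin t l s g" "tl (gh_q g t) \<noteq> []"
  shows "gh_own g (hd (tl (gh_q g t))) = t" "o_op s (hd (tl (gh_q g t))) = o_op s (l_mOp l)"
    "hd (tl (gh_q g t)) \<noteq> l_mOp l" "l_mOp l \<notin> set (tl (tl (gh_q g t)))" "gh_own g (l_mOp l) = t"
    "hd (tl (gh_q g t)) \<in> o_alloc s"
  by (rule mfin_Cons[OF assms], force)+

lemma mfin_unlink:
  assumes "mfin t l s g" "tl (gh_q g t) \<noteq> []" "lseg (o_next s) v (tl (tl (gh_q g t))) null"
  shows "mfin t l (s\<lparr>o_next := (o_next s)(l_mOp l := v)\<rparr>)
    (g\<lparr>gh_q := (gh_q g)(t := l_mOp l # tl (tl (gh_q g t)))\<rparr>)"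
proof -
  obtain y xs where q: "gh_q g t = l_mOp l # y # xs" "distinct (l_mOp l # y # xs)"
    by (rule mfin_Cons[OF assms(1,2)])
  have "lseg ((o_next s)(l_mOp l := v)) v xs null"
    using assms(3) q by simp
  moreover have "owned t s g (gh_q g t)" "optype s (o_op s (l_mOp l)) (gh_q g t)"
      "gh_mode g (l_mOp l) = MFin" "l_par l = l_mOp l"
    using assms(1) by (simp_all add: mfin_def)
  ultimately show ?thesis using q by (simp add: mfin_def owned_def optype_def)
qed

lemma psupply_step:
  "psupply s g xs c \<Longrightarrow> xs \<noteq> [] \<Longrightarrow> c \<noteq> null \<Longrightarrow> global_inv N s g \<Longrightarrow>
    c \<in> gh_pub g \<and> c \<in> c_alloc s \<and> gh_res g (hd xs) = Some (Ret (c_data s c)) \<and>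
      psupply s g (tl xs) (c_next s c)"
  by (cases xs) (auto simp: psupply_def global_inv_def)

lemma psupply_null:
  "psupply s g xs null \<Longrightarrow> xs \<noteq> [] \<Longrightarrow> gh_res g (hd xs) = Some (Ret None) \<and> psupply s g (tl xs) null"
  by (cases xs) (auto simp: psupply_def)

lemma locstep_mpop_write:
  assumes T: "pc_inv (MPop p) N i l s g" and G: "global_inv N s g"
    and e: "(l', s') \<in> exec_mpop p N i l s"
    and p: "p \<in> {P2, P3, P4, P9, P13, P15, P18, P21}"
  shows "locstep N i l s g l' s'"
proof -
  have b: "base i l s g" "g_location s i = null" "o_op s (l_mOp l) = POP" and T': "mpop_inv p i l s g"
    using T by auto
  have E: "EMPTY_CELL \<in> c_alloc s" "c_data s EMPTY_CELL = None" using G by (auto simp: global_inv_def)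
  show ?thesis
  proof (cases p)
    case P2
    then show ?thesis using e T' b pnone_par[of i l s g] E
      by (auto intro!: locstep_write[OF guar_cell_write] simp: keep_def base_cell_write celldone_write)
  next
    case P3
    then show ?thesis using e T' b pnone_par[of i l s g]
      by (auto intro!: locstep_write[OF guar_finished] simp: keep_def base_MFin pnone_MFin finok_simps)
  next
    case P4
    have T4: "pnone i l s g" "celldone s g (l_mOp l)" using T' P4 by auto
    then obtain xs where q: "gh_q g i = l_par l # xs" by (cases "gh_q g i") (auto simp: pnone_def)
    have n: "o_next s (l_par l) = null \<longleftrightarrow> xs = []"
      using T4 q lseg_null[of "o_next s" "o_next s (l_par l)" xs] by (auto simp: pnone_def owned_def)
    have fin: "finok s g (l_mOp l)" "gh_mode g (l_mOp l) = MFin" using b T4 by (auto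
      simp: finok_simps pnone_def)
    \<comment> \<open>The ghost list drops its first record together with the assignment to
      \<open>l_par\<close>.\<close>
    have pn: "pnone i (l\<lparr>l_par := o_next s (l_par l), l_pc := x\<rparr>) s (g\<lparr>gh_q := (gh_q g)(i := xs)\<rparr>)"
      if "xs \<noteq> []" for x
      using T4 q that by (auto simp: pnone_def owned_def optype_def)
    show ?thesis using e T4 b P4 fin pn n
      by (auto intro!: locstep_write[OF guar_q[where xs = xs]] thread_inv_finish simp: keep_def Let_def)
  next
    case P9
    have "psupply s g (gh_q g i) (l_top l)" "l_top l \<in> gh_pub g" "mfin i l s g" using T' P9 by auto
    moreover have "l_top l \<noteq> null" "gh_q g i \<noteq> []" "hd (gh_q g i) = l_mOp l"
      using calculation G by (auto simp: global_inv_def mfin_def)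
    ultimately show ?thesis using e b P9 psupply_step[OF _ _ _ G, of "gh_q g i"
      "l_top l"] mfin_next(5)[of i l s g]
      by (auto intro!: locstep_write[OF guar_cell_write] simp: keep_def base_cell_write celldone_write)
  next
    case P13
    then show ?thesis using e T' b E mfin_tl[of i l s g] psupply_null[of s g "tl (gh_q g i)"]
      by (auto intro!: locstep_write[OF guar_cell_write] simp: keep_def base_cell_write celldone_write)
  next
    case P15
    then show ?thesis using e T' b mfin_tl[of i l s g] psupply_step[OF _ _ _ G, of "tl (gh_q g i)"
      "l_top l"]
      by (auto intro!: locstep_write[OF guar_cell_write] simp: keep_def base_cell_write celldone_write)
  next
    case P18
    then show ?thesis using e T' b mfin_tl[of i l s g]
      by (auto intro!: locstep_write[OF guar_finished] simp: keep_def base_MFin mfin_MFin finok_simps)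
  next
    case P21
    have "mfin i l s g" "tl (gh_q g i) \<noteq> []" "lseg (o_next s) (l_op l) (tl (tl (gh_q g i))) null"
      using T' P21 by auto
    then show ?thesis using e T' b P21 mfin_tl[of i l s g] mfin_unlink[of i l s g "l_op l"]
      mfin_next(5)[of i l s g]
      by (auto intro!: locstep_write[OF guar_next_write[where xs = "l_mOp l # tl (tl (gh_q g i))"]]
        simp: keep_def)
  qed (use p in auto)
qed

lemma central_pub: "stacked s g S \<Longrightarrow> g_central s = null \<or> g_central s \<in> gh_pub g"
proof -
  assume "stacked s g S"
  then obtain cs where "lseg (c_next s) (g_central s) cs null" "set cs \<subseteq> gh_pub g"
    by (auto simp: stacked_def)
  then show ?thesis by (cases cs) auto
qed

lemma locstep_mpop_fail:
  assumes T: "pc_inv (MPop p) N i l s g" and S: "stacked s g S" and e: "(l', s') \<in> exec_mpop p N i l s"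
    and p: "p = P1 \<and> g_central s \<noteq> null \<or> p = P8 \<and> g_central s \<noteq> l_top l"
  shows "locstep N i l s g l' s'"
  using T e p central_pub[OF S] by (auto intro!: locstep_read simp: keep_def Let_def)

section \<open>Steps of cMultiPush without linearization\<close>

lemma cells_inj:
  "global_inv N s g \<Longrightarrow> inj_on (o_cell s) {r\<in>o_alloc s. r \<noteq> null \<and> o_op s r = PUSH}"
  by (rule inj_onI) (simp add: global_inv_def)

lemma owned_push:
  assumes "owned t s g xs" "optype s PUSH xs"
  shows "set xs \<subseteq> {r\<in>o_alloc s. r \<noteq> null \<and> o_op s r = PUSH}"
  using assms by (auto simp: owned_def optype_def)

text \<open>Since the cells of distinct records differ, the write hits the open end of the list and
  none of its inner links.\<close>

lemma linked_last_upd: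
  assumes "linked s xs" "inj_on (o_cell s) (set xs)" "distinct xs" "xs \<noteq> []"
  shows "linked (s\<lparr>c_next := (c_next s)(o_cell s (last xs) := v)\<rparr>) xs"
  using assms
proof (induction xs rule: induct_list012)
  case (3 x y zs)
  have "linked (s\<lparr>c_next := (c_next s)(o_cell s (last (y # zs)) := v)\<rparr>) (y # zs)"
    using 3 by (intro "3.IH"(2)) (auto intro: inj_on_subset)
  moreover have "last (y # zs) \<in> set (y # zs)" by (rule last_in_set) simp
  then have "o_cell s x \<noteq> o_cell s (last (y # zs))"
    using "3.prems"(2,3) by (metis distinct.simps(2) inj_on_eq_iff list.set_intros(1,2))
  moreover define s' where "s' = s\<lparr>c_next := (c_next s)(o_cell s (last (y # zs)) := v)\<rparr>"
  ultimately have "c_next s' (o_cell s' x) = o_cell s' y" "linked s' (y # zs)"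
    using "3.prems"(1) by simp_all
  then have "linked s' (x # y # zs)" by simp
  then show ?case unfolding s'_def by (simp only: last_ConsR[OF list.distinct(2)])
qed auto

lemma head_unfold:
  assumes "head t l s g"
  shows "gh_q g t \<noteq> []" "hd (gh_q g t) = l_mOp l" "owned t s g (gh_q g t)"
    "optype s (o_op s (l_mOp l)) (gh_q g t)" "unres g (gh_q g t)"
    "o_last s (l_mOp l) = last (gh_q g t)" "o_length s (l_mOp l) = int (length (gh_q g t))"
    "o_op s (l_mOp l) = PUSH \<Longrightarrow> linked s (gh_q g t)" "waits g (tl (gh_q g t))"
    "lseg (o_next s) (l_mOp l) (gh_q g t) null"
    "gh_mode g (l_mOp l) = MHead" "o_status s (l_mOp l) = INIT"
proof -
  have *: "hd (gh_q g t) = l_mOp l" using assms by (simp add: head_def leads_def)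
  show "gh_q g t \<noteq> []" "hd (gh_q g t) = l_mOp l" "owned t s g (gh_q g t)"
    "optype s (o_op s (l_mOp l)) (gh_q g t)" "unres g (gh_q g t)"
    "o_last s (l_mOp l) = last (gh_q g t)" "o_length s (l_mOp l) = int (length (gh_q g t))"
    "o_op s (l_mOp l) = PUSH \<Longrightarrow> linked s (gh_q g t)" "waits g (tl (gh_q g t))"
    "lseg (o_next s) (l_mOp l) (gh_q g t) null"
    "gh_mode g (l_mOp l) = MHead" "o_status s (l_mOp l) = INIT"
    using assms * by (simp_all add: head_def leads_def hlist_def plist_def)
qed

lemma head_last:
  assumes "head t l s g" "o_op s (l_mOp l) = PUSH"
  shows "last (gh_q g t) \<in> o_alloc s" "last (gh_q g t) \<noteq> null" "gh_own g (last (gh_q g t)) = t"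
    "o_op s (last (gh_q g t)) = PUSH" "gh_res g (last (gh_q g t)) = None"
proof -
  note h = head_unfold[OF assms(1)]
  show "last (gh_q g t) \<in> o_alloc s" "last (gh_q g t) \<noteq> null" "gh_own g (last (gh_q g t)) = t"
    using owned_last[OF h(3,1)] by simp_all
  show "o_op s (last (gh_q g t)) = PUSH" "gh_res g (last (gh_q g t)) = None"
    using h(1,4,5) assms(2) by (auto simp: optype_def unres_def)
qed

lemma head_c_next:
  assumes "head t l s g" "global_inv N s g" "o_op s (l_mOp l) = PUSH"
  shows "head t l (s\<lparr>c_next := (c_next s)(o_cell s (last (gh_q g t)) := v)\<rparr>) g"
proof -
  note h = head_unfold[OF assms(1)]
  have "inj_on (o_cell s) (set (gh_q g t))"
    using cells_inj[OF assms(2)] owned_push[OF h(3)] h(4) assms(3) by (auto intro: inj_on_subset)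
  then have "linked (s\<lparr>c_next := (c_next s)(o_cell s (last (gh_q g t)) := v)\<rparr>) (gh_q g t)"
    using linked_last_upd h(1,3,8) assms(3) by (auto simp: owned_def)
  then show ?thesis using h by (simp add: head_def leads_def hlist_def plist_def)
qed

lemma ufin_MFin: "ufin_at t p m s g \<Longrightarrow> ufin_at t p m s (g\<lparr>gh_mode := (gh_mode g)(r := MFin)\<rparr>)"
  by (simp add: ufin_def mfin_MFin)

lemma ufin_frame [simp]: "ufin_at t p m (s\<lparr>o_status := v'\<rparr>) g = ufin_at t p m s g"
  by (simp add: ufin_def)

lemma ufin_unlink:
  assumes "ufin t l s g" "tl (gh_q g t) \<noteq> []" "lseg (o_next s) v (tl (tl (gh_q g t))) null"
  shows "ufin t l (s\<lparr>o_next := (o_next s)(l_mOp l := v)\<rparr>)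
    (g\<lparr>gh_q := (gh_q g)(t := l_mOp l # tl (tl (gh_q g t)))\<rparr>)"
proof -
  have m: "mfin t l s g" using assms(1) by (simp add: ufin_def)
  obtain y xs where q: "gh_q g t = l_mOp l # y # xs" by (rule mfin_Cons[OF m assms(2)])
  show ?thesis using mfin_unlink[OF m assms(2,3)] assms(1) q by (simp add: ufin_def)
qed

lemma locstep_mpush:
  assumes T: "pc_inv (MPush p) N i l s g" and G: "global_inv N s g" and S: "stacked s g S"
    and e: "(l', s') \<in> exec_mpush p N i l s" and p: "\<not> (p = U6 \<and> g_central s = l_top l)"
  shows "locstep N i l s g l' s'"
proof -
  have b: "base i l s g" "g_location s i = null" "o_op s (l_mOp l) = PUSH" and T': "mpush_inv p i l s g"
    using T by auto
  have u: "mfin i l s g" "l_par l = l_mOp l" "gh_mode g (l_mOp l) = MFin"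
    "gh_res g (l_mOp l) = Some Ack"
    "tl (gh_q g i) \<noteq> [] \<Longrightarrow> gh_res g (hd (tl (gh_q g i))) = Some Ack"
    if u: "ufin i l s g"
  proof -
    show m: "mfin i l s g" using u by (simp add: ufin_def)
    then show "l_par l = l_mOp l" "gh_mode g (l_mOp l) = MFin" by (simp_all add: mfin_def)
    have "l_mOp l \<in> set (gh_q g i)" using m hd_in_set[of "gh_q g i"] by (simp add: mfin_def)
    then show "gh_res g (l_mOp l) = Some Ack" using u by (simp add: ufin_def)
    assume "tl (gh_q g i) \<noteq> []"
    then have "hd (tl (gh_q g i)) \<in> set (gh_q g i)" by (cases "gh_q g i") auto
    then show "gh_res g (hd (tl (gh_q g i))) = Some Ack" using u by (simp add: ufin_def)
  qed
  show ?thesis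
  proof (cases p)
    case U1
    then show ?thesis using e T' b central_pub[OF S] by (auto intro!: locstep_read simp: keep_def)
  next
    case U2
    then show ?thesis using e T' b head_unfold(6)[of i l s g] by (auto intro!: locstep_read
      simp: keep_def)
  next
    case U3
    then show ?thesis using e T' b by (auto intro!: locstep_read simp: keep_def)
  next
    case U4
    then show ?thesis using e T' b head_c_next[OF _ G, of i l] head_last[of i l s g]
      by (auto intro!: locstep_write[OF guar_c_next] simp: keep_def)
  next
    case U5
    then show ?thesis using e T' b by (auto intro!: locstep_read simp: keep_def)
  next
    case U6
    then show ?thesis using e T' b p by (auto intro!: locstep_read simp: keep_def)
  next
    case U7
    then show ?thesis using e T' b u mfin_next(1)[of i l s g]
      by (auto intro!: locstep_read thread_inv_finish simp: keep_def finok_simps)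
  next
    case U8
    then show ?thesis using e T' b u mfin_next(2)[of i l s g]
      by (auto intro!: locstep_read simp: keep_def)
  next
    case U9
    then show ?thesis using e T' b u mfin_tl[of i l s g]
      by (auto intro!: locstep_write[OF guar_finished] simp: keep_def base_MFin ufin_MFin finok_simps)
  next
    case U10
    then show ?thesis using e T' b u mfin_next(2)[of i l s g]
      by (auto intro!: locstep_read simp: keep_def)
  next
    case U11
    then show ?thesis using e T' b u mfin_next(6)[of i l s g]
      by (auto intro!: locstep_read simp: keep_def)
  next
    case U12
    have "ufin i l s g" "tl (gh_q g i) \<noteq> []" "lseg (o_next s) (l_op l) (tl (tl (gh_q g i))) null"
      using T' U12 by auto
    then show ?thesis using e b U12 u mfin_tl(5)[of i l s g] ufin_unlink[of i l s g "l_op l"]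
      by (auto intro!: locstep_write[OF guar_next_write[where xs = "l_mOp l # tl (tl (gh_q g i))"]]
        simp: keep_def)
  qed
qed

section \<open>Steps of collide, activeCollide and passiveCollide\<close>

lemma head_frame [simp]:
  "head_at t m (s\<lparr>g_location := v1\<rparr>) g = head_at t m s g"
  "head_at t m (s\<lparr>g_collision := v2\<rparr>) g = head_at t m s g"
  by (simp_all add: head_def)

lemma waiting_frame [simp]:
  "waiting_at t m (s\<lparr>g_location := v1\<rparr>) g = waiting_at t m s g"
  "waiting_at t m (s\<lparr>g_collision := v2\<rparr>) g = waiting_at t m s g"
  by (simp_all add: waiting_def)

lemma elimd_frame [simp]:
  "elimd_at m (s\<lparr>g_location := v1\<rparr>) g a = elimd_at m s g a"
  "elimd_at m (s\<lparr>g_collision := v2\<rparr>) g a = elimd_at m s g a"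
  by (simp_all add: elimd_def)

lemma capt_frame [simp]:
  "capt_at t m (s\<lparr>g_location := v1\<rparr>) g a = capt_at t m s g a"
  "capt_at t m (s\<lparr>g_collision := v2\<rparr>) g a = capt_at t m s g a"
  by (simp_all add: capt_def)

lemma colp_frame [simp]:
  "colp_at t m (s\<lparr>g_collision := v2\<rparr>) g = colp_at t m s g"
  by (simp add: colp_def)

lemma base_id: "base t l s g \<Longrightarrow> o_id s (l_mOp l) = t"
  by (simp add: base_def)

text \<open>The disjunction in \<open>colp\<close> is decided by comparing \<open>location\<close>
  with \<open>l_mOp\<close>, because a capturing record has a foreign identifier. This is the test
  that the CAS at C8 and C9 performs.\<close>

lemma colp_cases:
  assumes "colp t l s g" "base t l s g"
  shows "if g_location s t = l_mOp l then head t l s g else capt t l s g (g_location s t)"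
  using assms by (auto simp: colp_def capt_def base_def)

lemma locstep_col:
  assumes T: "pc_inv (Col p) N i l s g" and e: "(l', s') \<in> exec_col p N i l s" and G: "global_inv N s g"
    and L: "\<And>t. t \<in> {1..N} \<Longrightarrow> g_location s t = null \<or> g_location s t \<in> o_alloc s"
  shows "locstep N i l s g l' s'"
proof -
  have b: "base i l s g" and T': "col_inv p N i l s g" using T by auto
  have col: "g_collision s j \<le> N" if "j \<in> {1..N}" for j using G that by (simp add: global_inv_def)
  show ?thesis
  proof (cases p)
    case C1
    then show ?thesis using e T' b
      by (auto intro!: locstep_write[OF guar_location] simp: keep_def colp_def)
  next
    case C2
    then show ?thesis using e T' b col by (auto intro!: locstep_read simp: keep_def)
  next
    case C3
    then show ?thesis using e T' b
      by (auto intro!: locstep_write[OF guar_collision] locstep_read simp: keep_def EMPTY_def split: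
        if_splits)
  next
    case C4
    then show ?thesis using e T' b col by (auto intro!: locstep_read simp: keep_def)
  next
    case C5
    then show ?thesis using e T' b L[of "l_him l"] by (auto intro!: locstep_read simp: keep_def Let_def)
  next
    case C8
    then show ?thesis using e T' b colp_cases[of i l s g]
      by (auto intro!: locstep_write[OF guar_location] locstep_read simp: keep_def split: if_splits)
  next
    case C9
    then show ?thesis using e T' b colp_cases[of i l s g]
      by (auto intro!: locstep_write[OF guar_location] locstep_read thread_inv_enter simp: keep_def
        split: if_splits)
  qed (use e T' b in \<open>auto intro!: locstep_read simp: keep_def split: if_splits\<close>)
qed

lemma locstep_act:
  assumes T: "pc_inv (Act p) N i l s g" and e: "(l', s') \<in> exec_act p N i l s"
    and p: "\<not> (p = A2 \<and> g_location s (l_id l) = l_pInf l)"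
  shows "locstep N i l s g l' s'"
proof -
  have b: "base i l s g" "g_location s i = null" and T': "act_inv p N i l s g" using T by auto
  show ?thesis
  proof (cases p)
    case A1
    then show ?thesis using e T' b by (auto intro!: locstep_read simp: keep_def)
  next
    case A2
    then show ?thesis using e T' b p by (auto intro!: locstep_enter)
  next
    case A3
    have "l_aInf l = l_mOp l" using T' A3 by (auto simp: act3_def comb0_def split: if_splits)
    then show ?thesis using e T' b A3 by (auto intro!: locstep_read simp: keep_def)
  next
    case A4
    then show ?thesis using e T' b by (auto intro!: locstep_read simp: keep_def act3_def split:
      if_splits)
  qed
qed

lemma locstep_pas:
  assumes T: "pc_inv (Pas p) N i l s g" and e: "(l', s') \<in> exec_pas p N i l s"
  shows "locstep N i l s g l' s'"
proof -
  have b: "base i l s g" "l_pInf l = l_mOp l" and T': "pas_inv p i l s g" using T by auto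
  have id: "o_id s (l_mOp l) = i" using b by (simp add: base_def)
  show ?thesis
  proof (cases p)
    case W4
    then show ?thesis using e T' b by (auto intro!: locstep_write[OF guar_location] simp: keep_def)
  next
    case W6
    then show ?thesis using e T' b by (auto intro!: locstep_read simp: keep_def capt_def split:
      if_splits)
  next
    case W7
    then show ?thesis using e T' b
      by (auto intro!: locstep_read thread_inv_finish simp: keep_def elimd_def finok_def split:
        if_splits)
  next
    case W9
    then show ?thesis using e T' b
      by (auto intro!: locstep_write[OF guar_cell_write] thread_inv_finish base_cell_write
          simp: keep_def elimd_def finok_simps celldone_write)
  next
    case W11
    then show ?thesis using e T' b
      by (auto intro!: locstep_read thread_inv_finish simp: keep_def waiting_def leads_def split:
        if_splits)
  next
    case W12
    \<comment> \<open>A retried record is an ordinary head except for its status, which W12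
      resets.\<close>
    then have "leads i l s g" "hlist i s g (gh_q g i)" using T' by auto
    moreover have "gh_own g (l_mOp l) = i" "gh_mode g (l_mOp l) = MHead"
      using head_own[OF calculation] calculation(1) by (auto simp: leads_def)
    ultimately show ?thesis using e T' b W12
      by (auto intro!: locstep_write[OF guar_head_status] thread_inv_enter simp: keep_def head_def)
  qed (use e T' b id in \<open>auto intro!: locstep_read simp: keep_def\<close>)
qed

section \<open>Steps of combine\<close>

lemma lseg_append_upd:
  assumes "lseg nx a xs b" "xs \<noteq> []" "distinct xs" "lseg nx c ys d" "last xs \<notin> set ys"
  shows "lseg (nx(last xs := c)) a (xs @ ys) d"
  using assms
proof (induction xs arbitrary: a)
  case (Cons x xs)
  show ?case
  proof (cases "xs = []")
    case True
    then have "lseg (nx(x := c)) a (x # ys) d" using Cons.prems lseg_upd[of x ys nx c c d] by simp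
    then show ?thesis unfolding True by (simp only: last.simps append.simps simp_thms if_True)
  next
    case False
    have l: "last (x # xs) = last xs" using False by (rule last_ConsR)
    have "lseg (nx(last xs := c)) (nx x) (xs @ ys) d"
      using Cons.prems False unfolding l by (intro Cons.IH) simp_all
    moreover have "x \<noteq> last xs" using False Cons.prems(3) last_in_set by fastforce
    ultimately have "lseg (nx(last xs := c)) a (x # xs @ ys) d" using Cons.prems(1) by simp
    then show ?thesis unfolding l by (simp only: append_Cons)
  qed
qed simp

lemma linked_append:
  "xs \<noteq> [] \<Longrightarrow> ys \<noteq> [] \<Longrightarrow>
    linked s (xs @ ys) \<longleftrightarrow> linked s xs \<and> linked s ys \<and> c_next s (o_cell s (last xs)) = o_cell s (hd ys)"
proof (induction xs rule: induct_list012)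
  case (2 x)
  then show ?case by (cases ys) auto
qed auto

lemma linked_c_next_other:
  assumes "linked s xs" "c \<notin> o_cell s ` set xs"
  shows "linked (s\<lparr>c_next := (c_next s)(c := v)\<rparr>) xs"
  using assms(1)
proof (rule linked_cong)
  fix x
  assume "x \<in> set (butlast xs)"
  then have "x \<in> set xs" by (rule in_set_butlastD)
  then show "c_next (s\<lparr>c_next := (c_next s)(c := v)\<rparr>) (o_cell s x) = c_next s (o_cell s x)"
    using assms(2) by auto
qed simp

lemma hlist_unfold:
  assumes "hlist t s g xs"
  shows "xs \<noteq> []" "owned t s g xs" "optype s (o_op s (hd xs)) xs" "unres g xs"
    "o_last s (hd xs) = last xs" "o_length s (hd xs) = int (length xs)"
    "o_op s (hd xs) = PUSH \<Longrightarrow> linked s xs" "waits g (tl xs)" "lseg (o_next s) (hd xs) xs null"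
  using assms by (simp_all add: hlist_def plist_def)

text \<open>The links of the second list survive as well: the lists are disjoint, so none of its
  records has the written cell.\<close>

lemma comb0_c_next:
  assumes c: "comb0 t l s g" and G: "global_inv N s g" and push: "o_op s (l_mOp l) = PUSH"
  shows "comb0 t l (s\<lparr>c_next := (c_next s)(o_cell s (last (gh_q g t)) := v)\<rparr>) g"
proof -
  have h: "head t l s g" "hlist t s g (gh_z g t)" "set (gh_q g t) \<inter> set (gh_z g t) = {}"
    "o_op s (hd (gh_z g t)) = PUSH"
    using c push by (auto simp: comb0_def)
  note hu = head_unfold[OF h(1)] and zu = hlist_unfold[OF h(2)]
  have l: "last (gh_q g t) \<in> set (gh_q g t)" using hu(1) by simp
  have "o_cell s (last (gh_q g t)) \<notin> o_cell s ` set (gh_z g t)"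
  proof
    assume "o_cell s (last (gh_q g t)) \<in> o_cell s ` set (gh_z g t)"
    then obtain r where r: "r \<in> set (gh_z g t)" "o_cell s (last (gh_q g t)) = o_cell s r" by auto
    have "last (gh_q g t) = r"
      using cells_inj[OF G] r l owned_push[OF hu(3)] owned_push[OF zu(2)] hu(4) zu(3) push h(4)
      by (auto dest: inj_onD)
    then show False using l r(1) h(3) by auto
  qed
  then have "linked (s\<lparr>c_next := (c_next s)(o_cell s (last (gh_q g t)) := v)\<rparr>) (gh_z g t)"
    using linked_c_next_other zu(7) h(4) by blast
  then have "hlist t (s\<lparr>c_next := (c_next s)(o_cell s (last (gh_q g t)) := v)\<rparr>) g (gh_z g t)"
    using h(2) by (simp add: hlist_def plist_def)
  then show ?thesis using c head_c_next[OF h(1) G push] by (simp add: comb0_def)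
qed

text \<open>The pointer write at B7 is the moment at which the ghost lists merge. The fields
  \<open>last\<close> and \<open>length\<close> of the active record follow later, so the conclusion
  is only \<open>comb1\<close>.\<close>

lemma comb0_link:
  assumes c: "comb0 t l s g"
    and n: "o_op s (l_mOp l) = PUSH \<longrightarrow> c_next s (o_cell s (last (gh_q g t))) = o_cell s (l_pInf l)"
  defines "xs \<equiv> gh_q g t @ gh_z g t"
  shows "comb1 t l (s\<lparr>o_next := (o_next s)(last (gh_q g t) := l_pInf l)\<rparr>)
      (g\<lparr>gh_q := (gh_q g)(t := xs)\<rparr>) \<and>
    o_last s (l_pInf l) = last xs \<and> o_length s (l_mOp l) + o_length s (l_pInf l) = int (length xs) \<and>
    gh_own g (last (gh_q g t)) = t"
proof -
  have h: "head t l s g" "hlist t s g (gh_z g t)" "set (gh_q g t) \<inter> set (gh_z g t) = {}"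
    and p: "hd (gh_z g t) = l_pInf l" "gh_mode g (l_pInf l) = MWait"
    "o_op s (l_pInf l) = o_op s (l_mOp l)" "l_aInf l = l_mOp l"
    using c by (auto simp: comb0_def)
  note hu = head_unfold[OF h(1)] and zu = hlist_unfold[OF h(2)]
  have pz: "l_pInf l \<in> set (gh_z g t)" using p(1) zu(1) hd_in_set by metis
  have mq: "l_mOp l \<in> set (gh_q g t)" using hu(1,2) hd_in_set by metis
  have l: "last (gh_q g t) \<in> set (gh_q g t)" using hu(1) by simp
  have ls: "lseg ((o_next s)(last (gh_q g t) := l_pInf l)) (l_mOp l) xs null"
    unfolding xs_def
    using lseg_append_upd[OF hu(10,1) _ zu(9)] hu(3) l h(3) p(1) by (auto simp: owned_def)
  have own: "owned t s g xs" using hu(3) zu(2) h(3) by (auto simp: owned_def xs_def)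
  have ty: "optype s (o_op s (l_mOp l)) xs" using hu(4) zu(3) p by (auto simp: optype_def xs_def)
  have un: "unres g xs" using hu(5) zu(4) by (auto simp: unres_def xs_def)
  \<comment> \<open>The mode of the first record is left open by \<open>plist\<close>; here it is
    \<open>MWait\<close> since the capture, so the whole second list waits.\<close>
  have "gh_z g t = l_pInf l # tl (gh_z g t)" using p(1) zu(1) by (metis list.collapse)
  then have "waits g (gh_z g t)" using zu(8) p(2) by (metis set_ConsD waits_def)
  then have w: "waits g (tl xs)" using hu(1,9) by (auto simp: waits_def xs_def)
  have li: "linked s xs" if "o_op s (l_mOp l) = PUSH"
    using that hu(8) zu(7) p n linked_append[OF hu(1) zu(1)] by (auto simp: xs_def)
  have hd: "hd xs = l_mOp l" "xs \<noteq> []" using hu(1,2) by (auto simp: xs_def)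
  have "comb1 t l (s\<lparr>o_next := (o_next s)(last (gh_q g t) := l_pInf l)\<rparr>) (g\<lparr>gh_q := (gh_q g)(t := xs)\<rparr>)"
    using ls own ty un w li hd hu(11,12) p(4) owned_mem[OF zu(2) pz] mq pz h(3)
    by (auto simp: comb1_def leads_def plist_def)
  then show ?thesis using hu(6,7) zu(5,6) p(1) zu(1) owned_last[OF hu(3,1)] by (simp add: xs_def)
qed

lemma comb1_own: "comb1 t l s g \<Longrightarrow> gh_own g (l_mOp l) = t"
  using owned_hd[of t s g "gh_q g t"] by (auto simp: comb1_def leads_def plist_def)

lemma comb1_frame [simp]:
  "comb1_at t a p m (s\<lparr>o_last := v1\<rparr>) g = comb1_at t a p m s g"
  "comb1_at t a p m (s\<lparr>o_length := v2\<rparr>) g = comb1_at t a p m s g"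
  by (simp_all add: comb1_def leads_def)

lemma comb1_head:
  assumes "comb1 t l s g" "o_last s (l_mOp l) = last (gh_q g t)"
    "o_length s (l_mOp l) = int (length (gh_q g t))"
  shows "head t l s g"
  using assms by (simp add: comb1_def head_def hlist_def leads_def)

lemma locstep_comb:
  assumes T: "pc_inv (Comb p) N i l s g" and e: "(l', s') \<in> exec_comb p N i l s"
    and G: "global_inv N s g"
  shows "locstep N i l s g l' s'"
proof -
  have b: "base i l s g" "g_location s i = null" and T': "comb_inv p i l s g" using T by auto
  have c0: "l_aInf l = l_mOp l" "o_last s (l_mOp l) = last (gh_q g i)" "head i l s g" if "comb0 i l s g"
    using that head_unfold(6)[of i l s g] by (auto simp: comb0_def)
  have c1: "l_aInf l = l_mOp l" "gh_own g (l_mOp l) = i" "l_pInf l \<noteq> l_mOp l" if "comb1 i l s g"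
    using that comb1_own[OF that] by (auto simp: comb1_def)
  show ?thesis
  proof (cases p)
    case B5
    then show ?thesis using e T' b c0 comb0_c_next[OF _ G, of i l] head_last[OF c0(3)]
      by (auto intro!: locstep_write[OF guar_c_next] simp: keep_def)
  next
    case B7
    have n: "comb0 i l s g" "o_op s (l_mOp l) = PUSH \<longrightarrow>
      c_next s (o_cell s (last (gh_q g i))) = o_cell s (l_pInf l)"
      using T' B7 by auto
    show ?thesis using e T' b B7 comb0_link[OF n]
      by (auto intro!: locstep_write[OF guar_next_write[where xs = "gh_q g i @ gh_z g i"]]
        simp: keep_def)
  next
    case B9
    then show ?thesis using e T' b c1
      by (auto intro!: locstep_write[OF guar_last_write] simp: keep_def)
  next
    case B12
    then show ?thesis using e T' b c1
      by (auto intro!: locstep_write[OF guar_length_write] thread_inv_enter comb1_head simp: keep_def)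
  qed (use e T' b c0 c1 in \<open>auto intro!: locstep_read simp: keep_def\<close>)
qed

lemma locstep_load:
  assumes T: "pc_inv p N i l s g" and e: "(l', s') \<in> exec p N i l s" and p: "p = Load1 \<or> p = Load2"
  shows "locstep N i l s g l' s'"
  using assms by (auto intro!: locstep_read simp: keep_def celldone_def)

section \<open>Steps of multiEliminate\<close>

lemma linked_cell_write:
  assumes "optype s PUSH xs" "o_op s r = POP" "linked s xs"
  shows "linked (s\<lparr>o_cell := (o_cell s)(r := v)\<rparr>) xs"
  by (rule linked_cong[OF assms(3)]) (use assms(1,2) in \<open>auto simp: optype_def\<close>)

text \<open>\<open>pairok\<close> reads only the cell of the push record of a pair.\<close>

lemma pairok_cell_write:
  "o_op s r = POP \<Longrightarrow> pairok (s\<lparr>o_cell := (o_cell s)(r := v)\<rparr>) g x y = pairok s g x y"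
  by (cases "o_op s x"; cases "o_op s y") (auto simp: pairok_def)

lemma paired_cell_write:
  "o_op s r = POP \<Longrightarrow> paired (s\<lparr>o_cell := (o_cell s)(r := v)\<rparr>) g xs ys = paired s g xs ys"
  by (induction xs ys rule: list_induct2') (auto simp: pairok_cell_write)

lemma elimbase_frame [simp]:
  "elimbase_at t a p m (s\<lparr>o_cell := v1\<rparr>) g = elimbase_at t a p m s g"
  "elimbase_at t a p m (s\<lparr>o_status := v2\<rparr>) g = elimbase_at t a p m s g"
  "elimbase_at t a p m (s\<lparr>o_length := v3\<rparr>) g = elimbase_at t a p m s g"
  "elimbase_at t a p m s (g\<lparr>gh_q := v5\<rparr>) = elimbase_at t a p m s g"
  "elimbase_at t a p m s (g\<lparr>gh_z := v6\<rparr>) = elimbase_at t a p m s g"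
  by (simp_all add: elimbase_def)

lemma elimlists_frame [simp]:
  "elimlists_at t p m x y (s\<lparr>o_status := v2\<rparr>) g xs ys = elimlists_at t p m x y s g xs ys"
  "elimlists_at t p m x y (s\<lparr>o_length := v3\<rparr>) g xs ys = elimlists_at t p m x y s g xs ys"
  "elimlists_at t p m x y s (g\<lparr>gh_q := v5\<rparr>) xs ys = elimlists_at t p m x y s g xs ys"
  "elimlists_at t p m x y s (g\<lparr>gh_z := v6\<rparr>) xs ys = elimlists_at t p m x y s g xs ys"
  by (simp_all add: elimlists_def)

lemma rest_frame [simp]:
  "rest_at t m (s\<lparr>o_length := v3\<rparr>) g xs r = rest_at t m s g xs r"
  "rest_at t m (s\<lparr>o_last := v4\<rparr>) g xs r = rest_at t m s g xs r"
  "rest_at t m s (g\<lparr>gh_z := v6\<rparr>) xs r = rest_at t m s g xs r"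
  by (simp_all add: rest_def)

lemma elimfull_cell_write:
  assumes e: "elimfull t l s g a b" and r: "o_op s r = POP"
  shows "elimfull t l (s\<lparr>o_cell := (o_cell s)(r := v)\<rparr>) g a b"
proof -
  have "elimlists t l s g (gh_q g t) (gh_z g t)" "elimbase t l s g" using e by (auto simp: elimfull_def)
  then have "elimlists t l (s\<lparr>o_cell := (o_cell s)(r := v)\<rparr>) g (gh_q g t) (gh_z g t)"
    using linked_cell_write[OF _ r]
    by (cases "o_op s (l_mOp l)"; cases "o_op s (l_pInf l)") (auto simp: elimlists_def elimbase_def)
  then show ?thesis using e r by (simp add: elimfull_def paired_cell_write)
qed

lemma elimfull_Cons:
  assumes e: "elimfull t l s g a b"
  obtains xs ys where "gh_q g t = l_aCurr l # xs" "gh_z g t = l_pCurr l # ys"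
    "distinct (l_aCurr l # xs @ l_pCurr l # ys)" "waits g xs" "waits g ys"
    "lseg (o_next s) (o_next s (l_aCurr l)) xs null" "lseg (o_next s) (o_next s (l_pCurr l)) ys null"
    "pairok s g (l_aCurr l) (l_pCurr l)" "paired s g xs ys"
    "gh_own g (l_aCurr l) = t" "gh_own g (l_pCurr l) = t" "gh_own g (l_mOp l) = t"
      "gh_own g (l_pInf l) = t"
    "o_op s (l_aCurr l) = o_op s (l_mOp l)" "o_op s (l_pCurr l) = o_op s (l_pInf l)"
    "o_op s (l_pInf l) \<noteq> o_op s (l_mOp l)" "l_pInf l \<noteq> l_mOp l" "l_aInf l = l_mOp l"
    "gh_mode g (l_mOp l) = MFin"
proof -
  have b: "elimbase t l s g" "elimlists t l s g (gh_q g t) (gh_z g t)"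
    "gh_q g t \<noteq> []" "gh_z g t \<noteq> []" "paired s g (gh_q g t) (gh_z g t)"
    using e by (auto simp: elimfull_def)
  obtain x xs where q: "gh_q g t = x # xs" using b(3) by (auto simp: neq_Nil_conv)
  obtain y ys where z: "gh_z g t = y # ys" using b(4) by (auto simp: neq_Nil_conv)
  have "lseg (o_next s) (l_aCurr l) (gh_q g t) null" "lseg (o_next s) (l_pCurr l) (gh_z g t) null"
    using b(2) by (simp_all add: elimlists_def)
  then have "x = l_aCurr l" "y = l_pCurr l" "lseg (o_next s) (o_next s (l_aCurr l)) xs null"
    "lseg (o_next s) (o_next s (l_pCurr l)) ys null"
    unfolding q z by simp_all
  then show ?thesis
    using that[of xs ys] q z b(1,5) b(2)[unfolded elimlists_def q z]
    by (simp add: elimbase_def owned_def optype_def)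
qed

lemma waits_MFin: "r \<notin> set xs \<Longrightarrow> waits (g\<lparr>gh_mode := (gh_mode g)(r := MFin)\<rparr>) xs = waits g xs"
  by (auto simp: waits_def)

text \<open>The records of the current pair do not occur in the tails of the lists, and only for the
  tails does the assertion demand that they wait.\<close>

lemma elimfull_MFin:
  assumes e: "elimfull t l s g a b" and r: "r = l_aCurr l \<or> r = l_pCurr l"
  shows "elimfull t l s (g\<lparr>gh_mode := (gh_mode g)(r := MFin)\<rparr>) a b"
proof -
  obtain xs ys where q: "gh_q g t = l_aCurr l # xs" "gh_z g t = l_pCurr l # ys"
    "distinct (l_aCurr l # xs @ l_pCurr l # ys)"
    by (rule elimfull_Cons[OF e])
  have "waits (g\<lparr>gh_mode := (gh_mode g)(r := MFin)\<rparr>) xs = waits g xs"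
    "waits (g\<lparr>gh_mode := (gh_mode g)(r := MFin)\<rparr>) ys = waits g ys"
    using r q(3) by (auto intro!: waits_MFin)
  then show ?thesis using e q(1,2) by (simp add: elimfull_def elimlists_def elimbase_def)
qed

lemma elimfull_status [simp]:
  "elimfull_at t a p m x y (s\<lparr>o_status := v2\<rparr>) g n k = elimfull_at t a p m x y s g n k"
  by (simp add: elimfull_def)

lemma elimfull_length:
  assumes "elimfull t l s g a b"
  shows "elimfull t l (s\<lparr>o_length := (o_length s)(l_mOp l := int (length (gh_q g t)) - c)\<rparr>) g c b"
    "elimfull t l (s\<lparr>o_length := (o_length s)(l_pInf l := int (length (gh_z g t)) - c)\<rparr>) g a c"
  using assms by (auto simp: elimfull_def elimbase_def)

text \<open>Dropping the first record of \<open>gh_q\<close> makes up for the earlier decrement, so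
  the active \<open>length\<close> is exact again; the passive one is so only after E13.\<close>

lemma elim_step_q:
  assumes e: "elimfull t l s g 1 1"
  shows "elim13 t (l\<lparr>l_aCurr := o_next s (l_aCurr l)\<rparr>) s (g\<lparr>gh_q := (gh_q g)(t := tl (gh_q g t))\<rparr>)"
proof -
  obtain xs ys where q: "gh_q g t = l_aCurr l # xs" "gh_z g t = l_pCurr l # ys"
    "waits g xs" "lseg (o_next s) (o_next s (l_aCurr l)) xs null" "paired s g xs ys"
    by (rule elimfull_Cons[OF e])
  have b: "elimbase t l s g" "elimlists t l s g (l_aCurr l # xs) (l_pCurr l # ys)"
    "o_length s (l_mOp l) = int (length xs)" "o_length s (l_pInf l) = int (length ys)"
    using e q(1,2) by (auto simp: elimfull_def)
  have "linked s xs" if "linked s (l_aCurr l # xs)" using that by (cases xs) auto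
  moreover have "waits g (tl xs)" using q(3) by (cases xs) (auto simp: waits_def)
  moreover have "lseg (o_next s) (l_pCurr l) (l_pCurr l # ys) null" using b(2)
    by (simp add: elimlists_def)
  ultimately have "elimlists t (l\<lparr>l_aCurr := o_next s (l_aCurr l)\<rparr>) s g xs (l_pCurr l # ys)"
    using b(2) q(4) by (auto simp: elimlists_def owned_def optype_def)
  moreover have "elimbase t (l\<lparr>l_aCurr := o_next s (l_aCurr l)\<rparr>) s g" using b(1) by simp
  ultimately show ?thesis using b(3,4) q by (simp add: elim13_def)
qed

lemma elim_step_z:
  assumes e: "elim13 t l s g"
  defines "l' \<equiv> l\<lparr>l_pCurr := o_next s (l_pCurr l)\<rparr>" and "g' \<equiv> g\<lparr>gh_z := (gh_z g)(t := tl (gh_z g t))\<rparr>"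
  shows "elimbase t l' s g'" "elimlists t l' s g' (gh_q g' t) (gh_z g' t)"
    "waits g' (gh_q g' t)" "waits g' (gh_z g' t)" "paired s g' (gh_q g' t) (gh_z g' t)"
    "o_length s (l_mOp l') = int (length (gh_q g' t))"
      "o_length s (l_pInf l') = int (length (gh_z g' t))"
    "l_aCurr l' = null \<longleftrightarrow> gh_q g' t = []" "l_pCurr l' = null \<longleftrightarrow> gh_z g' t = []"
proof -
  have b: "elimbase t l s g" "elimlists t l s g (gh_q g t) (gh_z g t)" "gh_z g t \<noteq> []"
    "waits g (gh_q g t)" "paired s g (gh_q g t) (tl (gh_z g t))"
    "o_length s (l_mOp l) = int (length (gh_q g t))"
      "o_length s (l_pInf l) = int (length (gh_z g t)) - 1"
    using e by (auto simp: elim13_def)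
  obtain y ys where z: "gh_z g t = y # ys" using b(3) by (auto simp: neq_Nil_conv)
  have ls: "lseg (o_next s) (l_pCurr l) (y # ys) null" "waits g ys"
    and lq: "lseg (o_next s) (l_aCurr l) (gh_q g t) null"
    and o: "owned t s g (gh_q g t @ y # ys)"
    using b(2) unfolding z by (simp_all add: elimlists_def)
  then have y: "y = l_pCurr l" "lseg (o_next s) (o_next s (l_pCurr l)) ys null" by simp_all
  have "linked s ys" if "linked s (y # ys)" using that by (cases ys) auto
  moreover have "waits g (tl ys)" using ls(2) by (cases ys) (auto simp: waits_def)
  ultimately have el: "elimlists t l' s g (gh_q g t) ys"
    using b(2) y(2) lq unfolding z by (auto simp: elimlists_def owned_def optype_def l'_def)
  have "null \<notin> set (gh_q g t)" "null \<notin> set ys" using o by (auto simp: owned_def)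
  then have "l_aCurr l = null \<longleftrightarrow> gh_q g t = []" "o_next s (l_pCurr l) = null \<longleftrightarrow> ys = []"
    using lseg_null[OF lq] lseg_null[OF y(2)] by auto
  then show "elimbase t l' s g'" "elimlists t l' s g' (gh_q g' t) (gh_z g' t)"
    "waits g' (gh_q g' t)" "waits g' (gh_z g' t)" "paired s g' (gh_q g' t) (gh_z g' t)"
    "o_length s (l_mOp l') = int (length (gh_q g' t))"
      "o_length s (l_pInf l') = int (length (gh_z g' t))"
    "l_aCurr l' = null \<longleftrightarrow> gh_q g' t = []" "l_pCurr l' = null \<longleftrightarrow> gh_z g' t = []"
    using el b z ls(2) by (simp_all add: g'_def l'_def)
qed

text \<open>When one list is exhausted, \<open>paired\<close> says that no operation of the other
  has taken effect; that suffix is a proper list again.\<close>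

lemma elimlists_rest:
  assumes b: "elimbase t l s g" and e: "elimlists t l s g xs ys" and f: "finok s g (l_mOp l)"
    and p: "paired s g xs ys"
  shows "xs \<noteq> [] \<Longrightarrow> ys = [] \<Longrightarrow> waits g xs \<Longrightarrow> rest t l s g xs (l_aCurr l) \<and> o_last s (l_mOp l) = last xs"
    "ys \<noteq> [] \<Longrightarrow> xs = [] \<Longrightarrow> waits g ys \<Longrightarrow> rest t l s g ys (l_pCurr l) \<and> o_last s (l_pInf l) = last ys"
proof -
  have m: "gh_mode g (l_mOp l) = MFin" using b by (simp add: elimbase_def)
  { assume *: "xs \<noteq> []" "ys = []" "waits g xs"
    have l: "lseg (o_next s) (l_aCurr l) xs null" and o: "owned t s g xs" and
      ty: "optype s (o_op s (l_mOp l)) xs" and "o_last s (l_mOp l) = last xs" "waits g (tl xs)"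
      "o_op s (l_mOp l) = PUSH \<longrightarrow> linked s xs"
      using e * by (auto simp: elimlists_def)
    moreover have "unres g xs" using p * by (cases xs) auto
    moreover have "o_op s (hd xs) = o_op s (l_mOp l)" using optype_hd[OF ty *(1)] .
    moreover have "hd xs = l_aCurr l" using lseg_hd[OF l *(1)] .
    ultimately show "rest t l s g xs (l_aCurr l) \<and> o_last s (l_mOp l) = last xs"
      using * m f by (simp add: rest_def plist_def) }
  { assume *: "ys \<noteq> []" "xs = []" "waits g ys"
    have l: "lseg (o_next s) (l_pCurr l) ys null" and o: "owned t s g ys" and
      ty: "optype s (o_op s (l_pInf l)) ys" and "o_last s (l_pInf l) = last ys" "waits g (tl ys)"
      "o_op s (l_mOp l) \<noteq> PUSH \<longrightarrow> linked s ys"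
      using e * by (auto simp: elimlists_def)
    moreover have "o_op s (l_pInf l) \<noteq> o_op s (l_mOp l)" using b by (simp add: elimbase_def)
    moreover have "unres g ys" using p * by (cases ys) auto
    moreover have "o_op s (hd ys) = o_op s (l_pInf l)" using optype_hd[OF ty *(1)] .
    moreover have "hd ys = l_pCurr l" using lseg_hd[OF l *(1)] .
    ultimately show "rest t l s g ys (l_pCurr l) \<and> o_last s (l_pInf l) = last ys"
      using * m f by (auto simp: rest_def plist_def) }
qed

lemma rest_hd:
  assumes "rest t l s g xs x"
  shows "gh_own g x = t" "x \<noteq> l_mOp l" "gh_mode g x = MWait"
proof -
  have *: "xs \<noteq> []" "owned t s g xs" "hd xs = x" "waits g xs" "gh_mode g (l_mOp l) = MFin"
    using assms by (auto simp: rest_def plist_def)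
  then have "x \<in> set xs" by auto
  then show "gh_own g x = t" "x \<noteq> l_mOp l" "gh_mode g x = MWait"
    using * by (auto simp: owned_def waits_def)
qed

lemma finok_cell_write:
  assumes "finok s g r'" "o_op s r = POP" "v \<in> c_alloc s" "gh_res g r = Some (Ret (c_data s v))"
  shows "finok (s\<lparr>o_cell := (o_cell s)(r := v)\<rparr>) g r'"
  using assms by (auto simp: finok_def celldone_def)

text \<open>E18 and E23 are excluded because they pass records on to another thread, which
  \<open>guar\<close> does not permit.\<close>

lemma locstep_elim:
  assumes T: "pc_inv (Elim p) N i l s g" and e: "(l', s') \<in> exec_elim p N i l s" and p: "p \<noteq> E18"
    "p \<noteq> E23"
  shows "locstep N i l s g l' s'"
proof -
  have b: "base i l s g" "g_location s i = null" and T': "elim_inv p i l s g" using T by auto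
  have f: "gh_own g (l_aCurr l) = i" "gh_own g (l_pCurr l) = i" "gh_own g (l_mOp l) = i"
    "gh_own g (l_pInf l) = i" "l_aInf l = l_mOp l" "gh_mode g (l_mOp l) = MFin"
    "o_op s (l_aCurr l) = o_op s (l_mOp l)" "o_op s (l_pCurr l) \<noteq> o_op s (l_mOp l)"
    "pairok s g (l_aCurr l) (l_pCurr l)"
    if f: "elimfull i l s g a d" for a d
    by (rule elimfull_Cons[OF f], simp)+
  have len: "o_length s (l_mOp l) = int (length (gh_q g i)) - a"
    "o_length s (l_pInf l) = int (length (gh_z g i)) - d" if f: "elimfull i l s g a d" for a d
    using f by (simp_all add: elimfull_def)
  have r: "l_aInf l = l_mOp l" "gh_own g (l_pInf l) = i" "gh_own g (l_mOp l) = i"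
    if "elimbase i l s g"
    using that by (auto simp: elimbase_def)
  show ?thesis
  proof (cases p)
    case E1
    then have "l_aInf l = l_mOp l" using T' f(5)[of 0 0] by simp
    then show ?thesis using e T' b E1 by (auto intro!: locstep_read simp: keep_def)
  next
    case E8
    then have "l_aInf l = l_mOp l" using T' f(5)[of 0 0] by simp
    then show ?thesis using e T' b E8 len(1)[of 0 0] by (auto intro!: locstep_read simp: keep_def)
  next
    case E3
    then have t: "elimfull i l s g 0 0" "l_aCurr l = l_mOp l \<or> finok s g (l_mOp l)"
      "o_op s (l_mOp l) = POP"
      "l_cp l = o_cell s (l_pCurr l)" using T' by auto
    note f = f[OF t(1)]
    have c: "gh_res g (l_aCurr l) = Some (Ret (c_data s (l_cp l)))" "l_cp l \<in> c_alloc s"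
       "gh_res g (l_pCurr l) = Some Ack" "o_op s (l_pCurr l) = PUSH" "o_op s (l_aCurr l) = POP"
      using f(7-9) t(3,4) by (auto simp: pairok_def)
    let ?s = "s\<lparr>o_cell := (o_cell s)(l_aCurr l := l_cp l)\<rparr>"
    have fa: "finok ?s g (l_aCurr l)" "finok ?s g (l_pCurr l)" using c
      by (simp_all add: finok_def celldone_def)
    \<comment> \<open>In the first iteration \<open>l_aCurr\<close> is \<open>l_mOp\<close> itself
      and this very write establishes the claim; afterwards it only has to be preserved.\<close>
    moreover have "finok ?s g (l_mOp l)" using t(2) fa(1) c finok_cell_write by metis
    moreover have "elimfull i l ?s g 0 0" using elimfull_cell_write[OF t(1) c(5)] .
    ultimately show ?thesis using e b E3 c base_cell_write[OF b(1) c(5)]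
      by (auto intro!: locstep_write[OF guar_cell_write] simp: keep_def)
  next
    case E5
    then have t: "elimfull i l s g 0 0" "l_aCurr l = l_mOp l \<or> finok s g (l_mOp l)"
      "o_op s (l_mOp l) = PUSH"
      "l_cp l = o_cell s (l_aCurr l)" using T' by auto
    note f = f[OF t(1)]
    have c: "gh_res g (l_pCurr l) = Some (Ret (c_data s (l_cp l)))" "l_cp l \<in> c_alloc s"
       "gh_res g (l_aCurr l) = Some Ack" "o_op s (l_aCurr l) = PUSH" "o_op s (l_pCurr l) = POP"
      using f(7-9) t(3,4) by (auto simp: pairok_def)
    let ?s = "s\<lparr>o_cell := (o_cell s)(l_pCurr l := l_cp l)\<rparr>"
    have fa: "finok ?s g (l_aCurr l)" "finok ?s g (l_pCurr l)" using c
      by (simp_all add: finok_def celldone_def)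
    moreover have "finok ?s g (l_mOp l)" using t(2) fa(1) c finok_cell_write by metis
    moreover have "elimfull i l ?s g 0 0" using elimfull_cell_write[OF t(1) c(5)] .
    ultimately show ?thesis using e b E5 c base_cell_write[OF b(1) c(5)]
      by (auto intro!: locstep_write[OF guar_cell_write] simp: keep_def)
  next
    case E6
    then show ?thesis using e T' b f elimfull_MFin[of i l s g 0 0 "l_aCurr l"]
      by (auto intro!: locstep_write[OF guar_finished] simp: keep_def base_MFin)
  next
    case E7
    then show ?thesis using e T' b f elimfull_MFin[of i l s g 0 0 "l_pCurr l"]
      by (auto intro!: locstep_write[OF guar_finished] simp: keep_def base_MFin)
  next
    case E9
    then have "elimfull i l s g 0 0" using T' by simp
    then show ?thesis using e T' b E9 f[of 0 0] elimfull_length(1)[of i l s g 0 0 1]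
      by (auto intro!: locstep_write[OF guar_length_write] simp: keep_def)
  next
    case E11
    then have "elimfull i l s g 1 0" using T' by simp
    then show ?thesis using e T' b E11 f[of 1 0] elimfull_length(2)[of i l s g 1 0 1]
      by (auto intro!: locstep_write[OF guar_length_write] simp: keep_def)
  next
    case E12
    then show ?thesis using e T' b f elim_step_q[of i l s g]
      by (auto intro!: locstep_write[OF guar_q[where xs = "tl (gh_q g i)"]] simp: keep_def)
  next
    case E13
    then have t: "elim13 i l s g" "finok s g (l_mOp l)" using T' by auto
    note z = elim_step_z[OF t(1)]
    let ?l = "l\<lparr>l_pCurr := o_next s (l_pCurr l)\<rparr>" and ?g = "g\<lparr>gh_z := (gh_z g)(i := tl (gh_z g i))\<rparr>"
    have fin: "finok s ?g (l_mOp ?l)" using t(2) by simp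
    note re = elimlists_rest[OF z(1,2) fin z(5)]
    have m: "gh_mode g (l_mOp l) = MFin" using z(1) by (simp add: elimbase_def)
    have T1: "thread_inv N i (if \<not> (l_aCurr ?l = null \<or> l_pCurr ?l = null) then goto (Elim E1) ?l
           else if l_aCurr ?l \<noteq> null then goto (Elim E14) ?l
           else if l_pCurr ?l \<noteq> null then goto (Elim E19) ?l
           else finish ?l) s ?g"
    proof -
      consider "l_aCurr ?l \<noteq> null" "l_pCurr ?l \<noteq> null" | "l_aCurr ?l \<noteq> null" "l_pCurr ?l = null" |
        "l_aCurr ?l = null" "l_pCurr ?l \<noteq> null" | "l_aCurr ?l = null" "l_pCurr ?l = null" by blast
      then show ?thesis
      proof cases
        case 1
        then have "elimfull i ?l s ?g 0 0" using z by (simp add: elimfull_def)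
        then show ?thesis using 1 b fin by simp
      next
        case 2
        then show ?thesis using re(1) z b by simp
      next
        case 3
        then show ?thesis using re(2) z b by simp
      next
        case 4
        have "thread_inv N i (finish ?l) s ?g" by (rule thread_inv_finish) (use b fin m in simp_all)
        then show ?thesis using 4 by simp
      qed
    qed
    have "(l', s') = (if \<not> (l_aCurr ?l = null \<or> l_pCurr ?l = null) then goto (Elim E1) ?l
           else if l_aCurr ?l \<noteq> null then goto (Elim E14) ?l
           else if l_pCurr ?l \<noteq> null then goto (Elim E19) ?l
           else finish ?l, s)"
      using e E13 by (simp add: Let_def)
    then show ?thesis using T1
      by (intro locstep_write[where g' = ?g]) (auto simp: guar_z keep_def)
  next
    case E15
    then show ?thesis using e T' b rest_hd[of i l s g "gh_q g i" "l_aCurr l"]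
      by (auto intro!: locstep_write[OF guar_length_write] simp: keep_def)
  next
    case E17
    then show ?thesis using e T' b rest_hd[of i l s g "gh_q g i" "l_aCurr l"]
      by (auto intro!: locstep_write[OF guar_last_write] simp: keep_def)
  next
    case E20
    then show ?thesis using e T' b rest_hd[of i l s g "gh_z g i" "l_pCurr l"]
      by (auto intro!: locstep_write[OF guar_length_write] simp: keep_def)
  next
    case E22
    then show ?thesis using e T' b rest_hd[of i l s g "gh_z g i" "l_pCurr l"]
      by (auto intro!: locstep_write[OF guar_last_write] simp: keep_def)
  qed (use e T' b f len r p in \<open>auto intro!: locstep_read simp: keep_def\<close>)
qed

section \<open>Linearization steps\<close>

definition live :: "'v locals \<Rightarrow> bool" where
  "live l \<longleftrightarrow> l_pc l \<noteq> Idle \<and> l_pc l \<noteq> Start"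

definition ready :: "nat \<Rightarrow> (nat \<Rightarrow> 'v locals) \<Rightarrow> 'v shared \<Rightarrow> op_ptr \<Rightarrow> bool" where
  "ready N ls s r \<longleftrightarrow> o_id s r \<in> {1..N} \<and> live (ls (o_id s r)) \<and> l_mOp (ls (o_id s r)) = r \<and>
     callop (l_call (ls (o_id s r))) r s"

definition named :: "nat \<Rightarrow> (nat \<Rightarrow> 'v locals) \<Rightarrow> 'v shared \<Rightarrow> bool" where
  "named N ls s \<longleftrightarrow> (\<forall>u\<in>{1..N}. live (ls u) \<longrightarrow> o_id s (l_mOp (ls u)) = u)"

lemma thread_inv_base: "thread_inv N u l s g \<Longrightarrow> live l \<Longrightarrow> base u l s g"
  by (cases "l_pc l") (auto simp: live_def)

lemma inv_named: "decs_inv N h ls s g S \<Longrightarrow> named N ls s"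
  unfolding named_def by (auto simp: decs_inv_def dest: thread_inv_base base_id)

text \<open>The reason why operations of foreign threads can be linearized: the thread of an
  unfinished record is not quiet, so it is in the middle of a call, and by \<open>sole\<close> that
  call is the one for which the record was made.\<close>

lemma inv_ready:
  assumes I: "decs_inv N h ls s g S" and r: "r \<in> o_alloc s" "r \<noteq> null" "gh_mode g r \<noteq> MFin"
  shows "ready N ls s r"
proof -
  let ?t = "o_id s r"
  have t: "?t \<in> {1..N}" using I r by (auto simp: decs_inv_def global_inv_def)
  then have T: "thread_inv N ?t (ls ?t) s g" using I by (simp add: decs_inv_def)
  have "live (ls ?t)"
  proof (rule ccontr)
    assume "\<not> live (ls ?t)"
    then have "quiet ?t s g" using T by (auto simp: live_def)
    then show False using r by (simp add: quiet_def)
  qed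
  then have "base ?t (ls ?t) s g" using T thread_inv_base by blast
  then have "l_mOp (ls ?t) = r" "callop (l_call (ls ?t)) (l_mOp (ls ?t)) s"
    using r by (auto simp: base_def sole_def)
  then show ?thesis using t \<open>live (ls ?t)\<close> by (simp add: ready_def)
qed

text \<open>Fixing the response of \<open>r\<close> affects the phase of one thread only, because
  \<open>named\<close> recovers a live thread from its record.\<close>

lemma lin_op:
  assumes L: "linearizing h L S (phase_of N ls f)" and n: "named N ls s" and r: "ready N ls s r"
    "f r = None"
    and st: "stack_step S (l_call (ls (o_id s r))) = (S', x)"
  shows "\<exists>L. linearizing h L S' (phase_of N ls (f(r := Some x)))"
proof -
  let ?t = "o_id s r"
  have p: "phase_of N ls f ?t = Pending (l_call (ls ?t))"
    using r by (simp add: phase_of_def ready_def live_def)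
  have "phase_of N ls (f(r := Some x)) = (phase_of N ls f)(?t := Linearized (l_call (ls ?t)) x)"
  proof
    fix u
    show "phase_of N ls (f(r := Some x)) u = ((phase_of N ls f)(?t := Linearized (l_call (ls ?t)) x)) u"
    proof (cases "u = ?t")
      case True
      then show ?thesis using r by (simp add: phase_of_def ready_def live_def)
    next
      case False
      then have "l_mOp (ls u) \<noteq> r" if "u \<in> {1..N}" "live (ls u)"
        using n that by (auto simp: named_def)
      then show ?thesis using False by (auto simp: phase_of_def live_def split: option.splits)
    qed
  qed
  then show ?thesis using linearizing_lin[OF L p st] by metis
qed

fun assign :: "(nat \<Rightarrow> 'b option) \<Rightarrow> nat list \<Rightarrow> 'b list \<Rightarrow> nat \<Rightarrow> 'b option" where
  "assign f (x # xs) (r # rs) = assign (f(x := Some r)) xs rs"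
| "assign f _ _ = f"

lemma assign_other: "y \<notin> set xs \<Longrightarrow> assign f xs rs y = f y"
  by (induction f xs rs rule: assign.induct) auto

lemma assign_map: "distinct xs \<Longrightarrow> length rs = length xs \<Longrightarrow> map (assign f xs rs) xs = map Some rs"
  by (induction f xs rs rule: assign.induct) (auto simp: assign_other)

lemma length_pops [simp]: "length (pops s n c) = n"
  by (induction n arbitrary: c) auto

abbreviation cells_data :: "'v shared \<Rightarrow> cell_ptr list \<Rightarrow> 'v list" where
  "cells_data s cs \<equiv> map (\<lambda>c. the (c_data s c)) cs"

text \<open>Each pop removes the first cell of the chain, which is the end of the abstract stack.
  When the chain is used up, \<open>c\<close> stays \<open>null\<close> and the remaining pops
  return empty, just as \<open>adv\<close> and \<open>pops\<close> do.\<close>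

lemma lin_pops:
  assumes G: "global_inv N s g" and n: "named N ls s"
    and "linearizing h L (rev (cells_data s cs)) (phase_of N ls f)"
    and "lseg (c_next s) c cs null" "set cs \<subseteq> gh_pub g"
    and "distinct xs" "\<forall>r\<in>set xs. ready N ls s r \<and> o_op s r = POP \<and> f r = None"
  shows "\<exists>L cs'. linearizing h L (rev (cells_data s cs')) (phase_of N ls (assign f xs (pops s
    (length xs) c))) \<and>
    lseg (c_next s) (adv (c_next s) (length xs) c) cs' null \<and> set cs' \<subseteq> gh_pub g"
  using assms(3-)
proof (induction xs arbitrary: L cs c f)
  case Nil
  then show ?case by auto
next
  case (Cons x xs)
  have x: "ready N ls s x" "f x = None" using Cons.prems by auto
  have pop: "l_call (ls (o_id s x)) = Pop"
    using Cons.prems(5) by (auto simp: ready_def callop_def split: call.splits)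
  have nn: "null \<notin> gh_pub g" using G by (simp add: global_inv_def)
  show ?case
  proof (cases cs)
    case Nil
    then have c: "c = null" using Cons.prems(2) by simp
    have "\<exists>L. linearizing h L (rev (cells_data s cs)) (phase_of N ls (f(x := Some (Ret None))))"
      using lin_op[OF Cons.prems(1) n x] Nil pop by simp
    then obtain L' where "linearizing h L' (rev (cells_data s cs)) (phase_of N ls (f(x := Some (Ret
      None))))" ..
    moreover have "distinct xs" "\<forall>r\<in>set xs. ready N ls s r \<and> o_op s r = POP \<and>
      (f(x := Some (Ret None))) r = None"
      using Cons.prems(4,5) by auto
    ultimately have "\<exists>L cs'. linearizing h L (rev (cells_data s cs'))
         (phase_of N ls (assign (f(x := Some (Ret None))) xs (pops s (length xs) c))) \<and>
       lseg (c_next s) (adv (c_next s) (length xs) c) cs' null \<and> set cs' \<subseteq> gh_pub g"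
      using Cons.prems(2,3) by (intro Cons.IH)
    then show ?thesis unfolding c by simp
  next
    case (Cons d ds)
    then have c: "c = d" "c \<noteq> null" "d \<in> gh_pub g" "lseg (c_next s) (c_next s c) ds null"
      using Cons.prems(2,3) nn by auto
    then have d: "c_data s d = Some (the (c_data s d))" using G by (auto simp: global_inv_def)
    have "\<exists>L. linearizing h L (rev (cells_data s ds)) (phase_of N ls (f(x := Some (Ret (c_data s c)))))"
      using lin_op[OF Cons.prems(1) n x] Cons pop c(1) d by simp
    then obtain L' where "linearizing h L' (rev (cells_data s ds)) (phase_of N ls (f(x := Some (Ret
      (c_data s c)))))" ..
    moreover have "distinct xs"
        "\<forall>r\<in>set xs. ready N ls s r \<and> o_op s r = POP \<and> (f(x := Some (Ret (c_data s c)))) r = None"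
        "set ds \<subseteq> gh_pub g"
      using Cons.prems(3-5) Cons by auto
    ultimately have "\<exists>L cs'. linearizing h L (rev (cells_data s cs'))
         (phase_of N ls (assign (f(x := Some (Ret (c_data s c)))) xs (pops s (length xs) (c_next s
           c)))) \<and>
       lseg (c_next s) (adv (c_next s) (length xs) (c_next s c)) cs' null \<and> set cs' \<subseteq> gh_pub g"
      using c(4) by (intro Cons.IH)
    then show ?thesis using c(2) by simp
  qed
qed

text \<open>The induction hypothesis pushes the tail before the head is pushed, which leaves the
  data of the head on top.\<close>

lemma lin_pushes:
  assumes n: "named N ls s" and L: "linearizing h L S (phase_of N ls f)"
    and "distinct xs" "\<forall>r\<in>set xs. ready N ls s r \<and> o_op s r = PUSH \<and> f r = None"
  shows "\<exists>L. linearizing h L (S @ rev (cells_data s (map (o_cell s) xs)))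
    (phase_of N ls (\<lambda>r. if r \<in> set xs then Some Ack else f r))"
  using assms(3-)
proof (induction xs)
  case Nil
  then show ?case using L by auto
next
  case (Cons x xs)
  let ?f = "\<lambda>r. if r \<in> set xs then Some Ack else f r"
  obtain L' where L': "linearizing h L' (S @ rev (cells_data s (map (o_cell s) xs))) (phase_of N ls ?f)"
    using Cons by auto
  have x: "ready N ls s x" "?f x = None" using Cons.prems by auto
  have "l_call (ls (o_id s x)) = Push (the (c_data s (o_cell s x)))"
    using Cons.prems by (auto simp: ready_def callop_def split: call.splits)
  then have "\<exists>L. linearizing h L (S @ rev (cells_data s (map (o_cell s) (x # xs)))) (phase_of N ls
    (?f(x := Some Ack)))"
    using lin_op[OF L' n x] by simp
  moreover have "?f(x := Some Ack) = (\<lambda>r. if r \<in> set (x # xs) then Some Ack else f r)" by auto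
  ultimately show ?case by metis
qed

fun exchange :: "'v shared \<Rightarrow> (nat \<Rightarrow> 'v resp option) \<Rightarrow> nat list \<Rightarrow> nat list \<Rightarrow> nat \<Rightarrow> 'v resp option" where
  "exchange s f (x # xs) (y # ys) =
     exchange s (if o_op s x = PUSH then f(x := Some Ack, y := Some (Ret (c_data s (o_cell s x))))
       else f(y := Some Ack, x := Some (Ret (c_data s (o_cell s y))))) xs ys"
| "exchange s f _ _ = f"

lemma exchange_other: "r \<notin> set xs \<union> set ys \<Longrightarrow> exchange s f xs ys r = f r"
  by (induction s f xs ys rule: exchange.induct) (auto split: if_splits)

text \<open>A push followed at once by a pop restores \<open>S\<close>, whatever it is; this is why
  elimination does not touch the central stack.\<close>

lemma lin_pair:
  assumes n: "named N ls s" and L: "linearizing h L S (phase_of N ls f)"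
    and x: "ready N ls s x" "o_op s x = PUSH" "f x = None" and y: "ready N ls s y" "o_op s y = POP"
      "f y = None"
  shows "\<exists>L. linearizing h L S (phase_of N ls (f(x := Some Ack, y := Some (Ret (c_data s (o_cell s
    x))))))"
proof -
  have cx: "l_call (ls (o_id s x)) = Push (the (c_data s (o_cell s x)))" "c_data s (o_cell s x) \<noteq> None"
    using x by (auto simp: ready_def callop_def split: call.splits)
  have cy: "l_call (ls (o_id s y)) = Pop"
    using y by (auto simp: ready_def callop_def split: call.splits)
  obtain L' where L': "linearizing h L' (S @ [the (c_data s (o_cell s x))]) (phase_of N ls (f(x :=
    Some Ack)))"
    using lin_op[OF L n x(1,3)] cx by auto
  have "x \<noteq> y" using x y by auto
  then show ?thesis
    using lin_op[OF L' n y(1)] cx cy y(3) by auto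
qed

lemma lin_exchange:
  assumes n: "named N ls s" and L: "linearizing h L S (phase_of N ls f)" and d: "distinct (xs @ ys)"
    and "\<forall>r\<in>set xs \<union> set ys. ready N ls s r \<and> f r = None"
    and "optype s a xs" "optype s b ys" "a \<noteq> b"
  shows "\<exists>L. linearizing h L S (phase_of N ls (exchange s f xs ys))"
  using assms(2-)
proof (induction xs ys arbitrary: L f rule: list_induct2')
  case (4 x xs y ys)
  let ?f = "if o_op s x = PUSH then f(x := Some Ack, y := Some (Ret (c_data s (o_cell s x))))
       else f(y := Some Ack, x := Some (Ret (c_data s (o_cell s y))))"
  have ty: "o_op s x = a" "o_op s y = b" "optype s a xs" "optype s b ys"
    using "4.prems"(4,5) by (auto simp: optype_def)
  have r: "ready N ls s x" "f x = None" "ready N ls s y" "f y = None" using "4.prems"(3) by auto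
  have "\<exists>L. linearizing h L S (phase_of N ls ?f)"
    using lin_pair[OF n "4.prems"(1), of x y] lin_pair[OF n "4.prems"(1), of y x] r ty \<open>a \<noteq> b\<close>
    by (cases a; cases b) auto
  then obtain L' where "linearizing h L' S (phase_of N ls ?f)" ..
  moreover have "\<forall>r\<in>set xs \<union> set ys. ready N ls s r \<and> ?f r = None" "distinct (xs @ ys)"
    using "4.prems"(2,3) by auto
  ultimately have "\<exists>L. linearizing h L S (phase_of N ls (exchange s ?f xs ys))"
    using "4.IH" ty(3,4) \<open>a \<noteq> b\<close> by blast
  then show ?case by simp
qed auto

lemma exchange_paired:
  assumes "distinct (xs @ ys)" "\<forall>r\<in>set xs \<union> set ys. f r = None" "optype s a xs" "optype s b ys" "a \<noteq> b"
    and "\<forall>r\<in>set xs \<union> set ys. o_op s r = PUSH \<longrightarrow> o_cell s r \<in> c_alloc s"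
    and "\<And>r. r \<in> set xs \<union> set ys \<Longrightarrow> gh_res g r = exchange s f xs ys r"
  shows "paired s g xs ys"
  using assms
proof (induction xs ys arbitrary: f rule: list_induct2')
  case (4 x xs y ys)
  let ?f = "if o_op s x = PUSH then f(x := Some Ack, y := Some (Ret (c_data s (o_cell s x))))
       else f(y := Some Ack, x := Some (Ret (c_data s (o_cell s y))))"
  have ty: "o_op s x = a" "o_op s y = b" "optype s a xs" "optype s b ys"
    using "4.prems"(3,4) by (auto simp: optype_def)
  have res: "gh_res g r = exchange s ?f xs ys r" if "r \<in> insert x (insert y (set xs \<union> set ys))" for r
    using "4.prems"(7)[of r] that unfolding exchange.simps(1) by (simp only: list.set) blast
  \<comment> \<open>By distinctness, the later pairs leave the responses of the first pair
    alone.\<close>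
  have "x \<notin> set xs \<union> set ys" "y \<notin> set xs \<union> set ys" "x \<noteq> y" using "4.prems"(1) by auto
  then have "gh_res g x = ?f x" "gh_res g y = ?f y" using res[of x] res[of y]
    by (simp_all add: exchange_other)
  moreover have "o_op s x = PUSH \<longrightarrow> o_cell s x \<in> c_alloc s" "o_op s y = PUSH \<longrightarrow> o_cell s y \<in> c_alloc s"
    using "4.prems"(6) by auto
  ultimately have "pairok s g x y"
    using ty \<open>a \<noteq> b\<close> \<open>x \<noteq> y\<close> by (cases a; cases b) (auto simp: pairok_def)
  moreover have "paired s g xs ys"
  proof (rule "4.IH")
    show "\<forall>r\<in>set xs \<union> set ys. ?f r = None" using "4.prems"(1,2) by auto
    show "gh_res g r = exchange s ?f xs ys r" if "r \<in> set xs \<union> set ys" for r using res that by simp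
  qed (use "4.prems" ty in auto)
  ultimately show ?case by simp
qed (auto simp: unres_def)

section \<open>Steps that change only the central pointer, \<open>location\<close>, a status and
  ghost state\<close>

text \<open>Two kinds of records concern thread \<open>u\<close>: those that it owns
  (\<open>own\<close>), and its own record (\<open>id\<close>), which another thread may own while
  \<open>u\<close> waits.\<close>

lemma rely_special:
  assumes "o_alloc s' = o_alloc s" "c_alloc s' = c_alloc s" "o_id s' = o_id s" "o_op s' = o_op s"
    "c_data s' = c_data s" "c_next s' = c_next s" "o_cell s' = o_cell s" "o_next s' = o_next s"
    "o_last s' = o_last s" "o_length s' = o_length s"
    "g_location s' u = g_location s u" "gh_q g' u = gh_q g u" "gh_z g' u = gh_z g u"
      "gh_pub g \<subseteq> gh_pub g'"
    and own: "\<And>r. r \<in> o_alloc s \<Longrightarrow> gh_own g r = u \<Longrightarrow> gh_own g' r = u \<and> gh_mode g' r = gh_mode g r \<and>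
      gh_res g' r = gh_res g r \<and> o_status s' r = o_status s r"
    and id: "\<And>r. r \<in> o_alloc s \<Longrightarrow> o_id s r = u \<Longrightarrow> gh_mode g' r = gh_mode g r \<and>
      o_status s' r = o_status s r"
    and res: "\<And>r x. gh_res g r = Some x \<Longrightarrow> gh_res g' r = Some x"
    and fin: "\<And>r. r \<in> o_alloc s \<Longrightarrow> gh_mode g r = MFin \<Longrightarrow> gh_mode g' r = MFin \<and>
      o_status s' r = o_status s r"
  shows "rely u m s g s' g'"
proof -
  have "extends s g s' g'" using assms by (simp add: extends_def)
  moreover have "mono_op r s g s' g'" if "r \<in> o_alloc s" for r
    using assms(1-10) res fin[OF that] by (auto simp: mono_op_def celldone_def)
  moreover have "keeps u r s g s' g'" if "r \<in> o_alloc s" "gh_own g r = u" for r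
    using assms(1-10) own[OF that] by (simp add: keeps_def)
  moreover have "wakes m s g s' g'" if "m \<in> o_alloc s" "o_id s m = u"
    using id[OF that] by (simp add: wakes_def)
  moreover have "gh_mode g r \<noteq> MFin" if "r \<in> o_alloc s" "gh_mode g' r \<noteq> MFin" for r
    using fin[OF that(1)] that(2) by auto
  ultimately show ?thesis using assms(1-13) by (simp add: rely_def)
qed

lemma global_inv_special:
  assumes "o_alloc s' = o_alloc s" "c_alloc s' = c_alloc s" "o_id s' = o_id s" "o_op s' = o_op s"
    "c_data s' = c_data s" "c_next s' = c_next s" "o_cell s' = o_cell s"
      "g_collision s' = g_collision s"
    "gh_pub g' = gh_pub g" "\<And>r. gh_res g' r = None \<Longrightarrow> gh_res g r = None" "global_inv N s g"
  shows "global_inv N s' g'"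
  using assms(11) unfolding global_inv_def assms(1-9) using assms(10) by auto

lemma base_special:
  assumes "base t l s g" "l_mOp l' = l_mOp l" "l_call l' = l_call l"
    "o_alloc s' = o_alloc s" "o_id s' = o_id s" "o_op s' = o_op s" "c_data s' = c_data s"
      "o_cell s' = o_cell s"
    "\<And>r. r \<in> o_alloc s \<Longrightarrow> o_id s r = t \<Longrightarrow> gh_mode g' r \<noteq> MFin \<Longrightarrow> gh_mode g r \<noteq> MFin"
  shows "base t l' s' g'"
proof -
  have "sole t (l_mOp l) s g" using assms(1) by (simp add: base_def)
  then have "sole t (l_mOp l) s' g'" unfolding sole_def assms(4,5) using assms(9) by blast
  then show ?thesis using assms(1-8) by (simp add: base_def callop_def split: call.splits)
qed

lemma pops_null: "set (pops s n null) \<subseteq> {Ret None}"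
  by (induction n) auto

lemma head_ready:
  assumes I: "decs_inv N h ls s g S" and h: "head t l s g" and r: "r \<in> set (gh_q g t)"
  shows "ready N ls s r" "gh_res g r = None" "o_op s r = o_op s (l_mOp l)"
    "gh_own g r = t" "r \<in> o_alloc s" "r \<noteq> null"
proof -
  note h = head_unfold[OF h]
  show *: "gh_own g r = t" "r \<in> o_alloc s" "r \<noteq> null" using owned_mem[OF h(3) r] by simp_all
  have "gh_q g t = l_mOp l # tl (gh_q g t)" using h(1,2) by (metis list.collapse)
  then have "r = l_mOp l \<or> r \<in> set (tl (gh_q g t))" using r by (metis set_ConsD)
  then have "gh_mode g r \<noteq> MFin" using h(9,11) by (auto simp: waits_def)
  then show "ready N ls s r" using inv_ready[OF I] * by blast
  show "gh_res g r = None" "o_op s r = o_op s (l_mOp l)" using h(4,5) r by (auto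
    simp: unres_def optype_def)
qed

lemma mOp_mem: "head t l s g \<Longrightarrow> l_mOp l \<in> set (gh_q g t)"
  using head_unfold(1,2)[of t l s g] hd_in_set[of "gh_q g t"] by simp

text \<open>Common to the linearization steps at the central stack. All records of the list may
  receive responses here, but only the first becomes \<open>MFin\<close>; the others stay
  \<open>MWait\<close> until their status is written.\<close>

lemma inv_linstep:
  assumes I: "decs_inv N h ls s g S" and i: "i \<in> {1..N}" and pc: "live (ls i)" and k: "keep (ls i) l'"
    and h: "head i (ls i) s g" and b: "base i (ls i) s g"
    and s': "o_alloc s' = o_alloc s" "c_alloc s' = c_alloc s" "o_id s' = o_id s" "o_op s' = o_op s"
    "c_data s' = c_data s" "c_next s' = c_next s" "o_cell s' = o_cell s" "o_next s' = o_next s"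
    "o_last s' = o_last s" "o_length s' = o_length s" "g_location s' = g_location s"
      "o_status s' = o_status s"
    and g': "g' = g\<lparr>gh_res := f, gh_mode := (gh_mode g)(l_mOp (ls i) := MFin), gh_pub := P\<rparr>"
      "gh_pub g \<subseteq> P"
    and f: "\<And>r. r \<notin> set (gh_q g i) \<Longrightarrow> f r = gh_res g r"
    and G: "global_inv N s' g'" "stacked s' g' S'" and T: "thread_inv N i l' s' g'"
    and L: "linearizing h L S' (phase_of N ls f)"
  shows "decs_inv N h (ls(i := l')) s' g' S'"
proof (rule inv_step[OF I i T G])
  show "\<exists>L. linearizing h L S' (phase_of N (ls(i := l')) (gh_res g'))"
    using L phase_of_keep[where i = i and ls = ls, OF k] pc g'(1) by (auto simp: live_def)
  fix u
  assume u: "u \<in> {1..N}" "u \<noteq> i"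
  have own: "f r = gh_res g r" "r \<noteq> l_mOp (ls i)" if "gh_own g r = u" for r
    using f[of r] head_ready(4)[OF I h] mOp_mem[OF h] that u by auto
  have mid: "o_id s (l_mOp (ls i)) = i" using b by (rule base_id)
  have "f r = Some x" if "gh_res g r = Some x" for r x
    using f[of r] head_ready(2)[OF I h, of r] that by auto
  then show "rely u (l_mOp (ls u)) s g s' g' \<or> thread_inv N u (ls u) s' g'"
    using own mid u g'(2) by (intro disjI1 rely_special) (auto simp: s' g'(1))
qed

section \<open>Linearization at the central stack\<close>

lemma step_pop_empty:
  assumes I: "decs_inv N h ls s g S" and i: "i \<in> {1..N}" and pc: "l_pc (ls i) = MPop P1"
    and e: "(l', s') \<in> exec_mpop P1 N i (ls i) s" and c: "g_central s = null"
  shows "\<exists>g' S'. decs_inv N h (ls(i := l')) s' g' S'"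
proof -
  have "thread_inv N i (ls i) s g" and G: "global_inv N s g" using I i by (auto simp: decs_inv_def)
  then have b: "base i (ls i) s g" "g_location s i = null" "o_op s (l_mOp (ls i)) = POP"
    and h: "head i (ls i) s g" and par: "l_par (ls i) = l_mOp (ls i)" using pc by auto
  obtain L cs where L: "linearizing h L (rev (cells_data s cs)) (phase_of N ls (gh_res g))"
    and cs: "lseg (c_next s) (g_central s) cs null" "set cs \<subseteq> gh_pub g"
    using I by (auto simp: decs_inv_def stacked_def)
  note hu = head_unfold[OF h]
  let ?q = "gh_q g i"
  let ?f = "assign (gh_res g) ?q (pops s (length ?q) null)"
  let ?g = "g\<lparr>gh_res := ?f, gh_mode := (gh_mode g)(l_mOp (ls i) := MFin), gh_pub := gh_pub g\<rparr>"
  have d: "distinct ?q" using hu(3) by (simp add: owned_def)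
  have "\<forall>r\<in>set ?q. ready N ls s r \<and> o_op s r = POP \<and> gh_res g r = None"
    using head_ready(1,2,3)[OF I h] b(3) by auto
  from lin_pops[OF G inv_named[OF I] L cs d this] obtain L' cs'
    where L': "linearizing h L' (rev (cells_data s cs')) (phase_of N ls ?f)"
    and cs': "lseg (c_next s) null cs' null" "set cs' \<subseteq> gh_pub g" unfolding c by auto
  have f: "?f r = gh_res g r" if "r \<notin> set ?q" for r using that by (rule assign_other)
  have res0: "gh_res g r = None" if "?f r = None" for r
    using f[of r] head_ready(2)[OF I h, of r] that by (cases "r \<in> set ?q") simp_all
  have l: "l' = (ls i)\<lparr>l_top := null, l_pc := MPop P2\<rparr>" "s' = s" using e c by auto
  have "map ?f ?q = map Some (pops s (length ?q) null)" using d by (intro assign_map) simp_all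
  then have "?f r \<in> Some ` set (pops s (length ?q) null)" if "r \<in> set ?q" for r
    using that by (metis image_eqI list.set_map)
  then have res: "\<forall>r\<in>set ?q. ?f r = Some (Ret None)" using pops_null[of s "length ?q"] by blast
  have "decs_inv N h (ls(i := l')) s' ?g (rev (cells_data s cs'))"
  proof (rule inv_linstep[OF I i _ _ h b(1) _ _ _ _ _ _ _ _ _ _ _ _ refl order_refl f _ _ _ L'])
    show "global_inv N s' ?g"
      by (rule global_inv_special[OF _ _ _ _ _ _ _ _ _ _ G])
        (use l(2) res0 in auto)
    show "stacked s' ?g (rev (cells_data s cs'))"
      using cs' c l(2) by (auto simp: stacked_def)
    have "pnone i l' s ?g" using hu b(3) res l(1) par by (simp add: pnone_def owned_def optype_def)
    moreover have "base i l' s' ?g" by (rule base_special[OF b(1)]) (auto simp: l split: if_splits)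
    ultimately show "thread_inv N i l' s' ?g" using l b(2,3) par by simp
  qed (use l pc in \<open>auto simp: live_def keep_def\<close>)
  then show ?thesis by blast
qed

text \<open>\<open>l_nTop\<close> may have been computed long before the CAS, but along published
  cells it is a function of \<open>l_top\<close> and the length of the list. So it is the correct
  new top whenever \<open>l_top\<close> is the current one.\<close>

lemma step_pop:
  assumes I: "decs_inv N h ls s g S" and i: "i \<in> {1..N}" and pc: "l_pc (ls i) = MPop P8"
    and e: "(l', s') \<in> exec_mpop P8 N i (ls i) s" and c: "g_central s = l_top (ls i)"
  shows "\<exists>g' S'. decs_inv N h (ls(i := l')) s' g' S'"
proof -
  have "thread_inv N i (ls i) s g" and G: "global_inv N s g" using I i by (auto simp: decs_inv_def)
  then have b: "base i (ls i) s g" "g_location s i = null" "o_op s (l_mOp (ls i)) = POP"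
    and h: "head i (ls i) s g" and par: "l_par (ls i) = l_mOp (ls i)"
    and top: "l_top (ls i) \<in> gh_pub g" "l_nTop (ls i) = adv (c_next s) (length (gh_q g i)) (l_top
      (ls i))"
    using pc by auto
  obtain L cs where L: "linearizing h L (rev (cells_data s cs)) (phase_of N ls (gh_res g))"
    and cs: "lseg (c_next s) (l_top (ls i)) cs null" "set cs \<subseteq> gh_pub g"
    using I c by (auto simp: decs_inv_def stacked_def)
  note hu = head_unfold[OF h]
  let ?q = "gh_q g i"
  let ?f = "assign (gh_res g) ?q (pops s (length ?q) (l_top (ls i)))"
  let ?g = "g\<lparr>gh_res := ?f, gh_mode := (gh_mode g)(l_mOp (ls i) := MFin), gh_pub := gh_pub g\<rparr>"
  have d: "distinct ?q" using hu(3) by (simp add: owned_def)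
  have "\<forall>r\<in>set ?q. ready N ls s r \<and> o_op s r = POP \<and> gh_res g r = None"
    using head_ready(1,2,3)[OF I h] b(3) by auto
  from lin_pops[OF G inv_named[OF I] L cs d this] obtain L' cs'
    where L': "linearizing h L' (rev (cells_data s cs')) (phase_of N ls ?f)"
    and cs': "lseg (c_next s) (l_nTop (ls i)) cs' null" "set cs' \<subseteq> gh_pub g" unfolding top(2) by auto
  have f: "?f r = gh_res g r" if "r \<notin> set ?q" for r using that by (rule assign_other)
  have res0: "gh_res g r = None" if "?f r = None" for r
    using f[of r] head_ready(2)[OF I h, of r] that by (cases "r \<in> set ?q") simp_all
  have l: "l' = (ls i)\<lparr>l_pc := MPop P9\<rparr>" "s' = s\<lparr>g_central := l_nTop (ls i)\<rparr>" using e c by auto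
  have "map ?f ?q = map Some (pops s (length ?q) (l_top (ls i)))" using d by (intro assign_map) simp_all
  then have ps: "psupply s ?g ?q (l_top (ls i))" using top by (simp add: psupply_def)
  have "decs_inv N h (ls(i := l')) s' ?g (rev (cells_data s cs'))"
  proof (rule inv_linstep[OF I i _ _ h b(1) _ _ _ _ _ _ _ _ _ _ _ _ refl order_refl f _ _ _ L'])
    show "global_inv N s' ?g"
      by (rule global_inv_special[OF _ _ _ _ _ _ _ _ _ _ G])
        (use l(2) res0 in auto)
    show "stacked s' ?g (rev (cells_data s cs'))"
      using cs' l(2) by (auto simp: stacked_def)
    have "mfin i l' s' ?g" using hu b(3) l par by (simp add: mfin_def owned_def optype_def)
    moreover have "base i l' s' ?g" by (rule base_special[OF b(1)]) (auto simp: l split: if_splits)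
    ultimately show "thread_inv N i l' s' ?g" using l b(2,3) top(1) ps by simp
  qed (use l pc in \<open>auto simp: live_def keep_def\<close>)
  then show ?thesis by blast
qed

lemma linked_lseg:
  "linked s xs \<Longrightarrow> xs \<noteq> [] \<Longrightarrow> lseg (c_next s) (c_next s (o_cell s (last xs))) cs b \<Longrightarrow>
    lseg (c_next s) (o_cell s (hd xs)) (map (o_cell s) xs @ cs) b"
  by (induction xs rule: induct_list012) auto

lemma lseg_closed: "lseg nx a xs b \<Longrightarrow> x \<in> set xs \<Longrightarrow> nx x \<in> set xs \<or> nx x = b"
proof (induction xs arbitrary: a)
  case (Cons y ys)
  then show ?case by (cases ys) auto
qed simp

text \<open>The cells of the list become published. The delicate parts of \<open>global_inv\<close>
  are that the published cells remain closed under \<open>next\<close> and that no unlinearized push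
  owns one of them.\<close>

lemma step_push:
  assumes I: "decs_inv N h ls s g S" and i: "i \<in> {1..N}" and pc: "l_pc (ls i) = MPush U6"
    and e: "(l', s') \<in> exec_mpush U6 N i (ls i) s" and c: "g_central s = l_top (ls i)"
  shows "\<exists>g' S'. decs_inv N h (ls(i := l')) s' g' S'"
proof -
  have "thread_inv N i (ls i) s g" and G: "global_inv N s g" using I i by (auto simp: decs_inv_def)
  then have b: "base i (ls i) s g" "g_location s i = null" "o_op s (l_mOp (ls i)) = PUSH"
    and h: "head i (ls i) s g" and par: "l_par (ls i) = l_mOp (ls i)"
    and top: "c_next s (o_cell s (last (gh_q g i))) = l_top (ls i)"
      "l_cp (ls i) = o_cell s (l_mOp (ls i))"
    using pc by auto
  obtain L cs where L: "linearizing h L (rev (cells_data s cs)) (phase_of N ls (gh_res g))"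
    and cs: "lseg (c_next s) (l_top (ls i)) cs null" "set cs \<subseteq> gh_pub g"
    using I c by (auto simp: decs_inv_def stacked_def)
  note hu = head_unfold[OF h]
  let ?q = "gh_q g i"
  let ?f = "\<lambda>r. if r \<in> set ?q then Some Ack else gh_res g r"
  let ?P = "gh_pub g \<union> o_cell s ` set ?q"
  let ?g = "g\<lparr>gh_res := ?f, gh_mode := (gh_mode g)(l_mOp (ls i) := MFin), gh_pub := ?P\<rparr>"
  let ?cs = "map (o_cell s) ?q @ cs"
  have d: "distinct ?q" using hu(3) by (simp add: owned_def)
  have ready: "\<forall>r\<in>set ?q. ready N ls s r \<and> o_op s r = PUSH \<and> gh_res g r = None"
    using head_ready(1,2,3)[OF I h] b(3) by auto
  from lin_pushes[OF inv_named[OF I] L d this] obtain L'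
    where L': "linearizing h L' (rev (cells_data s ?cs)) (phase_of N ls ?f)" by auto
  have l: "l' = (ls i)\<lparr>l_pc := MPush U7\<rparr>" "s' = s\<lparr>g_central := o_cell s (l_mOp (ls i))\<rparr>"
    using e c top by auto
  have ls: "lseg (c_next s) (o_cell s (l_mOp (ls i))) ?cs null"
    using linked_lseg[OF hu(8)[OF b(3)] hu(1), of cs null] cs top hu(2) by simp
  have cell: "o_cell s r \<in> c_alloc s" "o_cell s r \<noteq> null" "c_data s (o_cell s r) \<noteq> None"
    if "r \<in> set ?q" for r
    using G ready head_ready(5,6)[OF I h] that by (auto simp: global_inv_def)
  have P: "set ?cs \<subseteq> ?P" using cs by auto
  have closed: "c_next s x = null \<or> c_next s x \<in> ?P" if "x \<in> ?P" for x
  proof (cases "x \<in> gh_pub g")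
    case True
    then show ?thesis using G by (auto simp: global_inv_def)
  next
    case False
    \<comment> \<open>A new cell lies on the chain from the new top to \<open>null\<close>, hence so
      does its successor unless it is \<open>null\<close>.\<close>
    then have "x \<in> set ?cs" using that by auto
    then show ?thesis using lseg_closed[OF ls] P by blast
  qed
  have fresh: "o_cell s r \<notin> ?P" if r: "r \<in> o_alloc s" "r \<noteq> null" "o_op s r = PUSH" "?f r = None" for r
  proof -
    have nq: "r \<notin> set ?q" "gh_res g r = None" using r(4) by (auto split: if_splits)
    then have "o_cell s r \<notin> gh_pub g" using G r by (auto simp: global_inv_def)
    moreover have "o_cell s r \<notin> o_cell s ` set ?q"
    proof
      assume "o_cell s r \<in> o_cell s ` set ?q"
      then obtain r' where "r' \<in> set ?q" "o_cell s r = o_cell s r'" by auto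
      then have "r = r'" using cells_inj[OF G] r ready head_ready(5,6)[OF I h, of r']
        by (auto dest!: inj_onD)
      then show False using nq \<open>r' \<in> set ?q\<close> by simp
    qed
    ultimately show ?thesis by simp
  qed
  have "decs_inv N h (ls(i := l')) s' ?g (rev (cells_data s ?cs))"
  proof (rule inv_linstep[OF I i _ _ h b(1) _ _ _ _ _ _ _ _ _ _ _ _ refl _ _ _ _ _ L'])
    have "null \<notin> o_cell s ` set ?q" using cell(2) by (metis imageE)
    moreover have "\<forall>x\<in>o_cell s ` set ?q. c_data s x \<noteq> None \<and> x \<in> c_alloc s" using cell(1,3) by blast
    moreover have "gh_pub g \<subseteq> c_alloc s" "null \<notin> gh_pub g" "\<forall>x\<in>gh_pub g. c_data s x \<noteq> None"
      using G by (simp_all add: global_inv_def)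
    ultimately have "?P \<subseteq> c_alloc s" "null \<notin> ?P" "\<forall>x\<in>?P. c_data s x \<noteq> None" by blast+
    then show "global_inv N s' ?g"
      using G closed fresh l(2) by (simp add: global_inv_def)
    show "stacked s' ?g (rev (cells_data s ?cs))"
      using ls P l(2) unfolding stacked_def by (intro exI[of _ ?cs]) simp
    have "mfin i l' s' ?g" using hu b(3) l par by (simp add: mfin_def owned_def optype_def)
    then have "ufin i l' s' ?g" by (simp add: ufin_def)
    moreover have "base i l' s' ?g" by (rule base_special[OF b(1)]) (auto simp: l split: if_splits)
    ultimately show "thread_inv N i l' s' ?g" using l b(2,3) by simp
  qed (use l pc in \<open>auto simp: live_def keep_def\<close>)
  then show ?thesis by blast
qed

section \<open>Transfer of records between threads\<close>

text \<open>What the CAS at A2 reveals about the other thread. Outside collide and passiveCollide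
  its \<open>location\<close> is \<open>null\<close>, and once it is captured the entry is a foreign
  record; its own record is found there only while it is exposed.\<close>

lemma thread_inv_captured:
  assumes T: "thread_inv N t l s g" and x: "g_location s t = x" "x \<noteq> null" "o_id s x = t"
  obtains c where "l_pc l = Col c" "c \<noteq> C1" "l_mOp l = x" "head t l s g" "base t l s g"
proof -
  have nc: "\<not> capt t l s g x" using x(3) by (simp add: capt_def)
  have "\<exists>c. l_pc l = Col c \<and> c \<noteq> C1 \<and> base t l s g \<and> colp t l s g"
  proof (cases "l_pc l")
    case (Col c)
    then show ?thesis using T x by (cases c) auto
  next
    case (Pas c)
    then show ?thesis using T x nc by (cases c) auto
  qed (use T x in \<open>auto simp: quiet_def\<close>)
  then obtain c where c: "l_pc l = Col c" "c \<noteq> C1" "base t l s g" "colp t l s g" by blast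
  then have "l_mOp l = x" "head t l s g" using nc x(1) by (auto simp: colp_def)
  then show ?thesis using that c by blast
qed

lemma thread_inv_col_update:
  assumes "thread_inv N t l s g" "l_pc l = Col c" "c \<noteq> C1" "base t l s' g'" "colp t l s' g'"
    "o_alloc s' = o_alloc s" "o_id s' = o_id s"
  shows "thread_inv N t l s' g'"
  using assms by (cases c) auto

text \<open>Mode \<open>MWait\<close> refutes every assertion that claims \<open>MHead\<close> or
  \<open>MFin\<close>. The thread is therefore in passiveCollide, or still in collide and unaware of
  its capture.\<close>

lemma thread_inv_wait_update:
  assumes T: "thread_inv N t l s g" and m: "gh_mode g (l_mOp l) = MWait"
    and b: "base t l s' g'" and w: "waiting t l s' g'"
    and eq: "g_location s' = g_location s" "o_alloc s' = o_alloc s" "o_id s' = o_id s"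
      "o_op s' = o_op s"
    and live: "live l"
  shows "thread_inv N t l s' g'"
proof -
  have nh: "\<not> head t l s g" "\<not> leads t l s g" using m by (auto simp: head_def leads_def)
  have ne: "\<not> elimd l s g a" for a using m by (simp add: elimd_def)
  have capt: "capt t l s' g' a" if "capt t l s g a" for a
    using that ne w by (auto simp: capt_def eq split: if_splits)
  have colp: "colp t l s' g'" if "colp t l s g"
    using that nh capt eq by (auto simp: colp_def)
  have mo: "\<not> mfin t l s g" "\<not> pnone t l s g" "\<not> ufin t l s g" "\<not> elimbase t l s g"
      "\<not> elimfull t l s g a d" "\<not> elim13 t l s g" "\<not> rest t l s g xs x" "\<not> comb0 t l s g"
        "\<not> comb1 t l s g"
      "\<not> act3 t l s g" for a d xs x
    using m by (auto simp: mfin_def pnone_def ufin_def elimbase_def elimfull_def elim13_def rest_def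
      comb0_def
        comb1_def act3_def head_def leads_def split: if_splits)
  show ?thesis
  proof (cases "l_pc l")
    case (MPop p)
    then show ?thesis using T nh mo by (cases p) auto
  next
    case (MPush p)
    then show ?thesis using T nh mo by (cases p) auto
  next
    case (Col p)
    then show ?thesis using T colp nh b eq by (cases p) auto
  next
    case (Act p)
    then show ?thesis using T nh mo by (cases p) auto
  next
    case (Pas p)
    have "o_status s (l_mOp l) = INIT" if "waiting t l s g" using that m nh by (auto simp: waiting_def)
    then show ?thesis using Pas T capt ne nh b eq w by (cases p) auto
  next
    case (Comb p)
    then show ?thesis using T mo by (cases p) auto
  next
    case (Elim p)
    then show ?thesis using T mo by (cases p) auto
  qed (use T m live in \<open>auto simp: live_def\<close>)
qed

text \<open>Ownership of the whole remainder passes to the thread of its first record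
  \<open>x\<close>, which turns from a waiting record into a head. That thread may still be at any
  point after the capture, hence the use of \<open>thread_inv_wait_update\<close>.\<close>

lemma step_retry:
  assumes I: "decs_inv N h ls s g S" and i: "i \<in> {1..N}" and pc: "live (ls i)"
    and b: "base i (ls i) s g" "g_location s i = null"
    and r: "rest i (ls i) s g xs x" and len: "o_length s x = int (length xs)"
      and la: "o_last s x = last xs"
  shows "\<exists>g' S'. decs_inv N h (ls(i := finish (ls i))) (s\<lparr>o_status := (o_status s)(x := RETRY)\<rparr>) g' S'"
proof -
  let ?p = "o_id s x" and ?s = "s\<lparr>o_status := (o_status s)(x := RETRY)\<rparr>"
  let ?g = "g\<lparr>gh_own := (\<lambda>r. if r \<in> set xs then ?p else gh_own g r), gh_mode := (gh_mode g)(x := MHead),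
    gh_q := (gh_q g)(?p := xs)\<rparr>"
  have xs: "xs \<noteq> []" "owned i s g xs" "hd xs = x" "waits g xs" "gh_mode g (l_mOp (ls i)) = MFin"
    "plist i s g xs"
    "finok s g (l_mOp (ls i))"
    using r by (auto simp: rest_def plist_def)
  have x: "x \<in> set xs" "x \<in> o_alloc s" "x \<noteq> null" "gh_mode g x = MWait" "x \<noteq> l_mOp (ls i)"
    using xs owned_hd[OF xs(2,1)] rest_hd(2,3)[OF r] by auto
  have rd: "?p \<in> {1..N}" "live (ls ?p)" "l_mOp (ls ?p) = x"
    using inv_ready[OF I x(2,3)] x(4) by (auto simp: ready_def)
  \<comment> \<open>A thread has only one current record, and that of \<open>i\<close> is not
    \<open>x\<close>.\<close>
  have p: "?p \<noteq> i" using rd(3) x(5) by metis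
  have G: "global_inv N s g" "stacked s g S" and L: "\<exists>L. linearizing h L S (phase_of N ls (gh_res g))"
    and T: "thread_inv N ?p (ls ?p) s g"
    using I rd(1) by (auto simp: decs_inv_def)
  have bp: "base ?p (ls ?p) s g" using T rd(2) by (rule thread_inv_base)
  have "decs_inv N h (ls(i := finish (ls i))) ?s ?g S"
  proof (rule inv_step[OF I i])
    show "thread_inv N i (finish (ls i)) ?s ?g"
    proof (rule thread_inv_finish)
      show "base i (ls i) ?s ?g" by (rule base_special[OF b(1)]) (use p in \<open>auto split: if_splits\<close>)
      show "finok ?s ?g (l_mOp (ls i))" using xs(7) by (auto simp: finok_def celldone_def split:
        if_splits)
    qed (use b(2) xs(5) x(5) in simp_all)
    show "global_inv N ?s ?g" by (rule global_inv_special[OF _ _ _ _ _ _ _ _ _ _ G(1)]) simp_all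
    show "stacked ?s ?g S" using G(2) by (simp add: stacked_def)
    show "\<exists>L. linearizing h L S (phase_of N (ls(i := finish (ls i))) (gh_res ?g))"
      using L phase_of_keep[where i = i and ls = ls, OF keep_finish] pc by (auto simp: live_def)
    fix u
    assume u: "u \<in> {1..N}" "u \<noteq> i"
    show "rely u (l_mOp (ls u)) s g ?s ?g \<or> thread_inv N u (ls u) ?s ?g"
    proof (cases "u = ?p")
      case True
      have pl: "plist ?p ?s ?g xs"
      proof -
        have "owned ?p ?s ?g xs" using xs(2) by (auto simp: owned_def)
        moreover have "x \<notin> set (tl xs)" using xs(1,2,3) by (cases xs) (auto simp: owned_def)
        then have "waits ?g (tl xs)" using xs(6) by (auto simp: waits_def plist_def)
        ultimately show ?thesis using xs(6) by (simp add: plist_def unres_def)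
      qed
      have "thread_inv N ?p (ls ?p) ?s ?g"
      proof (rule thread_inv_wait_update[OF T _ _ _ _ _ _ _ rd(2)])
        show "gh_mode g (l_mOp (ls ?p)) = MWait" using rd(3) x(4) by simp
        show "base ?p (ls ?p) ?s ?g" by (rule base_special[OF bp]) (use x(4) in \<open>auto split: if_splits\<close>)
        have "leads ?p (ls ?p) ?s ?g" using rd(3) xs(3) by (simp add: leads_def)
        moreover have "hlist ?p ?s ?g xs" using pl len la xs(3) by (simp add: hlist_def)
        ultimately show "waiting ?p (ls ?p) ?s ?g" using rd(3) by (simp add: waiting_def)
      qed simp_all
      then show ?thesis using True by simp
    next
      case False
      have "r \<notin> set xs" if "gh_own g r = u" for r using owned_mem[OF xs(2)] that u by auto
      then show ?thesis using False u x(1,4) p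
        by (intro disjI1 rely_special) auto
    qed
  qed
  then show ?thesis by blast
qed

text \<open>The list of the victim becomes \<open>gh_z\<close> of the active thread. With equal
  types nothing takes effect and the victim begins to wait. With opposite types both leading records
  become \<open>MFin\<close> at once, because neither of their threads will wait for a
  status.\<close>

lemma step_capture:
  assumes I: "decs_inv N h ls s g S" and i: "i \<in> {1..N}" and pc: "l_pc (ls i) = Act A2"
    and e: "(l', s') \<in> exec_act A2 N i (ls i) s" and c: "g_location s (l_id (ls i)) = l_pInf (ls i)"
  shows "\<exists>g' S'. decs_inv N h (ls(i := l')) s' g' S'"
proof -
  let ?l = "ls i" and ?y = "l_pInf (ls i)" and ?x = "l_mOp (ls i)"
  let ?p = "o_id s ?y"
  have "thread_inv N i ?l s g" and G: "global_inv N s g" "stacked s g S"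
    and L: "\<exists>L. linearizing h L S (phase_of N ls (gh_res g))"
    using I i by (auto simp: decs_inv_def)
  then have b: "base i ?l s g" "g_location s i = null" and h: "head i ?l s g" and a: "l_aInf ?l = ?x"
    and y: "?y \<in> o_alloc s" "?y \<noteq> null" "?p \<noteq> i" "?p \<in> {1..N}" "l_id ?l = ?p"
    using pc by auto
  have T: "thread_inv N ?p (ls ?p) s g" using I y(4) by (auto simp: decs_inv_def)
  \<comment> \<open>The CAS has found \<open>?y\<close> in the entry of its own thread, so that
    thread is exposed and controls the list headed by \<open>?y\<close>.\<close>
  obtain d where d: "l_pc (ls ?p) = Col d" "d \<noteq> C1" "l_mOp (ls ?p) = ?y" "head ?p (ls ?p) s g"
    "base ?p (ls ?p) s g"
    by (rule thread_inv_captured[OF T _ y(2)]) (use c y(5) in auto)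
  let ?Q = "gh_q g i" and ?R = "gh_q g ?p"
  note hq = head_unfold[OF h] and hr = head_unfold[OF d(4)]
  have own: "gh_own g r = i" if "r \<in> set ?Q" for r using owned_mem[OF hq(3) that] by simp
  have ownR: "gh_own g r = ?p" if "r \<in> set ?R" for r using owned_mem[OF hr(3) that] by simp
  have disj: "set ?Q \<inter> set ?R = {}" using own ownR y(3) by (metis disjoint_iff)
  have xq: "?x \<in> set ?Q" using mOp_mem[OF h] .
  have yr: "?y \<in> set ?R" using mOp_mem[OF d(4)] d(3) by simp
  have xy: "?x \<noteq> ?y" using xq yr disj by auto
  have xa: "?x \<in> o_alloc s" "?x \<noteq> null" "o_id s ?x = i" using b(1) by (auto simp: base_def)
  have l: "l' = goto (Act A3) ?l" "s' = s\<lparr>g_location := (g_location s)(?p := ?x)\<rparr>"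
    using e c y(5) a by auto
  let ?own = "\<lambda>r. if r \<in> set ?R then i else gh_own g r"
  have k: "phase_of N (ls(i := l')) f = phase_of N ls f" for f
    using pc l by (intro phase_of_keep) (auto simp: keep_def)
  show ?thesis
  proof (cases "o_op s ?x = o_op s ?y")
    case True
    let ?g = "g\<lparr>gh_own := ?own, gh_mode := (gh_mode g)(?y := MWait), gh_z := (gh_z g)(i := ?R)\<rparr>"
    have w: "waits ?g zs" if "waits g zs" for zs using that by (auto simp: waits_def)
    have "decs_inv N h (ls(i := l')) s' ?g S"
    proof (rule inv_step[OF I i])
      have "owned i s' ?g ?Q" "owned i s' ?g ?R" using hq(3) hr(3) l(2) by (auto simp: owned_def)
      then have "plist i s' ?g ?Q" "plist i s' ?g ?R"
        using hq hr w[OF hq(9)] w[OF hr(9)] l(2) d(3) by (simp_all add: plist_def unres_def)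
      then have "hlist i s' ?g ?Q" "hlist i s' ?g ?R"
        using hq hr l(2) d(3) by (simp_all add: hlist_def)
      then have "comb0 i l' s' ?g"
        using l hq hr d(3) a True disj xy by (simp add: comb0_def head_def leads_def)
      then have "act3 i l' s' ?g" using l True by (simp add: act3_def)
      moreover have "base i l' s' ?g" by (rule base_special[OF b(1)]) (use l y(3) in \<open>auto split:
        if_splits\<close>)
      ultimately show "thread_inv N i l' s' ?g" using l b(2) y(3) by simp
      show "global_inv N s' ?g" by (rule global_inv_special[OF _ _ _ _ _ _ _ _ _ _ G(1)]) (simp_all
        add: l)
      show "stacked s' ?g S" using G(2) l by (simp add: stacked_def)
      show "\<exists>L. linearizing h L S (phase_of N (ls(i := l')) (gh_res ?g))" using L k by simp
      fix u
      assume u: "u \<in> {1..N}" "u \<noteq> i"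
      show "rely u (l_mOp (ls u)) s g s' ?g \<or> thread_inv N u (ls u) s' ?g"
      proof (cases "u = ?p")
        case True
        have "thread_inv N ?p (ls ?p) s' ?g"
        proof (rule thread_inv_col_update[OF T d(1,2)])
          show "base ?p (ls ?p) s' ?g"
            by (rule base_special[OF d(5)]) (use l hr(11) d(3) in \<open>auto split: if_splits\<close>)
          have "waiting ?p (ls ?p) s' ?g" using hr(12) d(3) l by (simp add: waiting_def)
          then have "capt ?p (ls ?p) s' ?g ?x"
            using xa y(3) l d(3) \<open>o_op s ?x = o_op s ?y\<close> by (simp add: capt_def)
          then show "colp ?p (ls ?p) s' ?g" using l by (simp add: colp_def)
        qed (simp_all add: l)
        then show ?thesis using True by simp
      next
        case False
        then show ?thesis using u ownR own xq yr hr(11) d(3) l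
          by (intro disjI1 rely_special) auto
      qed
    qed
    then show ?thesis by blast
  next
    case False
    let ?f = "exchange s (gh_res g) ?Q ?R"
    let ?g = "g\<lparr>gh_own := ?own, gh_mode := (gh_mode g)(?x := MFin, ?y := MFin), gh_res := ?f,
      gh_z := (gh_z g)(i := ?R)\<rparr>"
    have tyq: "optype s (o_op s ?x) ?Q" and tyr: "optype s (o_op s ?y) ?R" using hq(4) hr(4) d(3)
      by simp_all
    have dist: "distinct (?Q @ ?R)" using hq(3) hr(3) disj by (auto simp: owned_def)
    have none: "gh_res g r = None" "ready N ls s r" if "r \<in> set ?Q \<union> set ?R" for r
      using that head_ready(1,2)[OF I h] head_ready(1,2)[OF I d(4)] by auto
    have f: "?f r = gh_res g r" if "r \<notin> set ?Q \<union> set ?R" for r using that by (rule exchange_other)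
    have cell: "\<forall>r\<in>set ?Q \<union> set ?R. o_op s r = PUSH \<longrightarrow> o_cell s r \<in> c_alloc s"
      using G(1) owned_mem[OF hq(3)] owned_mem[OF hr(3)] by (auto simp: global_inv_def)
    have "paired s ?g ?Q ?R"
      by (rule exchange_paired[OF dist _ tyq tyr False cell, of "gh_res g"]) (use none in auto)
    then have pa: "paired s' ?g ?Q ?R" using l by simp
    obtain Q' where Q': "?Q = ?x # Q'" using hq(1,2) by (metis list.collapse)
    obtain R' where R': "?R = ?y # R'" using hr(1,2) d(3) by (metis list.collapse)
    have "pairok s' ?g ?x ?y" using pa unfolding Q' R' by (simp only: paired.simps)
    then have pok: "pairok s ?g ?x ?y" using l by simp
    obtain L0 where "linearizing h L0 S (phase_of N ls (gh_res g))" using L ..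
    from lin_exchange[OF inv_named[OF I] this dist _ tyq tyr False] none
    have L': "\<exists>L. linearizing h L S (phase_of N ls ?f)" by blast
    have mono: "?f r = Some v" if "gh_res g r = Some v" for r v
      using f[of r] none(1)[of r] that by (cases "r \<in> set ?Q \<union> set ?R") auto
    have tlw: "waits ?g (tl ?Q)" "waits ?g (tl ?R)"
    proof -
      have "?x \<notin> set (tl ?Q)" "?y \<notin> set (tl ?Q)" "?x \<notin> set (tl ?R)" "?y \<notin> set (tl ?R)"
        using dist unfolding Q' R' by auto
      then show "waits ?g (tl ?Q)" "waits ?g (tl ?R)" using hq(9) hr(9) by (auto simp: waits_def)
    qed
    have "decs_inv N h (ls(i := l')) s' ?g S"
    proof (rule inv_step[OF I i])
      have ow: "owned i s' ?g (?Q @ ?R)" using hq(3) hr(3) l(2) disj by (auto simp: owned_def)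
      \<comment> \<open>The assignments made by A4 are anticipated, as in
        \<open>act3\<close>.\<close>
      let ?l2 = "l'\<lparr>l_aCurr := l_aInf l', l_pCurr := l_pInf l'\<rparr>"
      have eb: "elimbase i ?l2 s' ?g"
        using l a y(1,2) xy False own[OF xq] yr by (simp add: elimbase_def)
      have el: "elimlists i ?l2 s' ?g ?Q ?R"
        using ow tyq tyr hq(1,2,6,8,10) hr(1,2,6,8,10) l a d(3) tlw False
        by (auto simp: elimlists_def)
      have "elimfull i ?l2 s' ?g 0 0"
        using eb el pa hq(1,7) hr(1,7) l d(3) y(3) by (simp add: elimfull_def)
      then have "act3 i l' s' ?g" using l False a by (simp add: act3_def)
      moreover have "base i l' s' ?g" by (rule base_special[OF b(1)]) (use l in \<open>auto split: if_splits\<close>)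
      ultimately show "thread_inv N i l' s' ?g" using l b(2) y(3) by simp
      show "global_inv N s' ?g"
      proof (rule global_inv_special[OF _ _ _ _ _ _ _ _ _ _ G(1)])
        show "gh_res g r = None" if "gh_res ?g r = None" for r
          using mono[of r] that by (cases "gh_res g r") auto
      qed (simp_all add: l)
      show "stacked s' ?g S" using G(2) l by (simp add: stacked_def)
      show "\<exists>L. linearizing h L S (phase_of N (ls(i := l')) (gh_res ?g))" using L' k by simp
      fix u
      assume u: "u \<in> {1..N}" "u \<noteq> i"
      show "rely u (l_mOp (ls u)) s g s' ?g \<or> thread_inv N u (ls u) s' ?g"
      proof (cases "u = ?p")
        case True
        have "thread_inv N ?p (ls ?p) s' ?g"
        proof (rule thread_inv_col_update[OF T d(1,2)])
          show "base ?p (ls ?p) s' ?g"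
            by (rule base_special[OF d(5)]) (use l in \<open>auto split: if_splits\<close>)
          \<comment> \<open>The passive thread sees only the two leading records, so the first pair
            of the matched lists is enough.\<close>
          have "elimd (ls ?p) s' ?g ?x" using d(3) l False pok by (auto simp: elimd_def pairok_def
            split: if_splits)
          then have "capt ?p (ls ?p) s' ?g ?x"
            using xa y(3) l d(3) False by (simp add: capt_def)
          then show "colp ?p (ls ?p) s' ?g" using l by (simp add: colp_def)
        qed (simp_all add: l)
        then show ?thesis using True by simp
      next
        case False
        have "r \<notin> set ?Q \<union> set ?R" if "gh_own g r = u" for r using that own ownR False u by auto
        then have *: "r \<notin> set ?Q \<union> set ?R" "r \<noteq> ?x" "r \<noteq> ?y" "?f r = gh_res g r" if "gh_own g r = u"
          for r
          using that xq yr f by blast+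
        have "rely u (l_mOp (ls u)) s g s' ?g"
        proof (rule rely_special)
          show "gh_own ?g r = u \<and> gh_mode ?g r = gh_mode g r \<and> gh_res ?g r = gh_res g r \<and>
            o_status s' r = o_status s r"
            if "gh_own g r = u" for r
            using *[OF that] l that by simp
          show "gh_res ?g r = Some v" if "gh_res g r = Some v" for r v using mono that by simp
        qed (use False u xa(3) l in auto)
        then show ?thesis ..
      qed
    qed
    then show ?thesis by blast
  qed
qed

section \<open>Allocation of a record\<close>

text \<open>The fresh record bears the identifier of \<open>i\<close>, so no other thread acquires a
  second unfinished record.\<close>

lemma rely_new:
  assumes G: "global_inv N s g" and r: "r \<notin> o_alloc s" and u: "u \<noteq> i"
    and c: "c_alloc s \<subseteq> c_alloc s'" "\<And>c. c \<in> c_alloc s \<Longrightarrow> c_data s' c = c_data s c \<and>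
      c_next s' c = c_next s c"
    and o: "o_alloc s' = insert r (o_alloc s)" "o_id s' r = i"
      "\<And>r'. r' \<in> o_alloc s \<Longrightarrow> o_id s' r' = o_id s r' \<and> o_op s' r' = o_op s r' \<and>
        o_length s' r' = o_length s r' \<and>
         o_status s' r' = o_status s r' \<and> o_cell s' r' = o_cell s r' \<and> o_next s' r' = o_next s r' \<and>
         o_last s' r' = o_last s r'"
    and "g_location s' = g_location s"
    and g': "g' = g\<lparr>gh_own := (gh_own g)(r := i), gh_mode := (gh_mode g)(r := MHead),
      gh_res := (gh_res g)(r := None), gh_q := (gh_q g)(i := [r])\<rparr>"
  shows "rely u m s g s' g'"
proof -
  have ne: "r' \<noteq> r" if "r' \<in> o_alloc s" for r' using that r by auto
  have cell: "celldone s' g' r'" if "r' \<in> o_alloc s" "celldone s g r'" for r'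
    using that c o(3)[OF that(1)] ne[OF that(1)] by (auto simp: celldone_def g')
  have "extends s g s' g'" using c o G by (auto simp: extends_def g' global_inv_def)
  moreover have "mono_op r' s g s' g'" if "r' \<in> o_alloc s" for r'
    using o(3)[OF that] ne[OF that] cell[OF that] by (auto simp: mono_op_def g')
  moreover have "keeps u r' s g s' g'" if "r' \<in> o_alloc s" "gh_own g r' = u" for r'
  proof -
    have "c_next s' (o_cell s r') = c_next s (o_cell s r')" if "r' \<noteq> null" "o_op s r' = PUSH"
      using G c(2) that \<open>r' \<in> o_alloc s\<close> by (auto simp: global_inv_def)
    then show ?thesis using o(3)[OF that(1)] ne[OF that(1)] that by (simp add: keeps_def g')
  qed
  moreover have "wakes m s g s' g'" if "m \<in> o_alloc s"
    using o(3)[OF that] ne[OF that] by (simp add: wakes_def g')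
  moreover have "r' \<in> o_alloc s \<and> gh_mode g r' \<noteq> MFin" if "r' \<in> o_alloc s'" "gh_mode g' r' \<noteq> MFin"
    "o_id s' r' = u" for r'
    using that o(1,2) u by (auto simp: g' split: if_splits)
  ultimately show ?thesis using assms(9) u by (simp add: rely_def g')
qed

text \<open>Nothing is known about the ghost response of an unallocated record, so it is reset here;
  no live thread refers to it.\<close>

lemma phase_of_new:
  assumes I: "decs_inv N h ls s g S" and r: "r \<notin> o_alloc s"
    and pc: "l_pc (ls i) = Start" and l': "live l'" "l_call l' = l_call (ls i)" "l_mOp l' = r"
  shows "phase_of N (ls(i := l')) ((gh_res g)(r := None)) = phase_of N ls (gh_res g)"
proof
  fix u
  show "phase_of N (ls(i := l')) ((gh_res g)(r := None)) u = phase_of N ls (gh_res g) u"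
  proof (cases "u = i")
    case True
    then show ?thesis using pc l' by (simp add: phase_of_def live_def)
  next
    case False
    have "l_mOp (ls u) \<noteq> r" if "u \<in> {1..N}" "live (ls u)"
    proof -
      have "base u (ls u) s g" using I that by (auto simp: decs_inv_def intro: thread_inv_base)
      then show ?thesis using r by (auto simp: base_def)
    qed
    then show ?thesis using False by (auto simp: phase_of_def live_def split: option.split)
  qed
qed

lemma step_new:
  assumes I: "decs_inv N h ls s g S" and i: "i \<in> {1..N}" and pc: "l_pc (ls i) = Start"
    and r: "r \<notin> o_alloc s" and c: "x = PUSH \<Longrightarrow> c \<notin> c_alloc s \<and> l_call (ls i) = Push d"
      "x = POP \<Longrightarrow> l_call (ls i) = Pop"
    and s': "s' = new_op i r x c (if x = PUSH then new_cell c d s else s)"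
  shows "\<exists>g' S'. decs_inv N h (ls(i := enter_loop ((ls i)\<lparr>l_mOp := r\<rparr>))) s' g' S'"
proof -
  let ?g = "g\<lparr>gh_own := (gh_own g)(r := i), gh_mode := (gh_mode g)(r := MHead),
      gh_res := (gh_res g)(r := None), gh_q := (gh_q g)(i := [r])\<rparr>"
  let ?l = "(ls i)\<lparr>l_mOp := r\<rparr>"
  have "thread_inv N i (ls i) s g" and G: "global_inv N s g" and S: "stacked s g S"
    and L: "\<exists>L. linearizing h L S (phase_of N ls (gh_res g))"
    using I i by (auto simp: decs_inv_def)
  then have q: "quiet i s g" using pc by simp
  have rn: "r \<noteq> null" using G r by (auto simp: global_inv_def)
  have cn: "c \<noteq> null" "c \<noteq> EMPTY_CELL" "c \<notin> gh_pub g" if "x = PUSH"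
    using G c(1)[OF that] by (auto simp: global_inv_def)
  have old: "c_alloc s \<subseteq> c_alloc s'" "c_next s' y = c_next s y" "c_data s' y = c_data s y"
    if "y \<in> c_alloc s" for y
    using that c(1) by (auto simp: s' new_op_def new_cell_def)
  have sub: "c_alloc s \<subseteq> c_alloc s'" by (auto simp: s' new_op_def new_cell_def)
  have "decs_inv N h (ls(i := enter_loop ?l)) s' ?g S"
  proof (rule inv_step[OF I i])
    show "thread_inv N i (enter_loop ?l) s' ?g"
    proof (rule thread_inv_enter)
      show "head i ?l s' ?g"
        using rn by (simp add: head_def leads_def hlist_def plist_def owned_def optype_def unres_def
          waits_def
            s' new_op_def new_cell_def)
      have "sole i r s' ?g" using q by (auto simp: sole_def quiet_def s' new_op_def new_cell_def
        split: if_splits)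
      then show "base i ?l s' ?g"
        using rn c by (cases x) (auto simp: base_def callop_def s' new_op_def new_cell_def)
      show "g_location s' i = null" using q by (simp add: quiet_def s' new_op_def new_cell_def)
    qed
    show "global_inv N s' ?g"
    proof (cases x)
      case PUSH
      then have x: "x = PUSH" .
      have A: "\<forall>r'\<in>o_alloc s. r' \<noteq> r" using r by auto
      have B: "\<forall>r'\<in>o_alloc s. r' \<noteq> null \<longrightarrow> o_op s r' = PUSH \<longrightarrow> o_cell s r' \<noteq> c"
        using G c(1)[OF x] by (auto simp: global_inv_def)
      have C: "\<forall>y\<in>gh_pub g. y \<noteq> c" using cn(3)[OF x] by auto
      show ?thesis using G A B C cn(1,2)[OF x] i unfolding global_inv_def by (auto
        simp: s' x new_op_def new_cell_def)
    next
      case POP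
      then show ?thesis using G r i by (auto simp: global_inv_def s' new_op_def)
    qed
    show "stacked s' ?g S"
    proof -
      obtain cs where cs: "lseg (c_next s) (g_central s) cs null" "set cs \<subseteq> gh_pub g"
        "S = rev (cells_data s cs)" using S by (auto simp: stacked_def)
      have a: "y \<in> c_alloc s" if "y \<in> set cs" for y using cs(2) G that by (auto simp: global_inv_def)
      have "lseg (c_next s') (g_central s') cs null"
      proof -
        have "g_central s' = g_central s" by (simp add: s' new_op_def new_cell_def)
        then show ?thesis using lseg_cong[OF cs(1)] old(2) a by metis
      qed
      moreover have "cells_data s' cs = cells_data s cs" using old(3) a by auto
      ultimately show ?thesis using cs(2,3) unfolding stacked_def by (intro exI[of _ cs]) simp
    qed
    show "\<exists>L. linearizing h L S (phase_of N (ls(i := enter_loop ?l)) (gh_res ?g))"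
      using L phase_of_new[OF I r pc, of "enter_loop ?l"] by (simp add: live_def)
    fix u
    assume u: "u \<in> {1..N}" "u \<noteq> i"
    have "rely u (l_mOp (ls u)) s g s' ?g"
      by (rule rely_new[OF G r u(2) sub _ _ _ _ _ refl])
        (use old r in \<open>auto simp: s' new_op_def new_cell_def\<close>)
    then show "rely u (l_mOp (ls u)) s g s' ?g \<or> thread_inv N u (ls u) s' ?g" ..
  qed
  then show ?thesis by blast
qed

section \<open>The invariant along executions\<close>

lemma inv_initial:
  assumes "initial N ls s"
  shows "\<exists>g S. decs_inv N [] ls s g S"
proof -
  let ?g = "\<lparr>gh_own = (\<lambda>_. 0), gh_mode = (\<lambda>_. MFin), gh_res = (\<lambda>_. None), gh_q = (\<lambda>_. []),
     gh_z = (\<lambda>_. []), gh_pub = {}\<rparr> :: 'a ghost"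
  have "phase_of N ls (gh_res ?g) = (\<lambda>_. Idling)"
    using assms by (auto simp: initial_def phase_of_def)
  then have "linearizing [] [] [] (phase_of N ls (gh_res ?g))" using linearizing_init by metis
  moreover have "global_inv N s ?g" using assms by (auto simp: initial_def global_inv_def EMPTY_def)
  moreover have "stacked s ?g []" using assms by (simp add: initial_def stacked_def)
  moreover have "thread_inv N t (ls t) s ?g" if "t \<in> {1..N}" for t
    using assms that by (auto simp: initial_def quiet_def)
  ultimately show ?thesis unfolding decs_inv_def by blast
qed

lemma inv_invoke:
  assumes I: "decs_inv N h ls s g S" and i: "i \<in> {1..N}" and pc: "l_pc (ls i) = Idle"
  shows "decs_inv N (h @ [Inv i c]) (ls(i := (ls i)\<lparr>l_call := c, l_pc := Start\<rparr>)) s g S"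
proof -
  let ?l = "(ls i)\<lparr>l_call := c, l_pc := Start\<rparr>"
  obtain L where L: "linearizing h L S (phase_of N ls (gh_res g))" using I by (auto simp: decs_inv_def)
  have "phase_of N ls (gh_res g) i = Idling" using pc by (simp add: phase_of_def)
  from linearizing_inv[OF L this, of c]
  have "linearizing (h @ [Inv i c]) L S ((phase_of N ls (gh_res g))(i := Pending c))" .
  moreover have "(phase_of N ls (gh_res g))(i := Pending c) = phase_of N (ls(i := ?l)) (gh_res g)"
    using i by (auto simp: phase_of_def fun_eq_iff split: option.split)
  ultimately have "\<exists>L. linearizing (h @ [Inv i c]) L S (phase_of N (ls(i := ?l)) (gh_res g))" by auto
  moreover have "thread_inv N i (ls i) s g" using I i by (simp add: decs_inv_def)
  then have "quiet i s g" using pc by simp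
  ultimately show ?thesis using I by (auto simp: decs_inv_def)
qed

lemma inv_respond:
  assumes I: "decs_inv N h ls s g S" and i: "i \<in> {1..N}" and pc: "l_pc (ls i) = Respond"
  shows "decs_inv N (h @ [Res i (l_resp (ls i))]) (ls(i := goto Idle (ls i))) s g S"
proof -
  let ?l = "goto Idle (ls i)"
  obtain L where L: "linearizing h L S (phase_of N ls (gh_res g))" and "thread_inv N i (ls i) s g"
    using I i by (auto simp: decs_inv_def)
  then have T: "base i (ls i) s g" "g_location s i = null" "gh_mode g (l_mOp (ls i)) = MFin"
    "gh_res g (l_mOp (ls i)) = Some (l_resp (ls i))" using pc by auto
  have "phase_of N ls (gh_res g) i = Linearized (l_call (ls i)) (l_resp (ls i))"
    using pc T(4) i by (simp add: phase_of_def)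
  from linearizing_res[OF L this]
  have "linearizing (h @ [Res i (l_resp (ls i))]) L S ((phase_of N ls (gh_res g))(i := Idling))" .
  moreover have "(phase_of N ls (gh_res g))(i := Idling) = phase_of N (ls(i := ?l)) (gh_res g)"
    by (auto simp: phase_of_def fun_eq_iff split: option.split)
  ultimately have "\<exists>L. linearizing (h @ [Res i (l_resp (ls i))]) L S (phase_of N (ls(i := ?l))
    (gh_res g))" by auto
  \<comment> \<open>By \<open>sole\<close> the returned record was the only one of this thread that
    could be unfinished, and it is \<open>MFin\<close>.\<close>
  moreover have "quiet i s g" using T(1,2,3) unfolding base_def sole_def quiet_def by metis
  ultimately show ?thesis using I by (auto simp: decs_inv_def)
qed

text \<open>At C5 a thread reads the entry of a thread about which its own assertion says nothing;
  the fact comes from the assertion of that other thread.\<close>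

lemma location_alloc:
  assumes I: "decs_inv N h ls s g S" and t: "t \<in> {1..N}"
  shows "g_location s t = null \<or> g_location s t \<in> o_alloc s"
proof -
  have T: "thread_inv N t (ls t) s g" using I t by (auto simp: decs_inv_def)
  have b: "l_mOp (ls t) \<in> o_alloc s" if "base t (ls t) s g" using that by (simp add: base_def)
  show ?thesis
  proof (cases "l_pc (ls t)")
    case (Col p)
    then show ?thesis using T b by (cases p) (auto simp: colp_def capt_def)
  next
    case (Pas p)
    then show ?thesis using T b by (cases p) (auto simp: capt_def)
  qed (use T in \<open>auto simp: quiet_def\<close>)
qed

lemma inv_exec:
  assumes I: "decs_inv N h ls s g S" and i: "i \<in> {1..N}"
    and e: "(l', s') \<in> exec (l_pc (ls i)) N i (ls i) s"
  shows "\<exists>g' S'. decs_inv N h (ls(i := l')) s' g' S'"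
proof -
  have T: "thread_inv N i (ls i) s g" and G: "global_inv N s g" and S: "stacked s g S" using I i
    by (auto simp: decs_inv_def)
  note loc = inv_locstep[OF I i]
  show ?thesis
  proof (cases "l_pc (ls i)")
    case Idle
    then show ?thesis using e by simp
  next
    case Respond
    then show ?thesis using e by simp
  next
    case Start
    show ?thesis
    proof (cases "l_call (ls i)")
      case (Push d)
      then obtain r c where *: "l' = enter_loop ((ls i)\<lparr>l_mOp := r\<rparr>)"
        "s' = new_op i r PUSH c (new_cell c d s)"
        "r \<notin> o_alloc s" "c \<notin> c_alloc s" using e Start by auto
      show ?thesis unfolding *(1)
        by (rule step_new[OF I i Start *(3), of PUSH c d]) (use * Push in auto)
    next
      case Pop
      then obtain r where *: "l' = enter_loop ((ls i)\<lparr>l_mOp := r\<rparr>)" "s' = new_op i r POP null s"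
        "r \<notin> o_alloc s" using e Start by auto
      show ?thesis unfolding *(1)
        by (rule step_new[OF I i Start *(3), of POP null]) (use * Pop in auto)
    qed
  next
    case Load1
    show ?thesis by (rule loc[OF locstep_load[OF T e]]) (simp_all add: Load1)
  next
    case Load2
    show ?thesis by (rule loc[OF locstep_load[OF T e]]) (simp_all add: Load2)
  next
    case (MPop p)
    have T': "pc_inv (MPop p) N i (ls i) s g" and e': "(l', s') \<in> exec_mpop p N i (ls i) s"
      using T e MPop by auto
    \<comment> \<open>Reads, writes, and the two points at which the outcome decides whether
      operations take effect.\<close>
    have "p \<in> {P5, P6, P7, P10, P11, P12, P14, P16, P17, P19, P20} \<or>
      p \<in> {P2, P3, P4, P9, P13, P15, P18, P21} \<or>
      p = P1 \<or> p = P8" by (cases p) auto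
    then consider (r) "p \<in> {P5, P6, P7, P10, P11, P12, P14, P16, P17, P19, P20}" |
      (w) "p \<in> {P2, P3, P4, P9, P13, P15, P18, P21}" |
      (f) "p = P1 \<and> g_central s \<noteq> null \<or> p = P8 \<and> g_central s \<noteq> l_top (ls i)" |
      (1) "p = P1" "g_central s = null" | (8) "p = P8" "g_central s = l_top (ls i)" by blast
    then show ?thesis
    proof cases
      case r
      show ?thesis by (rule loc[OF locstep_mpop_read[OF T' G e' r]]) (simp_all add: MPop)
    next
      case w
      show ?thesis by (rule loc[OF locstep_mpop_write[OF T' G e' w]]) (simp_all add: MPop)
    next
      case f
      show ?thesis by (rule loc[OF locstep_mpop_fail[OF T' S e' f]]) (simp_all add: MPop)
    next
      case 1
      then show ?thesis using step_pop_empty[OF I i] MPop e' by simp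
    next
      case 8
      then show ?thesis using step_pop[OF I i] MPop e' by simp
    qed
  next
    case (MPush p)
    have T': "pc_inv (MPush p) N i (ls i) s g" and e': "(l', s') \<in> exec_mpush p N i (ls i) s"
      using T e MPush by auto
    show ?thesis
    proof (cases "p = U6 \<and> g_central s = l_top (ls i)")
      case True
      then show ?thesis using step_push[OF I i] MPush e' by simp
    next
      case False
      show ?thesis by (rule loc[OF locstep_mpush[OF T' G S e' False]]) (simp_all add: MPush)
    qed
  next
    case (Col p)
    have T': "pc_inv (Col p) N i (ls i) s g" and e': "(l', s') \<in> exec_col p N i (ls i) s"
      using T e Col by auto
    show ?thesis by (rule loc[OF locstep_col[OF T' e' G location_alloc[OF I]]]) (simp_all add: Col)
  next
    case (Act p)
    have T': "pc_inv (Act p) N i (ls i) s g" and e': "(l', s') \<in> exec_act p N i (ls i) s"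
      using T e Act by auto
    show ?thesis
    proof (cases "p = A2 \<and> g_location s (l_id (ls i)) = l_pInf (ls i)")
      case True
      then show ?thesis using step_capture[OF I i] Act e' by simp
    next
      case False
      show ?thesis by (rule loc[OF locstep_act[OF T' e' False]]) (simp_all add: Act)
    qed
  next
    case (Pas p)
    have T': "pc_inv (Pas p) N i (ls i) s g" and e': "(l', s') \<in> exec_pas p N i (ls i) s"
      using T e Pas by auto
    show ?thesis by (rule loc[OF locstep_pas[OF T' e']]) (simp_all add: Pas)
  next
    case (Comb p)
    have T': "pc_inv (Comb p) N i (ls i) s g" and e': "(l', s') \<in> exec_comb p N i (ls i) s"
      using T e Comb by auto
    show ?thesis by (rule loc[OF locstep_comb[OF T' e' G]]) (simp_all add: Comb)
  next
    case (Elim p)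
    have T': "pc_inv (Elim p) N i (ls i) s g" and e': "(l', s') \<in> exec_elim p N i (ls i) s"
      using T e Elim by auto
    have lv: "live (ls i)" using Elim by (simp add: live_def)
    show ?thesis
    proof (cases "p = E18 \<or> p = E23")
      case True
      then show ?thesis using T' e' step_retry[OF I i lv] by auto
    next
      case False
      then show ?thesis by (intro loc[OF locstep_elim[OF T' e']]) (simp_all add: Elim)
    qed
  qed
qed

lemma decs_execution_inv:
  "decs_execution N h ls s \<Longrightarrow> \<exists>g S. decs_inv N h ls s g S"
proof (induction rule: decs_execution.induct)
  case (init ls s)
  then show ?case by (rule inv_initial)
next
  case (invoke h ls s i c)
  then show ?case using inv_invoke by blast
next
  case (step h ls s i l' s')
  then show ?case using inv_exec by blast
next
  case (respond h ls s i)
  then show ?case using inv_respond by blast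
qed

theorem theorem2:
  fixes N :: nat and h :: "('v call, 'v resp) history"
  assumes "N \<ge> 1"
    and "h \<in> decs_histories N"
  shows "linearizable stack_legal h"
proof -
  obtain ls s g S where "decs_inv N h ls s g S"
    using assms(2) decs_execution_inv unfolding decs_histories_def by blast
  then show ?thesis using linearizing_linearizable by (auto simp: decs_inv_def)
qed

end
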